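(* A strongly permutative epigroup variety $\mathcal V$ is a codistributive element of the lattice $\mathbf{EPI}$ if and only if $\mathcal V=\mathcal G\vee\mathcal X$ where $\mathcal G$ is an Abelian group variety, while $\mathcal X$ is one of the varieties $\mathcal T$, $\mathcal{SL}$, $\mathcal{ZM}$ or $\mathcal{SL}\vee\mathcal{ZM}$.
   Context: An epigroup is a semigroup $S$ such that for every $x\in S$ some power $x^n$ ($n\ge 1$) lies in a subgroup of $S$. For $x\in S$ some power of $x$ lies in a maximal subgroup $G_x$ of $S$; its unit is denoted $x^\omega$. Then $xx^\omega=x^\omega x\in G_x$, and the pseudoinverse $\overline{x}$ of $x$ is the inverse of $xx^\omega$ in $G_x$. Epigroups are considered as algebras with multiplication and the unary operation $x\mapsto\overline{x}$; an epigroup variety is a variety of such algebras consisting of epigroups. $\mathbf{EPI}$ is the lattice of all epigroup varieties under inclusion: $\wedge$ is intersection, and $\mathcal X\vee\mathcal Y$ is the least epigroup variety containing $\mathcal X$ and $\mathcal Y$. Periodic semigroup varieties are identified with periodic epigroup varieties (in periodic epigroups pseudoinversion is expressible through multiplication). A variety is strongly permutative if it satisfies an identity $x_1x_2\cdots x_n=x_{1\pi}x_{2\pi}\cdots x_{n\pi}$ for some $n$ and some permutation $\pi$ of $\{1,\dots,n\}$ with $1\pi\ne1$ and $n\pi\ne n$. An Abelian group variety is an epigroup variety all of whose members are Abelian groups (possibly the trivial variety). $\mathcal T$ is the trivial variety, $\mathcal{SL}$ the variety of all semilattices, $\mathcal{ZM}$ the variety of all semigroups with zero multiplication. An element $x$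 of a lattice $\langle L;\vee,\wedge\rangle$ is codistributive if $x\wedge(y\vee z)=(x\wedge y)\vee(x\wedge z)$ for all $y,z\in L$. *)

theory Defs
  imports "HOL-Combinatorics.Permutations" "HOL-Algebra.Lattice" "HOL-Algebra.Group"
begin

section \<open>Epigroups\<close>

text \<open>
  The operations are total functions on the ambient type; only their values on the carrier matter.
\<close>

record 'a unary_semigroup = "'a partial_object" +
  mul :: "'a \<Rightarrow> 'a \<Rightarrow> 'a"
  pinv :: "'a \<Rightarrow> 'a"

definition algebra :: "'a unary_semigroup \<Rightarrow> bool" where
  "algebra A \<longleftrightarrow> carrier A \<noteq> {} \<and>
     (\<forall>x\<in>carrier A. \<forall>y\<in>carrier A. mul A x y \<in> carrier A) \<and>
     (\<forall>x\<in>carrier A. pinv A x \<in> carrier A)"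

definition associative :: "'a unary_semigroup \<Rightarrow> bool" where
  "associative A \<longleftrightarrow>
     (\<forall>x\<in>carrier A. \<forall>y\<in>carrier A. \<forall>z\<in>carrier A.
        mul A (mul A x y) z = mul A x (mul A y z))"

text \<open>\<open>sg_power A x n\<close> is $x^n$ for $n \geq 1$; its value at $n = 0$ is irrelevant.\<close>

definition sg_power :: "'a unary_semigroup \<Rightarrow> 'a \<Rightarrow> nat \<Rightarrow> 'a" where
  "sg_power A x n = ((\<lambda>y. mul A y x) ^^ (n - 1)) x"

definition as_monoid :: "'a unary_semigroup \<Rightarrow> 'a set \<Rightarrow> 'a \<Rightarrow> 'a monoid" where
  "as_monoid A H e = \<lparr>carrier = H, mult = mul A, one = e\<rparr>"

text \<open>\<open>H\<close> is a subgroup of the semigroup \<open>A\<close> and \<open>e\<close> is its unit.\<close>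

definition sg_subgroup :: "'a unary_semigroup \<Rightarrow> 'a set \<Rightarrow> 'a \<Rightarrow> bool" where
  "sg_subgroup A H e \<longleftrightarrow> H \<subseteq> carrier A \<and> group (as_monoid A H e)"

definition maximal_subgroup :: "'a unary_semigroup \<Rightarrow> 'a set \<Rightarrow> 'a \<Rightarrow> bool" where
  "maximal_subgroup A H e \<longleftrightarrow> sg_subgroup A H e \<and>
     (\<forall>K f. sg_subgroup A K f \<and> H \<subseteq> K \<longrightarrow> K = H)"

text \<open>
  \<open>y\<close> is the inverse of $x x^\omega$ in $G_x$. Here \<open>H\<close> and \<open>e\<close> are $G_x$ and $x^\omega$, both of
  which are uniquely determined by \<open>x\<close>.
\<close>

definition is_pseudoinverse :: "'a unary_semigroup \<Rightarrow> 'a \<Rightarrow> 'a \<Rightarrow> bool" where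
  "is_pseudoinverse A x y \<longleftrightarrow>
     (\<exists>H e n. n \<ge> 1 \<and> maximal_subgroup A H e \<and> sg_power A x n \<in> H \<and>
        y = inv\<^bsub>as_monoid A H e\<^esub> (mul A x e))"

definition epigroup :: "'a unary_semigroup \<Rightarrow> bool" where
  "epigroup A \<longleftrightarrow> algebra A \<and> associative A \<and>
     (\<forall>x\<in>carrier A. \<exists>n\<ge>1. \<exists>H e. sg_subgroup A H e \<and> sg_power A x n \<in> H) \<and>
     (\<forall>x\<in>carrier A. is_pseudoinverse A x (pinv A x))"

section \<open>Identities and varieties\<close>

datatype uterm = Var nat | Mul uterm uterm | Inv uterm

primrec eval_uterm :: "'a unary_semigroup \<Rightarrow> (nat \<Rightarrow> 'a) \<Rightarrow> uterm \<Rightarrow> 'a" where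
  "eval_uterm A v (Var i) = v i"
| "eval_uterm A v (Mul s t) = mul A (eval_uterm A v s) (eval_uterm A v t)"
| "eval_uterm A v (Inv t) = pinv A (eval_uterm A v t)"

definition satisfies :: "'a unary_semigroup \<Rightarrow> uterm \<Rightarrow> uterm \<Rightarrow> bool" where
  "satisfies A s t \<longleftrightarrow>
     (\<forall>v. (\<forall>i. v i \<in> carrier A) \<longrightarrow> eval_uterm A v s = eval_uterm A v t)"

text \<open>
  HOL has no class of all algebras, so a variety is an equational class of algebras whose carriers
  are subsets of the type \<open>'a\<close>. If \<open>'a\<close> is infinite, this class contains, up to isomorphism, all
  countable members of the corresponding proper class, among them its free algebra of countably
  infinite rank, so that it determines the identities of the variety and the inclusion order is
  the usual one. Likewise, whether a variety consists of epigroups depends only on its countable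
  members.
\<close>

definition variety :: "'a unary_semigroup set \<Rightarrow> bool" where
  "variety V \<longleftrightarrow>
     (\<exists>\<Sigma> :: (uterm \<times> uterm) set. V = {A. algebra A \<and> (\<forall>(s, t)\<in>\<Sigma>. satisfies A s t)})"

definition epigroup_variety :: "'a unary_semigroup set \<Rightarrow> bool" where
  "epigroup_variety V \<longleftrightarrow> variety V \<and> (\<forall>A\<in>V. epigroup A)"

definition EPI :: "'a unary_semigroup set gorder" where
  "EPI = \<lparr>carrier = {V. epigroup_variety V}, eq = (=), le = (\<subseteq>)\<rparr>"

definition codistributive :: "('b, 'c) gorder_scheme \<Rightarrow> 'b \<Rightarrow> bool" where
  "codistributive L x \<longleftrightarrow> x \<in> carrier L \<and>
     (\<forall>y\<in>carrier L. \<forall>z\<in>carrier L.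
        x \<sqinter>\<^bsub>L\<^esub> (y \<squnion>\<^bsub>L\<^esub> z) = (x \<sqinter>\<^bsub>L\<^esub> y) \<squnion>\<^bsub>L\<^esub> (x \<sqinter>\<^bsub>L\<^esub> z))"

section \<open>Particular varieties\<close>

text \<open>The word $x_{1\sigma} x_{2\sigma} \cdots x_{n\sigma}$ for $n \geq 1$.\<close>

definition linear_word :: "(nat \<Rightarrow> nat) \<Rightarrow> nat \<Rightarrow> uterm" where
  "linear_word \<sigma> n = foldl (\<lambda>t i. Mul t (Var (\<sigma> i))) (Var (\<sigma> 1)) [2..<Suc n]"

text \<open>The conditions on \<open>\<pi>\<close> force $n \geq 2$.\<close>

definition strongly_permutative :: "'a unary_semigroup set \<Rightarrow> bool" where
  "strongly_permutative V \<longleftrightarrow>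
     (\<exists>n \<pi>. \<pi> permutes {1..n} \<and> \<pi> 1 \<noteq> 1 \<and> \<pi> n \<noteq> n \<and>
        (\<forall>A\<in>V. satisfies A (linear_word id n) (linear_word \<pi> n)))"

text \<open>The unary operation of a group, viewed as an epigroup, is necessarily group inversion.\<close>

definition abelian_group_variety :: "'a unary_semigroup set \<Rightarrow> bool" where
  "abelian_group_variety V \<longleftrightarrow> epigroup_variety V \<and>
     (\<forall>A\<in>V. \<exists>e. comm_group (as_monoid A (carrier A) e))"

definition trivial_variety :: "'a unary_semigroup set" where
  "trivial_variety = {A. epigroup A \<and> (\<exists>a. carrier A = {a})}"

definition SL :: "'a unary_semigroup set" where
  "SL = {A. epigroup A \<and>
     (\<forall>x\<in>carrier A. mul A x x = x) \<and>
     (\<forall>x\<in>carrier A. \<forall>y\<in>carrier A. mul A x y = mul A y x)}"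

definition ZM :: "'a unary_semigroup set" where
  "ZM = {A. epigroup A \<and>
     (\<exists>z\<in>carrier A. \<forall>x\<in>carrier A. \<forall>y\<in>carrier A. mul A x y = z)}"

end

theory Submission
  imports Defs "HOL-Library.Countable" "HOL-Algebra.FiniteProduct"
begin

text \<open>
  Write \<open>x\<^sup>\<omega>\<close> for the product of \<open>x\<close> with its pseudoinverse (\<open>om x\<close> below). Both sides of the
  equivalence turn out to mean the same third thing: every member of \<open>V\<close> satisfies \<open>xy = yx\<close> and
  \<open>x\<^sup>\<omega>xy = xy\<close>, so that its products form a commutative Clifford semigroup (\<open>clifford_squares\<close>).

  Suppose first that \<open>V\<close> satisfies these two identities, and take an identity \<open>s = t\<close> and values
  \<open>x\<^sub>i\<close> of its variables in a member of \<open>V\<close>. Multiplication by the product \<open>e\<close> of the idempotents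
  \<open>x\<^sub>i\<^sup>\<omega>\<close> moves the values of \<open>s\<close> and \<open>t\<close> into the maximal subgroup at \<open>e\<close>, an abelian group
  belonging to \<open>V\<close>. It changes nothing if \<open>s\<close> and \<open>t\<close> are not bare variables and contain the same
  variables, and the two cases in which these conditions fail are controlled by \<open>ZM\<close> and
  \<open>SL\<close>. Hence an identity holds in \<open>V\<close> as soon as it holds in the abelian groups of \<open>V\<close> and in
  those of the varieties \<open>SL\<close> and \<open>ZM\<close> that lie in \<open>V\<close> (\<open>identity_from_parts\<close>). This says at once
  that \<open>V\<close> is the join of these parts (\<open>clifford_squares_decomposition\<close>).

  It also gives codistributivity (\<open>clifford_squares_codistributive\<close>), because each part can be
  treated separately. \<open>SL\<close> and \<open>ZM\<close> are join prime. For abelian groups, the identities are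
  governed by exponents: the exponents of a variety form a subgroup of the integers, joins of
  varieties correspond to intersections, a cyclic group shows that meets correspond to sums, and
  the lattice of subgroups of the integers is distributive.

  Conversely, let \<open>V\<close> be strongly permutative. Substituting idempotents into the permutation
  identity makes all idempotents central and all local submonoids commutative
  (\<open>strongly_permutative_central\<close>). Let \<open>N\<close> be the nilpotent semigroup with elements
  \<open>a\<close>, \<open>b\<close>, \<open>ab = ba\<close> and \<open>0\<close>. If \<open>N\<close> is not in \<open>V\<close>, then \<open>V\<close> satisfies an identity failing in \<open>N\<close>. Up to
  symmetry it is \<open>x = t\<close> with \<open>t \<noteq> x\<close>, or \<open>xy = t\<close> where \<open>t\<close> is compound and neither \<open>xy\<close> nor \<open>yx\<close>, and every
  such identity forces \<open>V\<close> to have Clifford squares (\<open>clifford_squares_unless_nil_square\<close>).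
  If \<open>N\<close> is in \<open>V\<close>, then \<open>V\<close> is not codistributive: take for \<open>Y\<close> and \<open>Z\<close> the varieties of aperiodic
  semigroups with \<open>xy = xxy\<close> and with \<open>xy = xyy\<close>. Neither contains \<open>N\<close>, so the meets of \<open>V\<close> with
  \<open>Y\<close> and with \<open>Z\<close> have Clifford squares by the previous case, and so has the join of these meets. But
  the identities common to \<open>Y\<close> and \<open>Z\<close> all hold in \<open>N\<close>, so \<open>N\<close> is in the meet of \<open>V\<close> with the join
  of \<open>Y\<close> and \<open>Z\<close> (\<open>codistributive_clifford_squares\<close>).
\<close>

section \<open>Equational logic\<close>

primrec vars :: "uterm \<Rightarrow> nat set" where
  "vars (Var i) = {i}"
| "vars (Mul s t) = vars s \<union> vars t"
| "vars (Inv t) = vars t"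

primrec subst :: "(nat \<Rightarrow> uterm) \<Rightarrow> uterm \<Rightarrow> uterm" where
  "subst w (Var i) = w i"
| "subst w (Mul s t) = Mul (subst w s) (subst w t)"
| "subst w (Inv t) = Inv (subst w t)"

definition identities :: "'a unary_semigroup set \<Rightarrow> (uterm \<times> uterm) set" where
  "identities V = {(s, t). \<forall>A\<in>V. satisfies A s t}"

definition models :: "(uterm \<times> uterm) set \<Rightarrow> 'a unary_semigroup set" where
  "models E = {A. algebra A \<and> (\<forall>(s, t)\<in>E. satisfies A s t)}"

lemma finite_vars [simp]: "finite (vars t)"
  by (induction t) auto

lemma vars_nonempty: "vars t \<noteq> {}"
  by (induction t) auto

lemma vars_subst: "vars (subst w t) = (\<Union>i\<in>vars t. vars (w i))"
  by (induction t) auto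

lemma eval_subst: "eval_uterm A v (subst w t) = eval_uterm A (\<lambda>i. eval_uterm A v (w i)) t"
  by (induction t) auto

lemma eval_cong: "(\<And>i. i \<in> vars t \<Longrightarrow> v i = w i) \<Longrightarrow> eval_uterm A v t = eval_uterm A w t"
  by (induction t) auto

lemma eval_closed:
  assumes "algebra A" "\<And>i. v i \<in> carrier A"
  shows "eval_uterm A v t \<in> carrier A"
  using assms(2) by (induction t) (use assms(1) in \<open>auto simp: algebra_def\<close>)

lemma satisfiesD:
  "satisfies A s t \<Longrightarrow> (\<And>i. v i \<in> carrier A) \<Longrightarrow> eval_uterm A v s = eval_uterm A v t"
  by (simp add: satisfies_def)

lemma satisfies_sym: "satisfies A s t \<longleftrightarrow> satisfies A t s"
  by (auto simp: satisfies_def)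

lemma models_variety: "variety (models E)"
  unfolding variety_def models_def by blast

lemma variety_models: "variety V \<Longrightarrow> models (identities V) = V"
  unfolding variety_def models_def identities_def by fast

lemma varietyI_models: "V = models E \<Longrightarrow> variety V"
  using models_variety by blast

lemma identities_algebra:
  "variety V \<Longrightarrow> A \<in> V \<Longrightarrow> algebra A"
  unfolding variety_def by blast

lemma in_varietyI:
  assumes "variety V" "algebra A" "\<And>s t. (s, t) \<in> identities V \<Longrightarrow> satisfies A s t"
  shows "A \<in> V"
proof -
  have "A \<in> models (identities V)" using assms(2,3) by (auto simp: models_def)
  then show ?thesis using variety_models[OF assms(1)] by simp
qed

lemma subalgebra_in_variety:
  assumes V: "variety V" "A \<in> V"
    and B: "B \<subseteq> carrier A" "B \<noteq> {}"
      "\<And>x y. x \<in> B \<Longrightarrow> y \<in> B \<Longrightarrow> mul A x y \<in> B" "\<And>x. x \<in> B \<Longrightarrow> pinv A x \<in> B"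
  shows "A\<lparr>carrier := B\<rparr> \<in> V"
proof (rule in_varietyI[OF V(1)])
  show "algebra (A\<lparr>carrier := B\<rparr>)" using B by (auto simp: algebra_def)
next
  have eval: "eval_uterm (A\<lparr>carrier := B\<rparr>) v t = eval_uterm A v t" for v t
    by (induction t) auto
  fix s t assume "(s, t) \<in> identities V"
  then have "satisfies A s t" using V(2) by (auto simp: identities_def)
  then show "satisfies (A\<lparr>carrier := B\<rparr>) s t"
    using B(1) by (auto simp: satisfies_def eval)
qed

text \<open>
  Concrete algebras are built on a convenient countable type, and an injection carries them into
  \<open>'a\<close> without changing their identities.
\<close>

definition copy :: "('b \<Rightarrow> 'a) \<Rightarrow> 'b unary_semigroup \<Rightarrow> 'a unary_semigroup" where
  "copy h B = \<lparr>carrier = h ` carrier B,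
     mul = (\<lambda>x y. h (mul B (inv_into UNIV h x) (inv_into UNIV h y))), pinv = (\<lambda>x. h (pinv B (inv_into UNIV h x)))\<rparr>"

lemma eval_copy:
  assumes "inj h"
  shows "eval_uterm (copy h B) (\<lambda>i. h (v i)) t = h (eval_uterm B v t)"
  using assms by (induction t) (auto simp: copy_def)

lemma algebra_copy: "inj h \<Longrightarrow> algebra B \<Longrightarrow> algebra (copy h B)"
  by (auto simp: algebra_def copy_def)

lemma satisfies_copy:
  assumes h: "inj h"
  shows "satisfies (copy h B) s t \<longleftrightarrow> satisfies B s t"
proof
  assume L: "satisfies (copy h B) s t"
  show "satisfies B s t"
    unfolding satisfies_def
  proof (intro allI impI)
    fix v :: "nat \<Rightarrow> _" assume "\<forall>i. v i \<in> carrier B"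
    then have "eval_uterm (copy h B) (\<lambda>i. h (v i)) s = eval_uterm (copy h B) (\<lambda>i. h (v i)) t"
      by (intro satisfiesD[OF L]) (auto simp: copy_def)
    then show "eval_uterm B v s = eval_uterm B v t"
      using h by (simp add: eval_copy inj_eq)
  qed
next
  assume R: "satisfies B s t"
  show "satisfies (copy h B) s t"
    unfolding satisfies_def
  proof (intro allI impI)
    fix v :: "nat \<Rightarrow> _" assume v: "\<forall>i. v i \<in> carrier (copy h B)"
    then have "\<forall>i. \<exists>b\<in>carrier B. v i = h b" by (auto simp: copy_def)
    then obtain w where w: "\<And>i. w i \<in> carrier B" "\<And>i. v i = h (w i)" by metis
    then have "v = (\<lambda>i. h (w i))" by auto
    then show "eval_uterm (copy h B) v s = eval_uterm (copy h B) v t"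
      using satisfiesD[OF R, of w] w h by (simp add: eval_copy)
  qed
qed

lemma injection_into_infinite:
  assumes "infinite (UNIV :: 'a set)"
  obtains h :: "'b::countable \<Rightarrow> 'a" where "inj h"
proof -
  obtain f :: "nat \<Rightarrow> 'a" where f: "inj f"
    using infinite_countable_subset[OF assms] by blast
  have "inj (\<lambda>x :: 'b. f (to_nat x))"
    using inj_compose[OF f inj_to_nat] by (simp add: comp_def)
  then show ?thesis using that by blast
qed

instance uterm :: countable
  by countable_datatype

lemma identities_subst:
  assumes "\<And>A. A \<in> V \<Longrightarrow> algebra A"
    and st: "(s, t) \<in> identities V" and w: "\<And>i. (w i, w' i) \<in> identities V"
  shows "(subst w s, subst w' t) \<in> identities V"
proof -
  have "satisfies A (subst w s) (subst w' t)" if A: "A \<in> V" for A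
    unfolding satisfies_def
  proof (intro allI impI)
    fix v :: "nat \<Rightarrow> _" assume v: "\<forall>i. v i \<in> carrier A"
    have "eval_uterm A v (w i) = eval_uterm A v (w' i)" for i
      using w[of i] A v by (auto simp: identities_def intro!: satisfiesD)
    moreover have "satisfies A s t" using st A by (auto simp: identities_def)
    ultimately show "eval_uterm A v (subst w s) = eval_uterm A v (subst w' t)"
      using v assms(1)[OF A] by (auto simp: eval_subst eval_closed intro!: satisfiesD)
  qed
  then show ?thesis by (auto simp: identities_def)
qed

text \<open>
  The algebra is the relatively free one of countable rank: terms modulo the identities of \<open>V\<close>, each
  class named by a chosen representative. There are only countably many terms, so it fits into
  \<open>'a\<close>. What it is for is the last clause, which turns a fact about its generators into an identity
  of the whole variety.
\<close>

lemma free_algebra: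
  fixes V :: "'a unary_semigroup set"
  assumes inf: "infinite (UNIV :: 'a set)" and V: "variety V"
  obtains F v where "F \<in> V" "\<And>i. v i \<in> carrier F"
    "\<And>s t. eval_uterm F v s = eval_uterm F v t \<Longrightarrow> (s, t) \<in> identities V"
proof -
  have alg: "\<And>A. A \<in> V \<Longrightarrow> algebra A" using V identities_algebra by blast
  define rep where "rep s = (SOME t. (s, t) \<in> identities V)" for s
  have refl: "(s, s) \<in> identities V" for s by (simp add: identities_def satisfies_def)
  have sym: "(t, s) \<in> identities V" if "(s, t) \<in> identities V" for s t
    using that by (auto simp: identities_def satisfies_def)
  have trans: "(s, u) \<in> identities V" if "(s, t) \<in> identities V" "(t, u) \<in> identities V" for s t u
    using that by (auto simp: identities_def satisfies_def)
  have rep: "(s, rep s) \<in> identities V" for s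
    unfolding rep_def by (rule someI[of _ s]) (rule refl)
  have rep_eq: "rep s = rep t \<longleftrightarrow> (s, t) \<in> identities V" for s t
  proof
    assume "rep s = rep t" then show "(s, t) \<in> identities V" using rep sym trans by metis
  next
    assume "(s, t) \<in> identities V"
    then have "(\<lambda>u. (s, u) \<in> identities V) = (\<lambda>u. (t, u) \<in> identities V)"
      using sym trans by blast
    then show "rep s = rep t" by (simp add: rep_def)
  qed
  have rep_rep: "rep (rep s) = rep s" for s using rep rep_eq sym by blast
  define Q where "Q = \<lparr>carrier = range rep, mul = (\<lambda>s t. rep (Mul s t)), pinv = (\<lambda>t. rep (Inv t))\<rparr>"
  have algQ: "algebra Q" by (auto simp: algebra_def Q_def)
  have evalQ: "eval_uterm Q (\<lambda>i. rep (w i)) t = rep (subst w t)" for w t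
  proof (induction t)
    case (Mul s t)
    have "satisfies A (Mul (rep (subst w s)) (rep (subst w t))) (Mul (subst w s) (subst w t))"
      if "A \<in> V" for A
      using that rep[of "subst w s"] rep[of "subst w t"]
      by (auto simp: identities_def satisfies_def)
    then show ?case
      using Mul by (auto simp: Q_def rep_eq identities_def)
  next
    case (Inv t)
    have "satisfies A (Inv (rep (subst w t))) (Inv (subst w t))" if "A \<in> V" for A
      using that rep[of "subst w t"] by (auto simp: identities_def satisfies_def)
    then show ?case
      using Inv by (auto simp: Q_def rep_eq identities_def)
  qed auto
  obtain h :: "uterm \<Rightarrow> 'a" where h: "inj h"
    using injection_into_infinite[OF inf] by blast
  show ?thesis
  proof
    show "copy h Q \<in> V"
    proof (rule in_varietyI[OF V algebra_copy[OF h algQ]])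
      fix s t assume st: "(s, t) \<in> identities V"
      have "satisfies Q s t"
        unfolding satisfies_def
      proof (intro allI impI)
        fix v :: "nat \<Rightarrow> _" assume "\<forall>i. v i \<in> carrier Q"
        then have "rep (v i) = v i" for i
          by (smt (verit, best) Q_def imageE partial_object.select_convs(1) rep_rep)
        then have "v = (\<lambda>i. rep (v i))" by simp
        then show "eval_uterm Q v s = eval_uterm Q v t"
          using evalQ[of v s] evalQ[of v t] identities_subst[OF alg st, of v v] refl
          by (simp add: rep_eq)
      qed
      then show "satisfies (copy h Q) s t" using h by (simp add: satisfies_copy)
    qed
    show "h (rep (Var i)) \<in> carrier (copy h Q)" for i by (auto simp: copy_def Q_def)
    fix s t
    assume "eval_uterm (copy h Q) (\<lambda>i. h (rep (Var i))) s
      = eval_uterm (copy h Q) (\<lambda>i. h (rep (Var i))) t"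
    then have "rep (subst Var s) = rep (subst Var t)"
      using injD[OF h] evalQ[of Var] eval_copy[OF h, of Q "\<lambda>i. rep (Var i)"] by auto
    moreover have "subst Var u = u" for u by (induction u) auto
    ultimately show "(s, t) \<in> identities V" by (simp add: rep_eq)
  qed
qed

section \<open>Equational description of epigroups\<close>

locale sg =
  fixes A :: "'a unary_semigroup"
  assumes algebra: "algebra A" and associative: "associative A"
begin

abbreviation prod (infixl "\<cdot>" 70) where "x \<cdot> y \<equiv> mul A x y"
abbreviation C where "C \<equiv> carrier A"

lemma mul_closed [simp, intro]: "x \<in> C \<Longrightarrow> y \<in> C \<Longrightarrow> x \<cdot> y \<in> C"
  using algebra by (simp add: algebra_def)

lemma pinv_closed [simp, intro]: "x \<in> C \<Longrightarrow> pinv A x \<in> C"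
  using algebra by (simp add: algebra_def)

lemma assoc: "x \<in> C \<Longrightarrow> y \<in> C \<Longrightarrow> z \<in> C \<Longrightarrow> x \<cdot> y \<cdot> z = x \<cdot> (y \<cdot> z)"
  using associative by (simp add: associative_def)

text \<open>\<open>pw x n\<close> is the power of \<open>x\<close> with exponent \<open>n + 1\<close>; semigroups have no zeroth power.\<close>

definition pw :: "'a \<Rightarrow> nat \<Rightarrow> 'a" where
  "pw x n = ((\<lambda>y. y \<cdot> x) ^^ n) x"

lemma sg_power_pw: "sg_power A x n = pw x (n - 1)"
  by (simp add: sg_power_def pw_def)

lemma pw_0 [simp]: "pw x 0 = x"
  by (simp add: pw_def)

lemma pw_Suc: "pw x (Suc n) = pw x n \<cdot> x"
  by (simp add: pw_def)

lemma pw_closed [simp, intro]: "x \<in> C \<Longrightarrow> pw x n \<in> C"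
  by (induction n) (auto simp: pw_Suc)

lemma pw_add: "x \<in> C \<Longrightarrow> pw x m \<cdot> pw x n = pw x (Suc (m + n))"
  by (induction n) (auto simp: pw_Suc assoc [symmetric])

lemma pw_Suc': "x \<in> C \<Longrightarrow> pw x (Suc n) = x \<cdot> pw x n"
  using pw_add[of x 0 n] by simp

lemma pw_pw: "x \<in> C \<Longrightarrow> pw (pw x m) n = pw x (m + n * Suc m)"
  by (induction n) (auto simp: pw_Suc pw_add algebra_simps)

lemma pw_commute: "x \<in> C \<Longrightarrow> y \<in> C \<Longrightarrow> x \<cdot> y = y \<cdot> x \<Longrightarrow> pw x n \<cdot> y = y \<cdot> pw x n"
proof (induction n)
  case (Suc n)
  then show ?case using assoc[of y "pw x n" x] assoc[of "pw x n" y x] by (simp add: pw_Suc assoc)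
qed simp

text \<open>The largest subgroup with unit \<open>e\<close>: the units of the local submonoid at \<open>e\<close>.\<close>

definition units :: "'a \<Rightarrow> 'a set" where
  "units e = {h\<in>C. e \<cdot> h = h \<and> h \<cdot> e = h \<and>
     (\<exists>k\<in>C. e \<cdot> k = k \<and> k \<cdot> e = k \<and> h \<cdot> k = e \<and> k \<cdot> h = e)}"

lemma units_mult:
  assumes e: "e \<in> C" and h: "h \<in> units e" "h' \<in> units e"
  shows "h \<cdot> h' \<in> units e"
proof -
  obtain k k' where k: "h \<in> C" "e \<cdot> h = h" "h \<cdot> e = h" "k \<in> C" "e \<cdot> k = k" "k \<cdot> e = k"
      "h \<cdot> k = e" "k \<cdot> h = e"
    and k': "h' \<in> C" "e \<cdot> h' = h'" "h' \<cdot> e = h'" "k' \<in> C" "e \<cdot> k' = k'" "k' \<cdot> e = k'"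
      "h' \<cdot> k' = e" "k' \<cdot> h' = e"
    using h unfolding units_def by blast
  have "h \<cdot> h' \<cdot> (k' \<cdot> k) = h \<cdot> (h' \<cdot> k') \<cdot> k" "k' \<cdot> k \<cdot> (h \<cdot> h') = k' \<cdot> (k \<cdot> h) \<cdot> h'"
    using k(1,4) k'(1,4) by (simp_all add: assoc)
  then have "h \<cdot> h' \<cdot> (k' \<cdot> k) = e" "k' \<cdot> k \<cdot> (h \<cdot> h') = e" using k k' by simp_all
  moreover have "e \<cdot> (h \<cdot> h') = h \<cdot> h'" "h \<cdot> h' \<cdot> e = h \<cdot> h'" "e \<cdot> (k' \<cdot> k) = k' \<cdot> k" "k' \<cdot> k \<cdot> e = k' \<cdot> k"
    using assoc[of e h h'] assoc[of h h' e] assoc[of e k' k] assoc[of k' k e] e k k' by simp_all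
  ultimately show ?thesis using k(1,4) k'(1,4) unfolding units_def by blast
qed

lemma unit_in_units: "e \<in> C \<Longrightarrow> e \<cdot> e = e \<Longrightarrow> e \<in> units e"
  by (auto simp: units_def)

lemma units_subgroup:
  assumes e: "e \<in> C" "e \<cdot> e = e"
  shows "sg_subgroup A (units e) e"
proof -
  have "group (as_monoid A (units e) e)"
  proof (rule groupI)
    show "\<And>x. x \<in> carrier (as_monoid A (units e) e) \<Longrightarrow>
      \<exists>y\<in>carrier (as_monoid A (units e) e). y \<otimes>\<^bsub>as_monoid A (units e) e\<^esub> x = \<one>\<^bsub>as_monoid A (units e) e\<^esub>"
      by (auto simp: as_monoid_def units_def)
  qed (use units_mult[OF e(1)] unit_in_units[OF e] in \<open>auto simp: as_monoid_def units_def assoc\<close>)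
  then show ?thesis by (auto simp: sg_subgroup_def units_def)
qed

lemma subgroup_units:
  assumes "sg_subgroup A H e"
  shows "e \<in> C" "e \<cdot> e = e" "H \<subseteq> units e"
proof -
  interpret group "as_monoid A H e" using assms by (simp add: sg_subgroup_def)
  have H: "H \<subseteq> C" using assms by (simp add: sg_subgroup_def)
  show "e \<in> C" "e \<cdot> e = e" using H one_closed l_one[of e] by (auto simp: as_monoid_def)
  show "H \<subseteq> units e"
  proof
    fix h assume h: "h \<in> H"
    define k where "k = inv\<^bsub>as_monoid A H e\<^esub> h"
    have "k \<in> H" "k \<cdot> h = e" "h \<cdot> k = e"
      using inv_closed[of h] l_inv[of h] r_inv[of h] h by (simp_all add: k_def as_monoid_def)
    then show "h \<in> units e"
      using h H l_one[of h] r_one[of h] l_one[of k] r_one[of k] by (auto simp: units_def as_monoid_def)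
  qed
qed

text \<open>
  A group contains no idempotent besides its unit, so a subgroup that contains \<open>units e\<close> has unit \<open>e\<close>
  and is contained in \<open>units e\<close>.
\<close>

lemma maximal_subgroup_units:
  "maximal_subgroup A H e \<longleftrightarrow> e \<in> C \<and> e \<cdot> e = e \<and> H = units e"
proof
  assume max: "maximal_subgroup A H e"
  then have H: "sg_subgroup A H e" by (simp add: maximal_subgroup_def)
  have "sg_subgroup A (units e) e" using units_subgroup subgroup_units(1,2)[OF H] by simp
  then have "units e = H" using max subgroup_units(3)[OF H] unfolding maximal_subgroup_def by meson
  then show "e \<in> C \<and> e \<cdot> e = e \<and> H = units e" using subgroup_units(1,2)[OF H] by simp
next
  assume e: "e \<in> C \<and> e \<cdot> e = e \<and> H = units e"
  have "K = H" if K: "sg_subgroup A K f" "H \<subseteq> K" for K f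
  proof -
    have "e \<in> units f" using K subgroup_units(3) unit_in_units e by blast
    then obtain k where "k \<in> C" "e \<cdot> k = f" "e \<cdot> f = e"  by (auto simp: units_def)
    then have "e = f" using e assoc[of e e k] by simp
    then show "K = H" using subgroup_units(3)[OF K(1)] K(2) e by blast
  qed
  then show "maximal_subgroup A H e"
    using e units_subgroup unfolding maximal_subgroup_def by blast
qed

lemma inv_units:
  assumes e: "e \<in> C" "e \<cdot> e = e" and h: "h \<in> units e"
    and k: "k \<in> C" "e \<cdot> k = k" "k \<cdot> e = k" "k \<cdot> h = e" "h \<cdot> k = e"
  shows "inv\<^bsub>as_monoid A (units e) e\<^esub> h = k"
proof -
  interpret group "as_monoid A (units e) e"
    using units_subgroup[OF e] by (simp add: sg_subgroup_def)
  have "k \<in> units e" using h k by (auto simp: units_def)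
  then show ?thesis using h k by (intro inv_equality) (auto simp: as_monoid_def)
qed

end

text \<open>
  Apart from the quantified exponent these laws are equations. They describe exactly the epigroups
  (\<open>epigroup_iff\<close>), and everything below rests on them rather than on maximal subgroups.
\<close>

locale epi = sg +
  assumes pinv_commute: "x \<in> carrier A \<Longrightarrow> mul A x (pinv A x) = mul A (pinv A x) x"
    and pinv_mult: "x \<in> carrier A \<Longrightarrow> mul A (pinv A x) (mul A x (pinv A x)) = pinv A x"
    and index: "x \<in> carrier A \<Longrightarrow> \<exists>m. mul A (pw x m) (mul A x (pinv A x)) = pw x m"
begin

definition om where "om x = x \<cdot> pinv A x"

lemma om_closed [simp, intro]: "x \<in> C \<Longrightarrow> om x \<in> C"
  by (simp add: om_def)

lemma om_idem: "x \<in> C \<Longrightarrow> om x \<cdot> om x = om x"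
  using pinv_mult[of x] by (simp add: om_def assoc)

lemma om_pinv: "x \<in> C \<Longrightarrow> om x \<cdot> pinv A x = pinv A x"
  using pinv_mult[of x] pinv_commute[of x] by (simp add: om_def assoc)

lemma pinv_om: "x \<in> C \<Longrightarrow> pinv A x \<cdot> om x = pinv A x"
  using pinv_mult[of x] by (simp add: om_def)

lemma om_commute: "x \<in> C \<Longrightarrow> om x \<cdot> x = x \<cdot> om x"
  using pinv_commute[of x] assoc[of x "pinv A x" x] by (simp add: om_def)

lemma pw_om: "x \<in> C \<Longrightarrow> \<exists>m. pw x m \<cdot> om x = pw x m"
  using index by (simp add: om_def)

lemma pw_om_mono:
  assumes x: "x \<in> C" and m: "pw x m \<cdot> om x = pw x m" and "m \<le> n"
  shows "pw x n \<cdot> om x = pw x n"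
  using \<open>m \<le> n\<close>
proof (induction rule: dec_induct)
  case (step n)
  have "pw x (Suc n) \<cdot> om x = pw x n \<cdot> om x \<cdot> x"
    using x om_commute[OF x] by (simp add: pw_Suc assoc)
  then show ?case using step by (simp add: pw_Suc)
qed (fact m)

lemma pw_om_ge: "x \<in> C \<Longrightarrow> \<exists>m. \<forall>n\<ge>m. pw x n \<cdot> om x = pw x n"
  using pw_om pw_om_mono by blast

text \<open>
  If \<open>c\<close> is a right unit for \<open>z\<close>, so is each power of \<open>c\<close>, and high powers absorb \<open>om c\<close>.
\<close>

lemma right_unit_om:
  assumes z: "z \<in> C" and c: "c \<in> C" and zc: "z \<cdot> c = z"
  shows "z \<cdot> om c = z"
proof -
  have "z \<cdot> pw c n = z" for n
    by (induction n) (use z c zc in \<open>auto simp: pw_Suc assoc[symmetric]\<close>)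
  moreover obtain m where "pw c m \<cdot> om c = pw c m" using pw_om[OF c] by blast
  ultimately show ?thesis using assoc[of z "pw c m" "om c"] z c by simp
qed

lemma om_of_idem:
  assumes "e \<in> C" "e \<cdot> e = e"
  shows "om e = e" "pinv A e = e"
proof -
  have "e \<cdot> om e = e" using assms right_unit_om by blast
  moreover have "e \<cdot> om e = om e" using assms by (simp add: om_def assoc[symmetric])
  ultimately show "om e = e" by simp
  then show "pinv A e = e"
    using om_pinv[OF assms(1)] by (simp add: om_def)
qed

text \<open>
  A left divisor \<open>z\<close> of \<open>e\<close> can be cancelled repeatedly, so \<open>e\<close> is left divisible by arbitrarily
  high powers of \<open>y\<close>, which absorb \<open>om y\<close>.
\<close>

lemma absorb_om:
  assumes C: "z \<in> C" "y \<in> C" "e \<in> C" and zy: "z \<cdot> y = e" and e: "e \<cdot> y = y \<or> z \<cdot> e = z"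
  shows "e \<cdot> om y = e"
proof -
  have "pw z n \<cdot> pw y n = e" for n
  proof (induction n)
    case (Suc n)
    have "pw z (Suc n) \<cdot> pw y (Suc n) = pw z n \<cdot> e \<cdot> pw y n"
      using C zy assoc[of z y "pw y n"] by (simp add: pw_Suc[of z] pw_Suc'[of y] assoc)
    also have "\<dots> = pw z n \<cdot> pw y n"
      using e
    proof
      assume "e \<cdot> y = y"
      then have "e \<cdot> pw y n = pw y n"
        by (induction n) (use C in \<open>auto simp: pw_Suc assoc[symmetric]\<close>)
      then show ?thesis using C by (simp add: assoc)
    next
      assume "z \<cdot> e = z"
      then have "pw z n \<cdot> e = pw z n"
        by (induction n) (use C in \<open>auto simp: pw_Suc assoc\<close>)
      then show ?thesis by simp
    qed
    finally show ?case using Suc by simp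
  qed (use zy in simp)
  moreover obtain m where "pw y m \<cdot> om y = pw y m" using pw_om C by blast
  ultimately show ?thesis using C assoc[of "pw z m" "pw y m" "om y"] by simp
qed

lemma om_eqI:
  assumes "z \<in> C" "y \<in> C" "e \<in> C" "z \<cdot> y = e" "e \<cdot> y = y"
  shows "om y = e"
proof -
  have "e \<cdot> om y = om y" using assms by (simp add: om_def assoc[symmetric])
  then show ?thesis using absorb_om[OF assms(1-4)] assms(5) by simp
qed

lemma om_pinv_eq: "x \<in> C \<Longrightarrow> om (pinv A x) = om x"
  by (rule om_eqI[of x]) (simp_all add: om_pinv, simp add: om_def)

lemma om_units: "e \<in> C \<Longrightarrow> h \<in> units e \<Longrightarrow> om h = e"
  using om_eqI[of _ h e] by (auto simp: units_def)

lemma pinv_units: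
  assumes "e \<in> C" "h \<in> units e"
  shows "pinv A h \<in> units e"
proof -
  have h: "h \<in> C" using assms by (simp add: units_def)
  have "h \<cdot> pinv A h = e" using om_units[OF assms] by (simp add: om_def)
  then show ?thesis
    using om_units[OF assms] om_pinv[OF h] pinv_om[OF h] pinv_commute[OF h] assms h
    unfolding units_def by auto
qed

lemma unit_om: "x \<in> C \<Longrightarrow> x \<cdot> om x \<in> units (om x)"
proof -
  assume x: "x \<in> C"
  have r: "x \<cdot> om x \<cdot> om x = x \<cdot> om x"
    using x by (simp add: assoc om_idem)
  moreover have "om x \<cdot> (x \<cdot> om x) = x \<cdot> om x"
    using x r assoc[of "om x" x "om x"] by (simp add: om_commute)
  moreover have "x \<cdot> om x \<cdot> pinv A x = om x"
    using x assoc[of x "om x" "pinv A x"] by (simp add: om_pinv) (simp add: om_def)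
  moreover have "pinv A x \<cdot> (x \<cdot> om x) = om x"
    using x assoc[of "pinv A x" x "om x"] pinv_commute[OF x] om_idem[OF x] by (simp add: om_def)
  ultimately show ?thesis using x om_pinv[OF x] pinv_om[OF x] unfolding units_def by blast
qed

text \<open>
  A power of \<open>x\<close> that absorbs \<open>om x\<close> equals the same power of \<open>x \<cdot> om x\<close>, which is a unit at \<open>om x\<close>.
\<close>

lemma epigroup: "epigroup A"
  unfolding epigroup_def
proof (intro conjI ballI algebra associative)
  fix x assume x: "x \<in> C"
  let ?e = "om x"
  obtain m where m: "pw x m \<cdot> ?e = pw x m" using pw_om[OF x] by blast
  have "pw x n \<cdot> ?e = pw (x \<cdot> ?e) n" for n
  proof (induction n)
    case (Suc n)
    have "pw x (Suc n) \<cdot> ?e = pw x n \<cdot> ?e \<cdot> (x \<cdot> ?e)"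
      using x om_commute[OF x] om_idem[OF x] assoc[of "om x" x "om x"]
      by (simp add: pw_Suc assoc)
    then show ?case using Suc by (simp add: pw_Suc)
  qed simp
  then have "pw x m = pw (x \<cdot> ?e) m" using m by simp
  moreover have "pw (x \<cdot> ?e) n \<in> units ?e" for n
    by (induction n) (use unit_om[OF x] units_mult x in \<open>auto simp: pw_Suc\<close>)
  ultimately have m: "sg_power A x (Suc m) \<in> units ?e" by (simp add: sg_power_pw)
  then show "\<exists>n\<ge>1. \<exists>H e. sg_subgroup A H e \<and> sg_power A x n \<in> H"
    using units_subgroup[OF om_closed[OF x] om_idem[OF x]] by (intro exI[of _ "Suc m"]) auto
  have "inv\<^bsub>as_monoid A (units ?e) ?e\<^esub> (x \<cdot> ?e) = pinv A x"
    using x om_pinv[OF x] om_idem[OF x] pinv_om[OF x] pinv_commute[OF x] unit_om[OF x]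
      assoc[of "pinv A x" x "om x"] assoc[of x "om x" "pinv A x"]
    by (intro inv_units) (auto simp: om_def)
  then show "is_pseudoinverse A x (pinv A x)"
    unfolding is_pseudoinverse_def maximal_subgroup_units using m x om_idem[OF x]
    by (intro exI[of _ "units ?e"] exI[of _ ?e] exI[of _ "Suc m"]) auto
qed

end

text \<open>
  Let \<open>e\<close> be the unit of the maximal subgroup that contains a power \<open>p\<close> of \<open>x\<close>. Since \<open>x\<close> commutes
  with \<open>p\<close>, it commutes with \<open>e\<close>; and dividing one factor \<open>x\<close> out of \<open>p\<close> shows that \<open>x \<cdot> e\<close> is a unit
  at \<open>e\<close>. Its inverse there is the pseudoinverse.
\<close>

lemma epigroup_imp_epi:
  assumes "epigroup A"
  shows "epi A"
proof -
  interpret sg A using assms by unfold_locales (auto simp: epigroup_def)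
  have key: "x \<cdot> pinv A x = pinv A x \<cdot> x \<and> pinv A x \<cdot> (x \<cdot> pinv A x) = pinv A x \<and>
    (\<exists>m. pw x m \<cdot> (x \<cdot> pinv A x) = pw x m)" if x: "x \<in> C" for x
  proof -
    have "is_pseudoinverse A x (pinv A x)" using assms x by (simp add: epigroup_def)
    then obtain e n where n: "n \<ge> 1" and e: "e \<in> C" "e \<cdot> e = e"
      and p: "pw x (n - 1) \<in> units e" and y: "pinv A x = inv\<^bsub>as_monoid A (units e) e\<^esub> (x \<cdot> e)"
      unfolding is_pseudoinverse_def maximal_subgroup_units sg_power_pw by auto
    define m where "m = n - 1"
    define p where "p = pw x m"
    obtain q where q: "p \<in> C" "e \<cdot> p = p" "p \<cdot> e = p" "q \<in> C" "e \<cdot> q = q" "q \<cdot> e = q"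
      "p \<cdot> q = e" "q \<cdot> p = e" using p unfolding units_def m_def[symmetric] p_def[symmetric] by blast
    have xp: "x \<cdot> p = p \<cdot> x" using x pw_commute[of x x] by (simp add: p_def)
    have "e \<cdot> (x \<cdot> e) = x \<cdot> e"
    proof -
      have "x \<cdot> e = p \<cdot> (x \<cdot> q)"
        using q(1,4,7) x xp assoc[of x p q] assoc[of p x q] by simp
      then show ?thesis using q x e assoc[of e p "x \<cdot> q"] by simp
    qed
    moreover have "e \<cdot> x \<cdot> e = e \<cdot> x"
    proof -
      have "e \<cdot> x = q \<cdot> x \<cdot> p"
        using q(1,4,8) x xp assoc[of q p x] assoc[of q x p] by simp
      then show ?thesis using q x e assoc[of "q \<cdot> x" p e] by simp
    qed
    ultimately have ex: "e \<cdot> x = x \<cdot> e" using e x assoc[of e x e] by simp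
    \<comment> \<open>A right and a left inverse of \<open>x\<close> relative to \<open>e\<close>; there is no zeroth power to write them uniformly.\<close>
    define r where "r = (if m = 0 then q else pw x (m - 1) \<cdot> q)"
    have r: "r \<in> C" "x \<cdot> r = e"
    proof -
      show "r \<in> C" using q x by (simp add: r_def)
      show "x \<cdot> r = e"
      proof (cases m)
        case 0 then show ?thesis using q by (simp add: r_def p_def)
      next
        case (Suc k)
        then have "x \<cdot> r = p \<cdot> q" using x q by (simp add: r_def p_def pw_Suc' assoc)
        then show ?thesis using q by simp
      qed
    qed
    define s where "s = (if m = 0 then q else q \<cdot> pw x (m - 1))"
    have s: "s \<in> C" "s \<cdot> x = e"
    proof -
      show "s \<in> C" using q x by (simp add: s_def)
      show "s \<cdot> x = e"
      proof (cases m)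
        case 0 then show ?thesis using q by (simp add: s_def p_def)
      next
        case (Suc k)
        then have "s \<cdot> x = q \<cdot> p" using x q by (simp add: s_def p_def pw_Suc assoc)
        then show ?thesis using q by simp
      qed
    qed
    define y where "y = e \<cdot> r"
    have ey: "y \<in> C" "e \<cdot> y = y" using e r by (simp_all add: y_def assoc[symmetric])
    have xy: "x \<cdot> y = e"
      using e r x ex assoc[of x e r] assoc[of e x r] by (simp add: y_def)
    have es: "e \<cdot> (s \<cdot> e) = y"
      using ey e s x assoc[of s x y] xy assoc[of e s e] by simp
    have ye: "y \<cdot> e = y"
      using es s e assoc[of e "s \<cdot> e" e] assoc[of s e e] by simp
    have "s \<cdot> e \<cdot> x = e" using s e ex x assoc[of s e x] assoc[of s x e] by simp
    then have yx: "y \<cdot> x = e"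
      using es s e x assoc[of e "s \<cdot> e" x] by simp
    have inverse: "y \<cdot> (x \<cdot> e) = e" "x \<cdot> e \<cdot> y = e"
      using xy yx ey e x assoc[of y x e] assoc[of x e y] by simp_all
    then have u: "x \<cdot> e \<in> units e"
      unfolding units_def using ey ye e x ex assoc[of e x e] assoc[of x e e] by auto
    have "pinv A x = y" unfolding y
      using e ey ye u inverse by (intro inv_units) auto
    then show ?thesis using xy yx ye q(3) by (auto simp: p_def)
  qed
  show ?thesis by unfold_locales (use key in blast)+
qed

lemma epigroup_iff: "epigroup A \<longleftrightarrow> epi A"
  using epigroup_imp_epi epi.epigroup by blast

section \<open>Joins and meets of epigroup varieties\<close>

abbreviation omt :: "uterm \<Rightarrow> uterm" where
  "omt t \<equiv> Mul t (Inv t)"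

primrec powt :: "nat \<Rightarrow> uterm" where
  "powt 0 = Var 0"
| "powt (Suc n) = Mul (powt n) (Var 0)"

lemma (in sg) eval_powt: "eval_uterm A v (powt n) = pw (v 0) n"
  by (induction n) (auto simp: pw_Suc)

text \<open>
  The equations of epigroups whose index is bounded: \<open>powt n\<close> is the power with exponent \<open>n + 1\<close>.
\<close>

definition epigroup_identities :: "nat \<Rightarrow> (uterm \<times> uterm) set" where
  "epigroup_identities n =
    {(Mul (Mul (Var 0) (Var 1)) (Var 2), Mul (Var 0) (Mul (Var 1) (Var 2))),
     (Mul (Var 0) (Inv (Var 0)), Mul (Inv (Var 0)) (Var 0)),
     (Mul (Inv (Var 0)) (omt (Var 0)), Inv (Var 0)),
     (Mul (powt n) (omt (Var 0)), powt n)}"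

lemma epigroup_of_identities:
  assumes A: "algebra A" and sat: "\<And>s t. (s, t) \<in> epigroup_identities n \<Longrightarrow> satisfies A s t"
  shows "epigroup A"
proof -
  have "associative A"
    unfolding associative_def
  proof (intro ballI)
    fix x y z assume "x \<in> carrier A" "y \<in> carrier A" "z \<in> carrier A"
    then show "mul A (mul A x y) z = mul A x (mul A y z)"
      using satisfiesD[of A "Mul (Mul (Var 0) (Var 1)) (Var 2)" "Mul (Var 0) (Mul (Var 1) (Var 2))"
          "\<lambda>i. if i = 0 then x else if i = 1 then y else z"] sat
      by (simp add: epigroup_identities_def)
  qed
  then interpret sg A using A by unfold_locales
  have "epi A"
  proof (unfold_locales, goal_cases)
    case (1 x) then show ?case
      using satisfiesD[of A "Mul (Var 0) (Inv (Var 0))" "Mul (Inv (Var 0)) (Var 0)" "\<lambda>i. x"] sat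
      by (simp add: epigroup_identities_def)
  next
    case (2 x) then show ?case
      using satisfiesD[of A "Mul (Inv (Var 0)) (omt (Var 0))" "Inv (Var 0)" "\<lambda>i. x"] sat
      by (simp add: epigroup_identities_def)
  next
    case (3 x) then show ?case
      using satisfiesD[of A "Mul (powt n) (omt (Var 0))" "powt n" "\<lambda>i. x"] sat
      by (auto simp: epigroup_identities_def eval_powt)
  qed
  then show ?thesis by (simp add: epigroup_iff)
qed

text \<open>
  The index of a generator of the free algebra bounds the index of every element of every member of
  \<open>V\<close>. Without a uniform bound the identities shared by two varieties need not define epigroups.
\<close>

lemma epigroup_variety_uniform_index:
  fixes V :: "'a unary_semigroup set"
  assumes inf: "infinite (UNIV :: 'a set)" and V: "epigroup_variety V"
  shows "\<exists>m. \<forall>n\<ge>m. epigroup_identities n \<subseteq> identities V"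
proof -
  obtain F v where F: "F \<in> V" "\<And>i. v i \<in> carrier F"
    "\<And>s t. eval_uterm F v s = eval_uterm F v t \<Longrightarrow> (s, t) \<in> identities V"
    using free_algebra[OF inf, of V] V unfolding epigroup_variety_def by metis
  have epi: "epi A" if "A \<in> V" for A
    using V that by (simp add: epigroup_variety_def epigroup_iff)
  interpret F: epi F using epi F(1) .
  obtain m where "mul F (F.pw (v 0) m) (F.om (v 0)) = F.pw (v 0) m" using F.pw_om F(2) by blast
  then have m: "(Mul (powt m) (omt (Var 0)), powt m) \<in> identities V"
    using F by (intro F(3)) (simp add: F.eval_powt F.om_def)
  have "satisfies A s t" if A: "A \<in> V" and n: "m \<le> n" and st: "(s, t) \<in> epigroup_identities n" for A n s t
  proof -
    interpret A: epi A using epi A .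
    have "mul A (A.pw x n) (A.om x) = A.pw x n" if x: "x \<in> carrier A" for x
    proof -
      have "mul A (A.pw x m) (A.om x) = A.pw x m"
        using m A x satisfiesD[of A "Mul (powt m) (omt (Var 0))" "powt m" "\<lambda>i. x"]
        by (auto simp: identities_def A.eval_powt A.om_def)
      then show ?thesis using A.pw_om_mono x n by blast
    qed
    then show ?thesis using st A.assoc A.pinv_commute A.pinv_mult
      by (auto simp: epigroup_identities_def satisfies_def A.eval_powt A.om_def)
  qed
  then show ?thesis by (intro exI[of _ m]) (auto simp: identities_def)
qed

lemma identities_models_subset: "E \<subseteq> identities (models E)"
  by (auto simp: identities_def models_def)

lemma models_antimono: "E \<subseteq> E' \<Longrightarrow> models E' \<subseteq> models E"
  by (auto simp: models_def)

lemma identities_antimono: "V \<subseteq> W \<Longrightarrow> identities W \<subseteq> identities V"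
  by (auto simp: identities_def)

lemma carrier_EPI [simp]: "V \<in> carrier EPI \<longleftrightarrow> epigroup_variety V"
  by (simp add: EPI_def)

lemma le_EPI [simp]: "V \<sqsubseteq>\<^bsub>EPI\<^esub> W \<longleftrightarrow> V \<subseteq> W"
  by (simp add: EPI_def)

text \<open>
  The class defined by the common identities consists of epigroups because the two varieties have a
  common bound for the index.
\<close>

lemma join_EPI:
  fixes Y Z :: "'a unary_semigroup set"
  assumes inf: "infinite (UNIV :: 'a set)" and Y: "epigroup_variety Y" and Z: "epigroup_variety Z"
  shows "Y \<squnion>\<^bsub>EPI\<^esub> Z = models (identities Y \<inter> identities Z)" (is "_ = ?J")
    and "epigroup_variety (Y \<squnion>\<^bsub>EPI\<^esub> Z)"
    and "identities (Y \<squnion>\<^bsub>EPI\<^esub> Z) = identities Y \<inter> identities Z"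
proof -
  have Y': "models (identities Y) = Y" and Z': "models (identities Z) = Z"
    using Y Z by (simp_all add: epigroup_variety_def variety_models)
  obtain m where m: "\<And>n. n \<ge> m \<Longrightarrow> epigroup_identities n \<subseteq> identities Y"
    using epigroup_variety_uniform_index[OF inf Y] by blast
  obtain k where k: "\<And>n. n \<ge> k \<Longrightarrow> epigroup_identities n \<subseteq> identities Z"
    using epigroup_variety_uniform_index[OF inf Z] by blast
  have E: "epigroup_identities (max m k) \<subseteq> identities Y \<inter> identities Z" using m k by simp
  have J: "epigroup_variety ?J"
    unfolding epigroup_variety_def
  proof (intro conjI ballI models_variety)
    fix A assume "A \<in> ?J"
    then show "epigroup A"
      by (intro epigroup_of_identities[of _ "max m k"]) (use E in \<open>auto simp: models_def\<close>)
  qed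
  have YJ: "Y \<subseteq> ?J" using models_antimono[of "identities Y \<inter> identities Z" "identities Y"] Y' by auto
  have ZJ: "Z \<subseteq> ?J" using models_antimono[of "identities Y \<inter> identities Z" "identities Z"] Z' by auto
  have least: "?J \<subseteq> W" if "epigroup_variety W" "Y \<subseteq> W" "Z \<subseteq> W" for W
  proof -
    have "models (identities W) = W" using that by (simp add: epigroup_variety_def variety_models)
    then show ?thesis
      using models_antimono[of "identities W" "identities Y \<inter> identities Z"]
        identities_antimono that(2,3) by blast
  qed
  have Upper: "Upper EPI {Y, Z} = {W. epigroup_variety W \<and> Y \<subseteq> W \<and> Z \<subseteq> W}"
  proof (rule Set.set_eqI)
    fix W
    have "W \<in> Upper EPI {Y, Z} \<longleftrightarrow> (\<forall>X. (X = Y \<or> X = Z) \<and> epigroup_variety X \<longrightarrow> X \<subseteq> W) \<and> epigroup_variety W"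
      unfolding Upper_def by (simp only: mem_Collect_eq Int_iff carrier_EPI le_EPI insert_iff empty_iff) blast
    then show "W \<in> Upper EPI {Y, Z} \<longleftrightarrow> W \<in> {W. epigroup_variety W \<and> Y \<subseteq> W \<and> Z \<subseteq> W}"
      using Y Z by blast
  qed
  have "least EPI l (Upper EPI {Y, Z}) \<longleftrightarrow> l = ?J" for l
  proof
    assume "least EPI l (Upper EPI {Y, Z})"
    then have l: "epigroup_variety l" "Y \<subseteq> l" "Z \<subseteq> l"
        "\<And>W. epigroup_variety W \<Longrightarrow> Y \<subseteq> W \<Longrightarrow> Z \<subseteq> W \<Longrightarrow> l \<subseteq> W"
      by (simp_all add: least_def Upper)
    show "l = ?J" by (rule subset_antisym) (rule l(4)[OF J YJ ZJ], rule least[OF l(1-3)])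
  next
    assume l: "l = ?J"
    show "least EPI l (Upper EPI {Y, Z})"
      unfolding least_def Upper l
    proof (intro conjI subsetI ballI)
      show "?J \<in> {W. epigroup_variety W \<and> Y \<subseteq> W \<and> Z \<subseteq> W}" using J YJ ZJ by blast
    qed (simp_all only: mem_Collect_eq carrier_EPI le_EPI least)
  qed
  then show join: "Y \<squnion>\<^bsub>EPI\<^esub> Z = ?J"
    by (simp add: join_def sup_def)
  then show "epigroup_variety (Y \<squnion>\<^bsub>EPI\<^esub> Z)" using J by simp
  show "identities (Y \<squnion>\<^bsub>EPI\<^esub> Z) = identities Y \<inter> identities Z"
    unfolding join using identities_models_subset identities_antimono YJ ZJ by blast
qed

lemma epigroup_variety_Int:
  fixes Y Z :: "'a unary_semigroup set"
  assumes "epigroup_variety Y" "epigroup_variety Z"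
  shows "epigroup_variety (Y \<inter> Z)"
proof -
  have "models (identities Y) = Y" "models (identities Z) = Z"
    using assms by (simp_all add: epigroup_variety_def variety_models)
  moreover have "(models (identities Y \<union> identities Z) :: 'a unary_semigroup set) =
      models (identities Y) \<inter> models (identities Z)"
    unfolding models_def by blast
  ultimately have "Y \<inter> Z = models (identities Y \<union> identities Z)" by simp
  then show ?thesis using assms models_variety by (auto simp: epigroup_variety_def)
qed

lemma meet_EPI:
  assumes Y: "epigroup_variety Y" and Z: "epigroup_variety Z"
  shows "Y \<sqinter>\<^bsub>EPI\<^esub> Z = Y \<inter> Z"
proof -
  have Lower: "Lower EPI {Y, Z} = {W. epigroup_variety W \<and> W \<subseteq> Y \<and> W \<subseteq> Z}"
  proof (rule Set.set_eqI)
    fix W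
    have "W \<in> Lower EPI {Y, Z} \<longleftrightarrow> (\<forall>X. (X = Y \<or> X = Z) \<and> epigroup_variety X \<longrightarrow> W \<subseteq> X) \<and> epigroup_variety W"
      unfolding Lower_def by (simp only: mem_Collect_eq Int_iff carrier_EPI le_EPI insert_iff empty_iff) blast
    then show "W \<in> Lower EPI {Y, Z} \<longleftrightarrow> W \<in> {W. epigroup_variety W \<and> W \<subseteq> Y \<and> W \<subseteq> Z}"
      using Y Z by blast
  qed
  have "greatest EPI l (Lower EPI {Y, Z}) \<longleftrightarrow> l = Y \<inter> Z" for l
  proof
    assume "greatest EPI l (Lower EPI {Y, Z})"
    then have l: "l \<subseteq> Y" "l \<subseteq> Z"
        "\<And>W. epigroup_variety W \<Longrightarrow> W \<subseteq> Y \<Longrightarrow> W \<subseteq> Z \<Longrightarrow> W \<subseteq> l"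
      by (simp_all add: greatest_def Lower)
    show "l = Y \<inter> Z" using l(1,2) l(3)[OF epigroup_variety_Int[OF Y Z]] by auto
  next
    assume l: "l = Y \<inter> Z"
    show "greatest EPI l (Lower EPI {Y, Z})"
      unfolding greatest_def Lower l
    proof (intro conjI subsetI ballI)
      show "Y \<inter> Z \<in> {W. epigroup_variety W \<and> W \<subseteq> Y \<and> W \<subseteq> Z}"
        using epigroup_variety_Int[OF Y Z] by blast
    qed (simp_all only: mem_Collect_eq carrier_EPI le_EPI le_inf_iff)
  qed
  then show ?thesis by (simp add: meet_def inf_def)
qed

text \<open>
  The right-hand side of the codistributive law is always contained in the left-hand side, so the
  law amounts to one inclusion, stated here for identities.
\<close>

lemma codistributive_EPI:
  fixes V :: "'a unary_semigroup set"
  assumes inf: "infinite (UNIV :: 'a set)" and V: "epigroup_variety V"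
  shows "codistributive EPI V \<longleftrightarrow> (\<forall>Y Z. epigroup_variety Y \<longrightarrow> epigroup_variety Z \<longrightarrow>
    identities (V \<inter> Y) \<inter> identities (V \<inter> Z) \<subseteq> identities (V \<inter> models (identities Y \<inter> identities Z)))"
proof -
  have "V \<sqinter>\<^bsub>EPI\<^esub> (Y \<squnion>\<^bsub>EPI\<^esub> Z) = (V \<sqinter>\<^bsub>EPI\<^esub> Y) \<squnion>\<^bsub>EPI\<^esub> (V \<sqinter>\<^bsub>EPI\<^esub> Z) \<longleftrightarrow>
    identities (V \<inter> Y) \<inter> identities (V \<inter> Z) \<subseteq> identities (V \<inter> models (identities Y \<inter> identities Z))"
    (is "?L = ?R \<longleftrightarrow> ?sub") if Y: "epigroup_variety Y" and Z: "epigroup_variety Z" for Y Z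
  proof -
    have VY: "epigroup_variety (V \<inter> Y)" and VZ: "epigroup_variety (V \<inter> Z)"
      using V Y Z epigroup_variety_Int by blast+
    note J = join_EPI[OF inf Y Z]
    have L: "?L = V \<inter> models (identities Y \<inter> identities Z)" "epigroup_variety ?L"
      using meet_EPI[OF V J(2)] J(1) epigroup_variety_Int[OF V J(2)] by simp_all
    have RV: "?R = (V \<inter> Y) \<squnion>\<^bsub>EPI\<^esub> (V \<inter> Z)"
      by (simp add: meet_EPI[OF V Y] meet_EPI[OF V Z])
    note R = join_EPI[OF inf VY VZ, folded RV]
    have "Y \<subseteq> models (identities Y \<inter> identities Z)" "Z \<subseteq> models (identities Y \<inter> identities Z)"
      using identities_algebra Y Z by (auto simp: epigroup_variety_def models_def identities_def)
    then have sup: "identities ?L \<subseteq> identities ?R"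
      unfolding L R(3) by (intro Int_greatest identities_antimono) blast+
    have "?L = ?R \<longleftrightarrow> identities ?L = identities ?R"
      using L(2) R(2) variety_models unfolding epigroup_variety_def by metis
    then show ?thesis using sup R(3) L(1) by auto
  qed
  then show ?thesis using V by (simp add: codistributive_def Ball_def)
qed

section \<open>Semilattices and zero multiplication\<close>

definition compound :: "uterm \<Rightarrow> bool" where
  "compound t \<longleftrightarrow> (\<forall>i. t \<noteq> Var i)"

lemma compound_simps [simp]:
  "\<not> compound (Var i)" "compound (Mul s t)" "compound (Inv t)"
  by (simp_all add: compound_def)

text \<open>
  The value of a term in a semilattice is the infimum of the values of its variables.
\<close>

lemma satisfies_SL:
  assumes A: "A \<in> SL" and st: "vars s = vars t"
  shows "satisfies A s t"
  unfolding satisfies_def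
proof (intro allI impI)
  fix v :: "nat \<Rightarrow> 'a" assume v: "\<forall>i. v i \<in> carrier A"
  interpret epi A using A by (simp add: SL_def epigroup_iff)
  have idem: "x \<cdot> x = x" and comm: "x \<cdot> y = y \<cdot> x" if "x \<in> C" "y \<in> C" for x y
    using A that by (auto simp: SL_def)
  have pinv: "pinv A x = x" if "x \<in> C" for x using om_of_idem idem that by blast
  have ev: "eval_uterm A v u \<in> C" for u using eval_closed[OF algebra] v by blast
  have below: "eval_uterm A v u \<cdot> v i = eval_uterm A v u" if "i \<in> vars u" for i u
    using that
  proof (induction u)
    case (Mul a b)
    have "eval_uterm A v a \<cdot> eval_uterm A v b \<cdot> v i = eval_uterm A v a \<cdot> v i \<cdot> eval_uterm A v b"
      using ev v comm[of "eval_uterm A v b" "v i"] by (simp add: assoc)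
    moreover have "eval_uterm A v a \<cdot> eval_uterm A v b \<cdot> v i = eval_uterm A v a \<cdot> (eval_uterm A v b \<cdot> v i)"
      using ev v by (simp add: assoc)
    ultimately show ?case using Mul by auto
  qed (use v ev idem pinv in auto)
  have greatest: "z \<cdot> eval_uterm A v u = z" if "z \<in> C" "\<forall>i\<in>vars u. z \<cdot> v i = z" for z u
    using that(2) by (induction u) (use that(1) ev pinv in \<open>auto simp: assoc[symmetric]\<close>)
  show "eval_uterm A v s = eval_uterm A v t"
    using greatest[OF ev, of t s] greatest[OF ev, of s t] below st comm[OF ev ev] by metis
qed

lemma satisfies_ZM:
  assumes A: "A \<in> ZM" and st: "compound s" "compound t"
  shows "satisfies A s t"
proof -
  interpret epi A using A by (simp add: ZM_def epigroup_iff)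
  obtain z where z: "z \<in> C" "\<And>x y. x \<in> C \<Longrightarrow> y \<in> C \<Longrightarrow> x \<cdot> y = z" using A by (auto simp: ZM_def)
  have "eval_uterm A v u = z" if v: "\<forall>i. v i \<in> C" and u: "compound u" for u and v :: "nat \<Rightarrow> 'a"
  proof (cases u)
    case (Mul a b) then show ?thesis using z(2) eval_closed[OF algebra] v by simp
  next
    case (Inv a)
    then show ?thesis using z(2) eval_closed[OF algebra] v pinv_om by (metis eval_uterm.simps(3) om_closed pinv_closed)
  qed (use u in simp)
  then show ?thesis using st by (simp add: satisfies_def)
qed

lemma SL_models: "SL = models
  {(Mul (Var 0) (Var 0), Var 0), (Mul (Var 0) (Var 1), Mul (Var 1) (Var 0)),
   (Mul (Mul (Var 0) (Var 1)) (Var 2), Mul (Var 0) (Mul (Var 1) (Var 2))), (Inv (Var 0), Var 0)}"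
  (is "_ = models ?E")
proof (intro subset_antisym subsetI)
  fix A :: "'a unary_semigroup" assume A: "A \<in> SL"
  then interpret epi A by (simp add: SL_def epigroup_iff)
  show "A \<in> models ?E" using satisfies_SL[OF A] algebra by (auto simp: models_def insert_commute)
next
  fix A :: "'a unary_semigroup" assume "A \<in> models ?E"
  then have A: "algebra A" and sat: "\<And>s t. (s, t) \<in> ?E \<Longrightarrow> satisfies A s t"
    by (auto simp: models_def)
  have idem: "mul A x x = x" and pinv: "pinv A x = x" if "x \<in> carrier A" for x
    using satisfiesD[OF sat, of "Mul (Var 0) (Var 0)" "Var 0" "\<lambda>i. x"]
      satisfiesD[OF sat, of "Inv (Var 0)" "Var 0" "\<lambda>i. x"] that by auto
  have comm: "mul A x y = mul A y x" if "x \<in> carrier A" "y \<in> carrier A" for x y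
    using satisfiesD[OF sat, of "Mul (Var 0) (Var 1)" "Mul (Var 1) (Var 0)"
        "\<lambda>i. if i = 0 then x else y"] that by auto
  have as: "mul A (mul A x y) z = mul A x (mul A y z)"
    if "x \<in> carrier A" "y \<in> carrier A" "z \<in> carrier A" for x y z
    using satisfiesD[OF sat, of "Mul (Mul (Var 0) (Var 1)) (Var 2)" "Mul (Var 0) (Mul (Var 1) (Var 2))"
        "\<lambda>i. if i = 0 then x else if i = 1 then y else z"] that by auto
  interpret sg A using A as by unfold_locales (auto simp: associative_def)
  have "epi A"
    by unfold_locales (use idem pinv in \<open>auto intro!: exI[of _ 0]\<close>)
  then show "A \<in> SL" using idem comm by (simp add: SL_def epigroup_iff)
qed

lemma ZM_models: "ZM = models
  {(Mul (Var 0) (Var 1), Mul (Var 2) (Var 3)), (Inv (Var 0), Mul (Var 0) (Var 0))}"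
  (is "_ = models ?E")
proof (intro subset_antisym subsetI)
  fix A :: "'a unary_semigroup" assume A: "A \<in> ZM"
  then interpret epi A by (simp add: ZM_def epigroup_iff)
  show "A \<in> models ?E" using satisfies_ZM[OF A] algebra by (auto simp: models_def)
next
  fix A :: "'a unary_semigroup" assume "A \<in> models ?E"
  then have A: "algebra A" and sat: "\<And>s t. (s, t) \<in> ?E \<Longrightarrow> satisfies A s t"
    by (auto simp: models_def)
  obtain a where a: "a \<in> carrier A" using A by (auto simp: algebra_def)
  define z where "z = mul A a a"
  have z: "z \<in> carrier A" using A a by (simp add: algebra_def z_def)
  have mul: "mul A x y = z" if "x \<in> carrier A" "y \<in> carrier A" for x y
    using satisfiesD[OF sat, of "Mul (Var 0) (Var 1)" "Mul (Var 2) (Var 3)"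
        "\<lambda>i. if i = 0 then x else if i = 1 then y else a"] that a by (auto simp: z_def)
  have pinv: "pinv A x = z" if "x \<in> carrier A" for x
    using satisfiesD[OF sat, of "Inv (Var 0)" "Mul (Var 0) (Var 0)" "\<lambda>i. x"] that mul by auto
  interpret sg A using A mul z by unfold_locales (auto simp: associative_def)
  have "epi A"
    by unfold_locales (use z mul pinv in \<open>auto intro!: exI[of _ "Suc 0"] simp: pw_Suc\<close>)
  then show "A \<in> ZM" using mul z by (auto simp: ZM_def epigroup_iff)
qed

lemma trivial_models: "trivial_variety = models {(Var 0, Var 1)}"
proof (intro subset_antisym subsetI)
  fix A :: "'a unary_semigroup" assume "A \<in> trivial_variety"
  then show "A \<in> models {(Var 0, Var 1)}"
    by (auto simp: trivial_variety_def models_def satisfies_def epigroup_def)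
next
  fix A :: "'a unary_semigroup" assume "A \<in> models {(Var 0, Var 1)}"
  then have A: "algebra A" and sat: "satisfies A (Var 0) (Var 1)"
    by (auto simp: models_def)
  obtain a where a: "a \<in> carrier A" using A by (auto simp: algebra_def)
  have "x = a" if "x \<in> carrier A" for x
    using satisfiesD[OF sat, of "\<lambda>i. if i = 0 then x else a"] that a by auto
  then have C: "carrier A = {a}" using a by blast
  then have a': "mul A a a = a" "pinv A a = a" using A by (auto simp: algebra_def)
  interpret sg A using A by unfold_locales (auto simp: associative_def C a')
  have "epi A"
    by unfold_locales (auto intro!: exI[of _ 0] simp: C a')
  then show "A \<in> trivial_variety" using C by (auto simp: trivial_variety_def epigroup_iff)
qed

lemma epigroup_variety_SL: "epigroup_variety SL"
  and epigroup_variety_ZM: "epigroup_variety ZM"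
  and epigroup_variety_trivial: "epigroup_variety trivial_variety"
proof -
  show "epigroup_variety SL"
    unfolding epigroup_variety_def using varietyI_models[OF SL_models] by (simp add: SL_def)
  show "epigroup_variety ZM"
    unfolding epigroup_variety_def using varietyI_models[OF ZM_models] by (simp add: ZM_def)
  show "epigroup_variety trivial_variety"
    unfolding epigroup_variety_def using varietyI_models[OF trivial_models]
    by (simp add: trivial_variety_def)
qed

lemma identities_SL:
  assumes inf: "infinite (UNIV :: 'a set)"
  shows "(s, t) \<in> identities (SL :: 'a unary_semigroup set) \<longleftrightarrow> vars s = vars t"
proof
  assume st: "(s, t) \<in> identities (SL :: 'a unary_semigroup set)"
  define B :: "nat unary_semigroup" where "B = \<lparr>carrier = {0, 1}, mul = (*), pinv = id\<rparr>"
  obtain h :: "nat \<Rightarrow> 'a" where h: "inj h" using injection_into_infinite[OF inf] by blast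
  have "algebra B" by (auto simp: B_def algebra_def)
  then have "copy h B \<in> SL"
    unfolding SL_models models_def using h
    by (auto simp: algebra_copy satisfies_copy, auto simp: satisfies_def B_def)
  then have sat: "satisfies B s t" using st h by (auto simp: identities_def satisfies_copy)
  have ev: "eval_uterm B (\<lambda>j. if j = i then 0 else 1) u = (if i \<in> vars u then 0 else 1)" for i u
    by (induction u) (auto simp: B_def)
  have val: "(if j = i then 0 else 1) \<in> carrier B" for i j :: nat by (simp add: B_def)
  have "i \<in> vars s \<longleftrightarrow> i \<in> vars t" for i
    using satisfiesD[OF sat, of "\<lambda>j. if j = i then 0 else 1", OF val] by (simp add: ev split: if_splits)
  then show "vars s = vars t" by blast
qed (use satisfies_SL in \<open>auto simp: identities_def\<close>)

lemma identities_ZM: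
  assumes inf: "infinite (UNIV :: 'a set)"
  shows "(s, t) \<in> identities (ZM :: 'a unary_semigroup set) \<longleftrightarrow> s = t \<or> compound s \<and> compound t"
proof
  assume st: "(s, t) \<in> identities (ZM :: 'a unary_semigroup set)"
  define B :: "nat unary_semigroup" where "B = \<lparr>carrier = {0, 1}, mul = (\<lambda>_ _. 0), pinv = (\<lambda>_. 0)\<rparr>"
  obtain h :: "nat \<Rightarrow> 'a" where h: "inj h" using injection_into_infinite[OF inf] by blast
  have "algebra B" by (auto simp: B_def algebra_def)
  then have "copy h B \<in> ZM"
    unfolding ZM_models models_def using h
    by (auto simp: algebra_copy satisfies_copy, auto simp: satisfies_def B_def)
  then have sat: "satisfies B s t" using st h by (auto simp: identities_def satisfies_copy)
  have ev: "eval_uterm B (\<lambda>j. if j = i then 1 else 0) u = 1 \<longleftrightarrow> u = Var i" for i u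
    by (cases u) (auto simp: B_def)
  have "s = Var i \<longleftrightarrow> t = Var i" for i
    using satisfiesD[OF sat, of "\<lambda>j. if j = i then 1 else 0"] ev[of i s] ev[of i t]
    by (auto simp: B_def)
  then show "s = t \<or> compound s \<and> compound t" by (auto simp: compound_def)
qed (use satisfies_ZM in \<open>auto simp: identities_def satisfies_def\<close>)

section \<open>Identities with a bare variable on one side\<close>

context epi
begin

lemma pw_om_commute: "x \<in> C \<Longrightarrow> pw x n \<cdot> om x = om x \<cdot> pw x n"
  using pw_commute[of x "om x"] om_commute by simp

lemma pinv_left_multiple: "y \<in> C \<Longrightarrow> \<exists>w\<in>C. pinv A y = w \<cdot> pw y n"
proof (induction n)
  case 0
  have "pinv A y = pinv A y \<cdot> pinv A y \<cdot> y"
    using 0 pinv_mult[of y] by (simp add: assoc pinv_commute)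
  then show ?case using 0 by auto
next
  case (Suc n)
  then obtain w where w: "w \<in> C" "pinv A y = w \<cdot> pw y n" by blast
  have "pinv A y = pinv A y \<cdot> pinv A y \<cdot> y"
    using Suc pinv_mult[of y] by (simp add: assoc pinv_commute)
  also have "\<dots> = pinv A y \<cdot> w \<cdot> pw y (Suc n)"
    using Suc w by (simp add: pw_Suc assoc)
  finally show ?case using w Suc by blast
qed

text \<open>
  Evaluated at a single element \<open>p\<close>, a term without inverses is a power of \<open>p\<close>. An inverse of such a
  power is divisible by high powers of \<open>p\<close> and so absorbs \<open>om p\<close>, a property that products inherit.
\<close>

lemma eval_constant:
  assumes p: "p \<in> C"
  shows "(\<exists>k. eval_uterm A (\<lambda>_. p) t = pw p k \<and> (k = 0 \<longrightarrow> \<not> compound t)) \<or>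
    eval_uterm A (\<lambda>_. p) t \<cdot> om p = eval_uterm A (\<lambda>_. p) t"
proof (induction t)
  case (Var i)
  then show ?case by (auto intro: exI[of _ 0])
next
  case (Mul s t)
  let ?s = "eval_uterm A (\<lambda>_. p) s" and ?t = "eval_uterm A (\<lambda>_. p) t"
  have st: "?s \<in> C" "?t \<in> C" using eval_closed[OF algebra] p by auto
  consider "?t \<cdot> om p = ?t" | k where "?s \<cdot> om p = ?s" "?t = pw p k"
    | j k where "?s = pw p j" "?t = pw p k" using Mul by blast
  then show ?case
  proof cases
    case 1 then show ?thesis using st p by (simp add: assoc)
  next
    case 2
    have "?s \<cdot> ?t \<cdot> om p = ?s \<cdot> om p \<cdot> ?t"
      using st p 2(2) pw_om_commute[OF p, of k] by (simp add: assoc)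
    then show ?thesis using 2(1) by simp
  next
    case 3
    then show ?thesis using pw_add[OF p] by auto
  qed
next
  case (Inv t)
  let ?t = "eval_uterm A (\<lambda>_. p) t"
  have t: "?t \<in> C" using eval_closed[OF algebra] p by auto
  have "\<exists>n. pw ?t n \<cdot> om p = pw ?t n"
  proof (cases "?t \<cdot> om p = ?t")
    case False
    then obtain k where k: "?t = pw p k" using Inv by blast
    obtain m where "\<forall>n\<ge>m. pw p n \<cdot> om p = pw p n" using pw_om_ge[OF p] by blast
    then have "pw ?t m \<cdot> om p = pw ?t m" using p by (simp add: k pw_pw)
    then show ?thesis by blast
  qed (auto intro: exI[of _ 0])
  then obtain n where n: "pw ?t n \<cdot> om p = pw ?t n" by blast
  obtain w where "w \<in> C" "pinv A ?t = w \<cdot> pw ?t n" using pinv_left_multiple[OF t] by blast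
  then show ?case using n t p by (simp add: assoc)
qed

text \<open>
  If \<open>t\<close> is another variable, the algebra is trivial. Otherwise all variables are set to \<open>p\<close>: unless
  \<open>p\<close> absorbs \<open>om p\<close> directly, it is a proper power of itself, hence equal to arbitrarily high powers of
  itself.
\<close>

lemma satisfies_Var_regular:
  assumes sat: "satisfies A (Var i) t" and t: "t \<noteq> Var i" and p: "p \<in> C"
  shows "p \<cdot> om p = p"
proof (cases "compound t")
  case False
  then obtain j where "t = Var j" by (auto simp: compound_def)
  moreover have "(if k = i then p else p \<cdot> om p) \<in> C" for k using p by simp
  ultimately show ?thesis
    using satisfiesD[OF sat, of "\<lambda>k. if k = i then p else p \<cdot> om p"] t by auto
next
  case True
  have eq: "eval_uterm A (\<lambda>_. p) t = p" using satisfiesD[OF sat, of "\<lambda>_. p"] p by simp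
  consider "p \<cdot> om p = p" | k where "p = pw p (Suc k)"
    using eval_constant[OF p, of t] True unfolding eq by (metis not0_implies_Suc)
  then show ?thesis
  proof cases
    case 2
    have "pw p (n * Suc k) = p" for n
    proof (induction n)
      case (Suc n)
      have "pw p (Suc n * Suc k) = pw p (n * Suc k) \<cdot> pw p k"
        using pw_add[OF p, of "n * Suc k" k] by (simp add: algebra_simps)
      also have "\<dots> = pw p (Suc k)" using Suc p by (simp add: pw_Suc')
      finally show ?case using 2 by simp
    qed simp
    moreover obtain m where "\<forall>n\<ge>m. pw p n \<cdot> om p = pw p n" using pw_om_ge[OF p] by blast
    ultimately show ?thesis by (metis le_add1 mult_Suc_right)
  qed simp
qed

end

section \<open>Commutative epigroups with Clifford squares\<close>

text \<open>
  Products absorb \<open>om\<close> of their factors, so the products of such an epigroup form a commutative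
  Clifford semigroup, that is, a semilattice of abelian groups.
\<close>

definition clifford_squares :: "'a unary_semigroup \<Rightarrow> bool" where
  "clifford_squares A \<longleftrightarrow>
     satisfies A (Mul (Var 0) (Var 1)) (Mul (Var 1) (Var 0)) \<and>
     satisfies A (Mul (omt (Var 0)) (Mul (Var 0) (Var 1))) (Mul (Var 0) (Var 1))"

text \<open>
  Among the commutative epigroups this identity singles out the abelian groups.
\<close>

definition group_like :: "'a unary_semigroup \<Rightarrow> bool" where
  "group_like A \<longleftrightarrow> satisfies A (Mul (omt (Var 0)) (Var 1)) (Var 1)"

locale clifford = epi +
  assumes commute: "x \<in> carrier A \<Longrightarrow> y \<in> carrier A \<Longrightarrow> mul A x y = mul A y x"
    and om_square: "x \<in> carrier A \<Longrightarrow> y \<in> carrier A \<Longrightarrow> mul A (om x) (mul A x y) = mul A x y"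

lemma (in epi) group_like_iff: "group_like A \<longleftrightarrow> (\<forall>x\<in>C. \<forall>y\<in>C. om x \<cdot> y = y)"
proof
  assume L: "group_like A"
  show "\<forall>x\<in>C. \<forall>y\<in>C. om x \<cdot> y = y"
  proof (intro ballI)
    fix x y assume "x \<in> C" "y \<in> C"
    then show "om x \<cdot> y = y"
      using L satisfiesD[of A "Mul (omt (Var 0)) (Var 1)" "Var 1" "\<lambda>i. if i = 0 then x else y"]
      by (simp add: group_like_def om_def)
  qed
qed (auto simp: group_like_def satisfies_def om_def)

lemma (in epi) clifford_squares_iff: "clifford_squares A \<longleftrightarrow> clifford A"
proof
  assume L: "clifford_squares A"
  show "clifford A"
  proof
    fix x y assume xy: "x \<in> C" "y \<in> C"
    show "x \<cdot> y = y \<cdot> x" "om x \<cdot> (x \<cdot> y) = x \<cdot> y"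
      using L xy satisfiesD[of A "Mul (Var 0) (Var 1)" "Mul (Var 1) (Var 0)"
          "\<lambda>i. if i = 0 then x else y"]
        satisfiesD[of A "Mul (omt (Var 0)) (Mul (Var 0) (Var 1))" "Mul (Var 0) (Var 1)"
          "\<lambda>i. if i = 0 then x else y"]
      by (simp_all add: clifford_squares_def om_def)
  qed
next
  assume "clifford A"
  then interpret clifford A .
  show "clifford_squares A"
    using commute om_square by (simp add: clifford_squares_def satisfies_def om_def)
qed

context clifford
begin

text \<open>
  The additional factor \<open>w\<close> puts even a term that is a bare variable into a product, so that the
  defining law applies to it; commutativity moves the subterm containing \<open>i\<close> to the front.
\<close>

lemma om_absorbs_factor:
  assumes v: "\<And>i. v i \<in> C"
  shows "i \<in> vars t \<Longrightarrow> w \<in> C \<Longrightarrow> om (v i) \<cdot> (eval_uterm A v t \<cdot> w) = eval_uterm A v t \<cdot> w"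
proof (induction t arbitrary: w)
  case (Var j)
  then show ?case using om_square v by simp
next
  case (Mul a b)
  have ab: "eval_uterm A v a \<in> C" "eval_uterm A v b \<in> C" using eval_closed[OF algebra] v by auto
  have 1: "eval_uterm A v (Mul a b) \<cdot> w = eval_uterm A v a \<cdot> (eval_uterm A v b \<cdot> w)"
    using ab Mul.prems by (simp add: assoc)
  have 2: "eval_uterm A v (Mul a b) \<cdot> w = eval_uterm A v b \<cdot> (eval_uterm A v a \<cdot> w)"
    using ab Mul.prems commute[OF ab] by (simp add: assoc)
  from Mul.prems(1) show ?case
  proof (simp only: vars.simps Un_iff, elim disjE)
    assume "i \<in> vars a" then show ?thesis unfolding 1 using Mul ab by simp
  next
    assume "i \<in> vars b" then show ?thesis unfolding 2 using Mul ab by simp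
  qed
next
  case (Inv a)
  have a: "eval_uterm A v a \<in> C" using eval_closed[OF algebra] v by auto
  then obtain u where "u \<in> C" "pinv A (eval_uterm A v a) = u \<cdot> eval_uterm A v a"
    using pinv_left_multiple[of _ 0] by auto
  then have "eval_uterm A v (Inv a) \<cdot> w = eval_uterm A v a \<cdot> (u \<cdot> w)"
    using a Inv.prems commute[of u] by (simp add: assoc)
  then show ?case using Inv \<open>u \<in> C\<close> by simp
qed

lemma om_absorbs_compound:
  assumes v: "\<And>i. v i \<in> C" and t: "compound t" "i \<in> vars t"
  shows "om (v i) \<cdot> eval_uterm A v t = eval_uterm A v t"
proof (cases t)
  case (Mul a b)
  have ab: "eval_uterm A v a \<in> C" "eval_uterm A v b \<in> C" using eval_closed[OF algebra] v by auto
  then show ?thesis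
    using om_absorbs_factor[of v, OF v, of i a "eval_uterm A v b"]
      om_absorbs_factor[of v, OF v, of i b "eval_uterm A v a"] t Mul commute[OF ab] by auto
next
  case (Inv a)
  have a: "eval_uterm A v a \<in> C" using eval_closed[OF algebra] v by auto
  then obtain u where "u \<in> C" "pinv A (eval_uterm A v a) = u \<cdot> eval_uterm A v a"
    using pinv_left_multiple[of _ 0] by auto
  then show ?thesis
    using om_absorbs_factor[of v, OF v, of i a u] t Inv a commute[of u] by auto
qed (use t in simp)

text \<open>
  Multiplication by an idempotent below all \<open>om (v i)\<close> moves an evaluation into the maximal subgroup
  at that idempotent; this is how identities of abelian groups act on the whole algebra.
\<close>

lemma eval_restrict:
  assumes v: "\<And>i. v i \<in> C" and e: "e \<in> C" "e \<cdot> e = e" and below: "\<And>i. i \<in> vars t \<Longrightarrow> e \<cdot> om (v i) = e"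
  shows "e \<cdot> om (eval_uterm A v t) = e \<and>
    e \<cdot> eval_uterm A v t \<in> units e \<and> eval_uterm A (\<lambda>i. e \<cdot> v i) t = e \<cdot> eval_uterm A v t"
proof -
  have unit: "e \<cdot> x \<in> units e \<and> pinv A (e \<cdot> x) = e \<cdot> pinv A x" if x: "x \<in> C" "e \<cdot> om x = e" for x
  proof -
    have ex: "e \<cdot> (e \<cdot> y) = e \<cdot> y" "e \<cdot> y \<cdot> e = e \<cdot> y" if "y \<in> C" for y
      using e that commute[of e "e \<cdot> y"] by (simp_all flip: assoc)
    have "e \<cdot> x \<cdot> (e \<cdot> pinv A x) = e \<cdot> x \<cdot> e \<cdot> pinv A x" using x(1) e by (simp add: assoc)
    also have "\<dots> = e \<cdot> om x" using x(1) e ex[of x] by (simp add: om_def assoc)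
    finally have 1: "e \<cdot> x \<cdot> (e \<cdot> pinv A x) = e" using x by simp
    then have 2: "e \<cdot> pinv A x \<cdot> (e \<cdot> x) = e" using x e commute[of "e \<cdot> x"] by simp
    have u: "e \<cdot> x \<in> units e"
      unfolding units_def using 1 2 ex[OF x(1)] ex[OF pinv_closed[OF x(1)]] x(1) e by blast
    have p: "pinv A (e \<cdot> x) \<in> units e" using pinv_units[OF e(1) u] .
    have "e \<cdot> pinv A x = e \<cdot> pinv A x \<cdot> (e \<cdot> x \<cdot> pinv A (e \<cdot> x))"
      using om_units[OF e(1) u] x e ex[of "pinv A x"] by (simp add: om_def)
    also have "\<dots> = e \<cdot> pinv A (e \<cdot> x)"
      using 2 x e assoc[of "e \<cdot> pinv A x" "e \<cdot> x" "pinv A (e \<cdot> x)"] by simp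
    also have "\<dots> = pinv A (e \<cdot> x)" using p by (simp add: units_def)
    finally show ?thesis using u by simp
  qed
  show ?thesis
    using below
  proof (induction t)
    case (Var i)
    then show ?case using unit[OF v] by simp
  next
    case (Mul a b)
    let ?a = "eval_uterm A v a" and ?b = "eval_uterm A v b"
    have ab: "?a \<in> C" "?b \<in> C" using eval_closed[OF algebra] v by auto
    have IH: "e \<cdot> om ?a = e" "e \<cdot> om ?b = e" "eval_uterm A (\<lambda>i. e \<cdot> v i) a = e \<cdot> ?a"
       "eval_uterm A (\<lambda>i. e \<cdot> v i) b = e \<cdot> ?b" using Mul by auto
    have "e \<cdot> (pinv A ?b \<cdot> pinv A ?a) \<cdot> (?a \<cdot> ?b) = e \<cdot> (om ?a \<cdot> om ?b)"
    proof -
      have "pinv A ?b \<cdot> pinv A ?a \<cdot> (?a \<cdot> ?b) = pinv A ?b \<cdot> (pinv A ?a \<cdot> ?a) \<cdot> ?b"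
        using ab by (simp add: assoc)
      also have "\<dots> = om ?a \<cdot> (pinv A ?b \<cdot> ?b)"
        using ab commute[of "pinv A ?b" "om ?a"] by (simp add: om_def assoc flip: pinv_commute)
      finally show ?thesis using ab e by (simp add: om_def assoc flip: pinv_commute)
    qed
    also have "\<dots> = e" using IH ab e by (simp flip: assoc)
    finally have z: "e \<cdot> (pinv A ?b \<cdot> pinv A ?a) \<cdot> (?a \<cdot> ?b) = e" .
    have "e \<cdot> (pinv A ?b \<cdot> pinv A ?a) \<cdot> e = e \<cdot> (pinv A ?b \<cdot> pinv A ?a)"
      using e ab commute[of "e \<cdot> (pinv A ?b \<cdot> pinv A ?a)" e] by (simp flip: assoc)
    then have om: "e \<cdot> om (?a \<cdot> ?b) = e"
      using absorb_om[OF _ _ e(1) z] e ab by simp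
    have "e \<cdot> ?a \<cdot> (e \<cdot> ?b) = ?a \<cdot> (e \<cdot> e) \<cdot> ?b"
      using e(1) ab commute[of e ?a] by (simp add: assoc)
    also have "\<dots> = e \<cdot> (?a \<cdot> ?b)" using e ab commute[of ?a e] by (simp add: assoc)
    finally have "e \<cdot> ?a \<cdot> (e \<cdot> ?b) = e \<cdot> (?a \<cdot> ?b)" .
    then show ?case using IH om unit[of "?a \<cdot> ?b"] ab by simp
  next
    case (Inv a)
    have a: "eval_uterm A v a \<in> C" using eval_closed[OF algebra] v by auto
    then show ?case using Inv unit[OF a] unit[of "pinv A (eval_uterm A v a)"] om_pinv_eq[OF a] by simp
  qed
qed

text \<open>
  The product of the idempotents \<open>om (v i)\<close>; it acts trivially wherever all of them do.
\<close>

lemma common_idempotent: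
  assumes "finite J" "J \<noteq> {}" and v: "\<And>i. v i \<in> C"
  shows "\<exists>e\<in>C. e \<cdot> e = e \<and> (\<forall>i\<in>J. e \<cdot> om (v i) = e) \<and>
    (\<forall>z\<in>C. (\<forall>i\<in>J. om (v i) \<cdot> z = z) \<longrightarrow> e \<cdot> z = z)"
  using assms(1,2)
proof (induction rule: finite_ne_induct)
  case (singleton i)
  then show ?case using v om_idem by (intro bexI[of _ "om (v i)"]) auto
next
  case (insert i J)
  then obtain e where e: "e \<in> C" "e \<cdot> e = e" "\<forall>i\<in>J. e \<cdot> om (v i) = e"
    "\<forall>z\<in>C. (\<forall>i\<in>J. om (v i) \<cdot> z = z) \<longrightarrow> e \<cdot> z = z" by blast
  let ?f = "om (v i)"
  have f: "?f \<in> C" "?f \<cdot> ?f = ?f" using v om_idem by auto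
  have "e \<cdot> ?f \<cdot> (e \<cdot> ?f) = e \<cdot> (?f \<cdot> e) \<cdot> ?f" using e f by (simp add: assoc)
  also have "\<dots> = e \<cdot> ?f" using e f commute[of ?f e] by (simp add: assoc) (simp flip: assoc)
  finally have 1: "e \<cdot> ?f \<cdot> (e \<cdot> ?f) = e \<cdot> ?f" .
  have 2: "e \<cdot> ?f \<cdot> om (v j) = e \<cdot> ?f" if "j \<in> insert i J" for j
  proof (cases "j = i")
    case True
    then show ?thesis using e f by (simp add: assoc)
  next
    case False
    have "e \<cdot> ?f \<cdot> om (v j) = e \<cdot> om (v j) \<cdot> ?f"
      using e(1) f(1) v[of j] commute[of ?f "om (v j)"] by (simp add: assoc)
    then show ?thesis using e(3) that False by simp
  qed
  have 3: "e \<cdot> ?f \<cdot> z = z" if "z \<in> C" "\<forall>j\<in>insert i J. om (v j) \<cdot> z = z" for z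
    using e(1,4) f(1) that by (simp add: assoc)
  show ?case using 1 2 3 e(1) f(1) by (intro bexI[of _ "e \<cdot> ?f"]) auto
qed

end

text \<open>
  Give the variable \<open>i\<close> the value \<open>e \<cdot> f\<close> and all other variables the value \<open>e\<close>. Then the value of a
  term only shows whether \<open>i\<close> occurs in it.
\<close>

lemma (in clifford) idempotents_equal:
  assumes sat: "satisfies A s t" and i: "i \<in> vars s" "i \<notin> vars t"
    and e: "e \<in> C" "e \<cdot> e = e" and f: "f \<in> C" "f \<cdot> f = f"
  shows "e \<cdot> f = e"
proof -
  have ef: "e \<cdot> f \<cdot> (e \<cdot> f) = e \<cdot> f"
    using e f commute[of f e] assoc[of e f "e \<cdot> f"] assoc[of f e f] assoc[of e e f] by (metis assoc mul_closed)
  have eef: "e \<cdot> (e \<cdot> f) = e \<cdot> f" "e \<cdot> f \<cdot> e = e \<cdot> f"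
    using e f commute[of "e \<cdot> f" e] by (simp_all flip: assoc)
  define v where "v j = (if j = i then e \<cdot> f else e)" for j
  have v: "v j \<in> C" for j using e f by (simp add: v_def)
  have pinv: "pinv A e = e" "pinv A (e \<cdot> f) = e \<cdot> f" using e f ef om_of_idem by auto
  have "eval_uterm A v u = (if i \<in> vars u then e \<cdot> f else e)" for u
    by (induction u) (use ef eef e pinv in \<open>auto simp: v_def\<close>)
  then show ?thesis using satisfiesD[OF sat, of v, OF v] i by simp
qed

lemma separating_identity:
  fixes X W :: "'a unary_semigroup set"
  assumes X: "epigroup_variety X" and W: "epigroup_variety W" and not: "\<not> X \<subseteq> W"
  obtains D a b where "D \<in> X" "(a, b) \<in> identities W" "\<not> satisfies D a b"
proof -
  obtain D where D: "D \<in> X" "D \<notin> W" using not by blast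
  then have "algebra D" using X identities_algebra by (auto simp: epigroup_variety_def)
  then show ?thesis
    using in_varietyI[of W D] W D that unfolding epigroup_variety_def by blast
qed

lemma not_SL_subset:
  fixes W :: "'a unary_semigroup set"
  assumes W: "epigroup_variety W" and not: "\<not> SL \<subseteq> W"
  obtains a b i where "(a, b) \<in> identities W" "i \<in> vars a" "i \<notin> vars b"
proof -
  obtain D :: "'a unary_semigroup" and a b
    where D: "D \<in> SL" "(a, b) \<in> identities W" "\<not> satisfies D a b"
    using separating_identity[OF epigroup_variety_SL W not] by blast
  then have "vars a \<noteq> vars b" using satisfies_SL by blast
  moreover have "(b, a) \<in> identities W" using D(2) by (auto simp: identities_def satisfies_def)
  ultimately show ?thesis using D(2) that by blast
qed

text \<open>
  An identity that fails under zero multiplication has a bare variable on one side.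
\<close>

lemma not_ZM_subset:
  fixes W :: "'a unary_semigroup set"
  assumes W: "epigroup_variety W" and not: "\<not> ZM \<subseteq> W"
  shows "(Mul (Var 0) (omt (Var 0)), Var 0) \<in> identities W"
proof -
  obtain D :: "'a unary_semigroup" and a b
    where D: "D \<in> ZM" "(a, b) \<in> identities W" "\<not> satisfies D a b"
    using separating_identity[OF epigroup_variety_ZM W not] by blast
  have "a \<noteq> b" "\<not> (compound a \<and> compound b)"
    using D satisfies_ZM by (auto simp: satisfies_def)
  moreover have "(b, a) \<in> identities W" using D(2) by (auto simp: identities_def satisfies_def)
  ultimately obtain i t where t: "(Var i, t) \<in> identities W" "t \<noteq> Var i"
    using D(2) unfolding compound_def by metis
  have "satisfies A (Mul (Var 0) (omt (Var 0))) (Var 0)" if A: "A \<in> W" for A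
  proof -
    interpret epi A using W A by (simp add: epigroup_variety_def epigroup_iff)
    have "satisfies A (Var i) t" using t A by (auto simp: identities_def)
    then show ?thesis using satisfies_Var_regular t(2) by (simp add: satisfies_def om_def)
  qed
  then show ?thesis by (auto simp: identities_def)
qed

text \<open>
  Let \<open>e\<close> be the product of the \<open>om (v i)\<close> over the variables of \<open>s\<close> and \<open>t\<close>. The maximal subgroup at
  \<open>e\<close> is an abelian group in \<open>W\<close>, so \<open>s\<close> and \<open>t\<close> agree after multiplication by \<open>e\<close>. It remains to see
  that \<open>e\<close> fixes both values. A compound term absorbs \<open>om\<close> of its own variables; a bare variable does
  so if \<open>ZM\<close> is not contained in \<open>W\<close>; and if the two sides have different variables, then \<open>SL\<close> is
  not contained in \<open>W\<close>, so that all idempotents coincide.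
\<close>

lemma identity_from_parts:
  fixes W :: "'a unary_semigroup set"
  assumes W: "epigroup_variety W" and cs: "\<And>A. A \<in> W \<Longrightarrow> clifford_squares A"
    and groups: "\<And>A. A \<in> W \<Longrightarrow> group_like A \<Longrightarrow> satisfies A s t"
    and sl: "SL \<subseteq> W \<Longrightarrow> vars s = vars t"
    and zm: "ZM \<subseteq> W \<Longrightarrow> s = t \<or> compound s \<and> compound t"
  shows "(s, t) \<in> identities W"
proof (cases "s = t")
  case True
  then show ?thesis by (simp add: identities_def satisfies_def)
next
  case neq: False
  have var: "variety W" using W by (simp add: epigroup_variety_def)
  have "eval_uterm A v s = eval_uterm A v t" if A: "A \<in> W" and v: "\<And>i. v i \<in> carrier A" for A v
  proof -
    interpret epi A using W A by (simp add: epigroup_variety_def epigroup_iff)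
    interpret clifford A using cs[OF A] by (simp add: clifford_squares_iff)
    define J where "J = vars s \<union> vars t"
    obtain e where e: "e \<in> carrier A" "mul A e e = e" "\<And>i. i \<in> J \<Longrightarrow> mul A e (om (v i)) = e"
      and e': "\<And>z. z \<in> carrier A \<Longrightarrow> (\<And>i. i \<in> J \<Longrightarrow> mul A (om (v i)) z = z) \<Longrightarrow> mul A e z = z"
      using common_idempotent[of J v] v by (auto simp: J_def vars_nonempty)
    define w where "w i = (if i \<in> J then mul A e (v i) else e)" for i
    define B where "B = A\<lparr>carrier := units e\<rparr>"
    have BW: "B \<in> W"
      unfolding B_def
    proof (rule subalgebra_in_variety[OF var A])
      show "units e \<subseteq> carrier A" by (auto simp: units_def)
      show "units e \<noteq> {}" using unit_in_units[OF e(1,2)] by blast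
    qed (fact units_mult[OF e(1)], fact pinv_units[OF e(1)])
    have evB: "eval_uterm B w u = eval_uterm A w u" for u by (induction u) (auto simp: B_def)
    interpret B: epi B using W BW by (simp add: epigroup_variety_def epigroup_iff)
    have BA: "B.om x = om x" "carrier B = units e" "mul B = mul A" for x
      unfolding B.om_def om_def by (simp_all add: B_def)
    have "group_like B"
      unfolding B.group_like_iff BA using om_units[OF e(1)] by (simp add: units_def)
    then have "satisfies B s t" using groups BW by blast
    moreover have "w i \<in> carrier B" for i
      using eval_restrict[of v e "Var i", OF v e(1,2)] e(3) unit_in_units[OF e(1,2)]
      by (simp add: w_def B_def)
    ultimately have "eval_uterm A w s = eval_uterm A w t"
      using satisfiesD[of B s t w] by (simp add: evB)
    moreover have "eval_uterm A w u = mul A e (eval_uterm A v u)" if "vars u \<subseteq> J" for u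
    proof -
      have "eval_uterm A w u = eval_uterm A (\<lambda>i. mul A e (v i)) u"
        using that by (intro eval_cong) (auto simp: w_def)
      then show ?thesis using eval_restrict[of v e u, OF v e(1,2)] e(3) that by auto
    qed
    ultimately have eq: "mul A e (eval_uterm A v s) = mul A e (eval_uterm A v t)" by (simp add: J_def)
    have own: "mul A (om (v i)) (eval_uterm A v u) = eval_uterm A v u"
      if u: "u = s \<or> u = t" "i \<in> vars u" for u i
    proof (cases "compound u")
      case True
      then show ?thesis using om_absorbs_compound v u by blast
    next
      case False
      then have "\<not> ZM \<subseteq> W" using zm neq u by blast
      then have reg: "satisfies A (Mul (Var 0) (omt (Var 0))) (Var 0)"
        using not_ZM_subset[OF W] A by (auto simp: identities_def)
      have "mul A x (om x) = x" if "x \<in> carrier A" for x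
        using satisfiesD[OF reg, of "\<lambda>_. x"] that by (simp add: om_def)
      then show ?thesis using False u v om_commute by (auto simp: compound_def)
    qed
    have "mul A (om (v i)) (eval_uterm A v u) = eval_uterm A v u"
      if u: "u = s \<or> u = t" and i: "i \<in> J" for u i
    proof (cases "i \<in> vars u")
      case False
      then have "\<not> SL \<subseteq> W" using sl u i by (auto simp: J_def)
      then obtain a b k where k: "(a, b) \<in> identities W" "k \<in> vars a" "k \<notin> vars b"
        using not_SL_subset[OF W] by blast
      have sat: "satisfies A a b" using k(1) A by (auto simp: identities_def)
      have all: "mul A f g = f" if "f \<in> carrier A" "mul A f f = f" "g \<in> carrier A" "mul A g g = g" for f g
        using idempotents_equal[OF sat k(2,3) that] .
      obtain j where j: "j \<in> vars u" using vars_nonempty by blast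
      have "om (v i) = om (v j)"
        using all[of "om (v i)" "om (v j)"] all[of "om (v j)" "om (v i)"] v om_idem
          commute[of "om (v i)" "om (v j)"] by simp
      then show ?thesis using own[OF u j] by simp
    qed (use own u in blast)
    then have "mul A e (eval_uterm A v u) = eval_uterm A v u" if "u = s \<or> u = t" for u
      using that by (intro e' eval_closed[of A v, OF algebra v]) simp
    then have es: "mul A e (eval_uterm A v s) = eval_uterm A v s"
      and et: "mul A e (eval_uterm A v t) = eval_uterm A v t" by blast+
    show ?thesis using eq unfolding es et .
  qed
  then show ?thesis by (auto simp: identities_def satisfies_def)
qed

section \<open>Decomposition into abelian groups, semilattices and zero multiplication\<close>

definition clifford_identities :: "(uterm \<times> uterm) set" where
  "clifford_identities = {(Mul (Var 0) (Var 1), Mul (Var 1) (Var 0)),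
     (Mul (omt (Var 0)) (Mul (Var 0) (Var 1)), Mul (Var 0) (Var 1))}"

lemma clifford_identities_iff:
  "clifford_identities \<subseteq> identities V \<longleftrightarrow> (\<forall>A\<in>V. clifford_squares A)"
  by (auto simp: clifford_identities_def identities_def clifford_squares_def)

lemma group_like_comm_group:
  assumes A: "epigroup A" and cs: "clifford_squares A" and gl: "group_like A"
  shows "\<exists>e. comm_group (as_monoid A (carrier A) e)"
proof -
  interpret epi A using A by (simp add: epigroup_iff)
  interpret clifford A using cs by (simp add: clifford_squares_iff)
  have gl: "mul A (om x) y = y" if "x \<in> carrier A" "y \<in> carrier A" for x y
    using gl that by (simp add: group_like_iff)
  obtain a where a: "a \<in> carrier A" using algebra by (auto simp: algebra_def)
  have "comm_group (as_monoid A (carrier A) (om a))"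
  proof (rule comm_groupI)
    fix x assume x: "x \<in> carrier (as_monoid A (carrier A) (om a))"
    then have x: "x \<in> carrier A" by (simp add: as_monoid_def)
    have "om x = om a" using gl[of x "om a"] gl[of a "om x"] x a commute[of "om x" "om a"] by simp
    then have "mul A (pinv A x) x = om a" using pinv_commute[OF x] by (simp add: om_def)
    then show "\<exists>y\<in>carrier (as_monoid A (carrier A) (om a)).
        y \<otimes>\<^bsub>as_monoid A (carrier A) (om a)\<^esub> x = \<one>\<^bsub>as_monoid A (carrier A) (om a)\<^esub>"
      using x by (auto simp: as_monoid_def)
  qed (use a gl assoc commute in \<open>auto simp: as_monoid_def\<close>)
  then show ?thesis by blast
qed

lemma comm_group_group_like:
  assumes A: "epigroup A" and G: "comm_group (as_monoid A (carrier A) e)"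
  shows "group_like A" "clifford_squares A"
proof -
  interpret epi A using A by (simp add: epigroup_iff)
  interpret G: comm_group "as_monoid A (carrier A) e" by fact
  have e: "e \<in> carrier A" "\<And>x. x \<in> carrier A \<Longrightarrow> mul A e x = x"
    and comm: "\<And>x y. x \<in> carrier A \<Longrightarrow> y \<in> carrier A \<Longrightarrow> mul A x y = mul A y x"
    using G.one_closed G.l_one G.m_comm by (simp_all add: as_monoid_def)
  have gl: "mul A (om x) y = y" if x: "x \<in> carrier A" and y: "y \<in> carrier A" for x y
  proof -
    have "om x = e"
      using G.l_cancel_one[of "om x" "om x"] x om_idem[OF x] by (simp add: as_monoid_def)
    then show ?thesis using e y by simp
  qed
  show "group_like A" using gl by (simp add: group_like_iff)
  show "clifford_squares A" unfolding clifford_squares_iff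
  proof (unfold_locales, goal_cases)
    case (1 x y) then show ?case by (rule comm)
  next
    case (2 x y) then show ?case using gl by simp
  qed
qed

lemma group_like_part:
  fixes V :: "'a unary_semigroup set"
  assumes V: "epigroup_variety V" and cs: "\<And>A. A \<in> V \<Longrightarrow> clifford_squares A"
  shows "abelian_group_variety {A \<in> V. group_like A}"
proof -
  let ?g = "(Mul (omt (Var 0)) (Var 1), Var 1)"
  have "V = models (identities V)" using V by (simp add: epigroup_variety_def variety_models)
  moreover have "(models (insert ?g (identities V)) :: 'a unary_semigroup set)
      = {A \<in> models (identities V). group_like A}"
    unfolding models_def group_like_def by blast
  ultimately have "{A \<in> V. group_like A} = models (insert ?g (identities V))" by simp
  then have "epigroup_variety {A \<in> V. group_like A}"
    using V varietyI_models by (auto simp: epigroup_variety_def)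
  then show ?thesis
    using cs group_like_comm_group unfolding abelian_group_variety_def epigroup_variety_def by blast
qed

text \<open>
  \<open>G\<close> consists of the abelian groups in \<open>V\<close>, and \<open>X\<close> records which of \<open>SL\<close> and \<open>ZM\<close> are contained
  in \<open>V\<close>. By \<open>identity_from_parts\<close> the identities of these parts are all identities of \<open>V\<close>.
\<close>

theorem clifford_squares_decomposition:
  fixes V :: "'a unary_semigroup set"
  assumes inf: "infinite (UNIV :: 'a set)" and V: "epigroup_variety V"
  shows "(\<forall>A\<in>V. clifford_squares A) \<longleftrightarrow>
    (\<exists>G X. abelian_group_variety G \<and>
       X \<in> {trivial_variety, SL, ZM, SL \<squnion>\<^bsub>EPI\<^esub> ZM} \<and>
       V = G \<squnion>\<^bsub>EPI\<^esub> X)"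
proof
  assume cs: "\<forall>A\<in>V. clifford_squares A"
  define G where "G = {A \<in> V. group_like A}"
  have G: "abelian_group_variety G" unfolding G_def using group_like_part V cs by blast
  have triv: "trivial_variety \<subseteq> V"
  proof
    fix A :: "'a unary_semigroup" assume "A \<in> trivial_variety"
    then obtain a where a: "carrier A = {a}" "algebra A"
      by (auto simp: trivial_variety_def epigroup_def)
    have "satisfies A s t" for s t
      using eval_closed[OF a(2)] a(1) by (simp add: satisfies_def)
    then show "A \<in> V" using V a(2) by (intro in_varietyI) (simp_all add: epigroup_variety_def)
  qed
  define X :: "'a unary_semigroup set" where "X = (if SL \<subseteq> V then if ZM \<subseteq> V then SL \<squnion>\<^bsub>EPI\<^esub> ZM else SL
    else if ZM \<subseteq> V then ZM else trivial_variety)"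
  note SLZM = join_EPI[OF inf epigroup_variety_SL epigroup_variety_ZM]
  have X: "X \<in> {trivial_variety, SL, ZM, SL \<squnion>\<^bsub>EPI\<^esub> ZM}" by (simp add: X_def)
  then have Xv: "epigroup_variety X"
    using epigroup_variety_SL epigroup_variety_ZM epigroup_variety_trivial SLZM(2) by auto
  have "identities V \<subseteq> identities X"
    using identities_antimono[of SL V] identities_antimono[of ZM V]
      identities_antimono[OF triv] SLZM(3) by (auto simp: X_def)
  moreover have "identities V \<subseteq> identities G" by (intro identities_antimono) (auto simp: G_def)
  moreover have "(s, t) \<in> identities V" if st: "(s, t) \<in> identities G" "(s, t) \<in> identities X" for s t
  proof (rule identity_from_parts[OF V])
    show "SL \<subseteq> V \<Longrightarrow> vars s = vars t"
      using st(2) SLZM(3) identities_SL[OF inf, of s t] by (auto simp: X_def split: if_splits)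
    show "ZM \<subseteq> V \<Longrightarrow> s = t \<or> compound s \<and> compound t"
      using st(2) SLZM(3) identities_ZM[OF inf, of s t] by (auto simp: X_def split: if_splits)
  qed (use st(1) cs in \<open>auto simp: G_def identities_def\<close>)
  ultimately have "identities V = identities G \<inter> identities X" by auto
  moreover have Gv: "epigroup_variety G" using G by (simp add: abelian_group_variety_def)
  ultimately have "V = G \<squnion>\<^bsub>EPI\<^esub> X"
    using join_EPI(1)[OF inf Gv Xv] variety_models[of V] V by (simp add: epigroup_variety_def)
  then show "\<exists>G X. abelian_group_variety G \<and> X \<in> {trivial_variety, SL, ZM, SL \<squnion>\<^bsub>EPI\<^esub> ZM} \<and>
       V = G \<squnion>\<^bsub>EPI\<^esub> X" using G X by blast
next
  assume "\<exists>G X. abelian_group_variety G \<and> X \<in> {trivial_variety, SL, ZM, SL \<squnion>\<^bsub>EPI\<^esub> ZM} \<and>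
       V = G \<squnion>\<^bsub>EPI\<^esub> X"
  then obtain G X :: "'a unary_semigroup set" where G: "abelian_group_variety G"
    and X: "X \<in> {trivial_variety, SL, ZM, SL \<squnion>\<^bsub>EPI\<^esub> ZM}" and VGX: "V = G \<squnion>\<^bsub>EPI\<^esub> X" by blast
  note SLZM = join_EPI[OF inf epigroup_variety_SL epigroup_variety_ZM]
  have Gv: "epigroup_variety G" using G by (simp add: abelian_group_variety_def)
  have Xv: "epigroup_variety X"
    using X epigroup_variety_SL epigroup_variety_ZM epigroup_variety_trivial SLZM(2) by auto
  have "clifford_identities \<subseteq> identities (SL :: 'a unary_semigroup set) \<inter>
      identities (ZM :: 'a unary_semigroup set)"
    using identities_SL[OF inf] identities_ZM[OF inf] by (auto simp: clifford_identities_def)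
  moreover have "clifford_identities \<subseteq> identities (trivial_variety :: 'a unary_semigroup set)"
    unfolding clifford_identities_iff
    by (auto simp: clifford_squares_def satisfies_def trivial_variety_def epigroup_def algebra_def)
  ultimately have "clifford_identities \<subseteq> identities X" using X SLZM(3) by auto
  moreover have "clifford_identities \<subseteq> identities G"
    unfolding clifford_identities_iff
  proof
    fix A assume A: "A \<in> G"
    then obtain e where e: "comm_group (as_monoid A (carrier A) e)"
      using G by (auto simp: abelian_group_variety_def)
    have "epigroup A" using A Gv by (simp add: epigroup_variety_def)
    then show "clifford_squares A" by (rule comm_group_group_like(2)[OF _ e])
  qed
  ultimately show "\<forall>A\<in>V. clifford_squares A"
    using join_EPI(3)[OF inf Gv Xv] VGX by (simp flip: clifford_identities_iff)
qed

section \<open>Exponents\<close>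

text \<open>
  The exponent of a variable when the term is evaluated in an abelian group.
\<close>

primrec cnt :: "nat \<Rightarrow> uterm \<Rightarrow> int" where
  "cnt i (Var j) = (if j = i then 1 else 0)"
| "cnt i (Mul s t) = cnt i s + cnt i t"
| "cnt i (Inv t) = - cnt i t"

primrec npow :: "uterm \<Rightarrow> nat \<Rightarrow> uterm" where
  "npow t 0 = omt t"
| "npow t (Suc n) = Mul (npow t n) t"

text \<open>
  The power with integer exponent \<open>k\<close> of \<open>x \<cdot> om x\<close> in the maximal subgroup at \<open>om x\<close>.
\<close>

definition ipow :: "int \<Rightarrow> uterm" where
  "ipow k = (let g = Mul (Var 0) (omt (Var 0)) in
     if k \<ge> 0 then npow g (nat k) else npow (Inv g) (nat (- k)))"

text \<open>
  The common exponents of all maximal subgroups of members of \<open>V\<close>. Since they are defined by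
  identities, the exponents of a join are the common exponents.
\<close>

definition exponents :: "'a unary_semigroup set \<Rightarrow> int set" where
  "exponents V = {k. (ipow k, ipow 0) \<in> identities V}"

context epi
begin

lemma unit_group:
  assumes e: "e \<in> C" "e \<cdot> e = e"
  shows "group (as_monoid A (units e) e)"
    and "h \<in> units e \<Longrightarrow> inv\<^bsub>as_monoid A (units e) e\<^esub> h = pinv A h"
proof -
  show "group (as_monoid A (units e) e)" using units_subgroup[OF e] by (simp add: sg_subgroup_def)
  assume h: "h \<in> units e"
  have hC: "h \<in> C" using h by (simp add: units_def)
  have "pinv A h \<cdot> h = e" "h \<cdot> pinv A h = e"
    using om_units[OF e(1) h] pinv_commute[OF hC] by (simp_all add: om_def)
  moreover have "pinv A h \<in> units e" using pinv_units[OF e(1) h] .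
  ultimately show "inv\<^bsub>as_monoid A (units e) e\<^esub> h = pinv A h"
    by (intro inv_units[OF e h]) (auto simp: units_def)
qed

lemma eval_cnt:
  assumes e: "e \<in> C" "e \<cdot> e = e" and h: "h \<in> units e"
  shows "eval_uterm A (\<lambda>j. if j = i then h else e) t = h [^]\<^bsub>as_monoid A (units e) e\<^esub> cnt i t"
proof -
  let ?G = "as_monoid A (units e) e"
  interpret G: group ?G using unit_group(1)[OF e] .
  have hG: "h \<in> carrier ?G" using h by (simp add: as_monoid_def)
  show ?thesis
  proof (induction t)
    case (Var j)
    have "\<one>\<^bsub>?G\<^esub> = e" by (simp add: as_monoid_def)
    then show ?case using hG by simp
  next
    case (Mul s t)
    then show ?case using G.int_pow_mult[OF hG] by (simp add: as_monoid_def)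
  next
    case (Inv t)
    have "h [^]\<^bsub>?G\<^esub> cnt i t \<in> units e" using G.int_pow_closed[OF hG] by (simp add: as_monoid_def)
    then show ?case using Inv G.int_pow_neg[OF hG] unit_group(2)[OF e] by simp
  qed
qed

lemma eval_ipow:
  assumes v: "v 0 \<in> C"
  shows "eval_uterm A v (ipow k) =
    (v 0 \<cdot> om (v 0)) [^]\<^bsub>as_monoid A (units (om (v 0))) (om (v 0))\<^esub> k"
proof -
  let ?e = "om (v 0)" and ?h = "v 0 \<cdot> om (v 0)"
  let ?G = "as_monoid A (units ?e) ?e"
  have e: "?e \<in> C" "?e \<cdot> ?e = ?e" using v om_idem by auto
  interpret G: group ?G using unit_group(1)[OF e] .
  have h: "?h \<in> units ?e" using unit_om[OF v] .
  then have hG: "?h \<in> carrier ?G" by (simp add: as_monoid_def)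
  have npow: "eval_uterm A v (npow t n) = x [^]\<^bsub>?G\<^esub> int n"
    if x: "eval_uterm A v t = x" "x \<in> units ?e" for t n x
  proof (induction n)
    case 0
    have "x \<cdot> pinv A x = ?e" using om_units[OF e(1) x(2)] by (simp add: om_def)
    then show ?case using x by (simp add: as_monoid_def)
  next
    case (Suc n)
    have "x \<in> carrier ?G" using x by (simp add: as_monoid_def)
    then have "x [^]\<^bsub>?G\<^esub> int (Suc n) = x [^]\<^bsub>?G\<^esub> int n \<otimes>\<^bsub>?G\<^esub> x"
      by (simp add: int_pow_int del: of_nat_Suc)
    then show ?case using Suc x by (simp add: as_monoid_def)
  qed
  have ev: "eval_uterm A v (Mul (Var 0) (omt (Var 0))) = ?h" by (simp add: om_def)
  show ?thesis
  proof (cases "k \<ge> 0")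
    case True
    then show ?thesis using npow[OF ev h, of "nat k"] by (simp add: ipow_def Let_def)
  next
    case False
    have inv: "eval_uterm A v (Inv (Mul (Var 0) (omt (Var 0)))) = inv\<^bsub>?G\<^esub> ?h"
      using unit_group(2)[OF e h] ev by simp
    have "inv\<^bsub>?G\<^esub> ?h \<in> units ?e" using G.inv_closed[OF hG] by (simp add: as_monoid_def)
    then show ?thesis
      using False npow[OF inv, of "nat (- k)"] G.int_pow_inv[OF hG, of "- k"] G.int_pow_neg[OF hG, of "- k"]
      by (simp add: ipow_def Let_def)
  qed
qed

end

lemma exponents_iff:
  assumes "\<forall>A\<in>V. epigroup A"
  shows "k \<in> exponents V \<longleftrightarrow> (\<forall>A\<in>V. \<forall>x\<in>carrier A.
    mul A x (epi.om A x) [^]\<^bsub>as_monoid A (sg.units A (epi.om A x)) (epi.om A x)\<^esub> k = epi.om A x)"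
proof -
  have "satisfies A (ipow k) (ipow 0) \<longleftrightarrow> (\<forall>x\<in>carrier A.
      mul A x (epi.om A x) [^]\<^bsub>as_monoid A (sg.units A (epi.om A x)) (epi.om A x)\<^esub> k = epi.om A x)"
    if "A \<in> V" for A
  proof -
    interpret epi A using assms that by (simp add: epigroup_iff)
    have ev: "eval_uterm A v (ipow k) = eval_uterm A v (ipow 0) \<longleftrightarrow>
        mul A (v 0) (om (v 0)) [^]\<^bsub>as_monoid A (units (om (v 0))) (om (v 0))\<^esub> k = om (v 0)"
      if "v 0 \<in> carrier A" for v
      using eval_ipow[of v, OF that] by (simp add: as_monoid_def)
    show ?thesis
    proof (intro iffI ballI)
      fix x assume "x \<in> carrier A" "satisfies A (ipow k) (ipow 0)"
      then show "mul A x (om x) [^]\<^bsub>as_monoid A (units (om x)) (om x)\<^esub> k = om x"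
        using satisfiesD[of A _ _ "\<lambda>_. x"] ev[of "\<lambda>_. x"] by blast
    qed (auto simp: satisfies_def ev)
  qed
  then show ?thesis by (simp add: exponents_def identities_def)
qed

lemma int_subgroup_principal:
  fixes S :: "int set"
  assumes zero: "0 \<in> S" and diff: "\<And>k l. k \<in> S \<Longrightarrow> l \<in> S \<Longrightarrow> k - l \<in> S"
  shows "\<exists>d. S = {k. d dvd k}"
proof (cases "S \<subseteq> {0}")
  case True
  then have "S = {k. 0 dvd k}" using zero by auto
  then show ?thesis by blast
next
  case False
  have neg: "- k \<in> S" if "k \<in> S" for k using diff[OF zero that] by simp
  have add: "k + l \<in> S" if "k \<in> S" "l \<in> S" for k l using diff[OF that(1) neg[OF that(2)]] by simp
  have nmult: "int n * k \<in> S" if "k \<in> S" for n k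
    by (induction n) (use zero add that in \<open>auto simp: algebra_simps\<close>)
  have mult: "q * k \<in> S" if "k \<in> S" for q k
    using nmult[OF that, of "nat q"] neg[OF nmult[OF that, of "nat (- q)"]] by (cases "q \<ge> 0") auto
  obtain k where k: "k \<in> S" "k \<noteq> 0" using False by blast
  define P where "P n \<longleftrightarrow> n > 0 \<and> int n \<in> S" for n
  define d where "d = (LEAST n. P n)"
  have "P (nat \<bar>k\<bar>)" using k neg by (simp add: P_def abs_if)
  then have "P d" unfolding d_def by (rule LeastI)
  then have d: "d > 0" "int d \<in> S" by (simp_all add: P_def)
  have "int d dvd l" if l: "l \<in> S" for l
  proof (rule ccontr)
    assume "\<not> int d dvd l"
    then have pos: "l mod int d > 0" using d(1)
      by (metis mod_eq_0_iff_dvd of_nat_0_less_iff order_le_less pos_mod_sign)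
    have "l mod int d \<in> S" using diff[OF l mult[OF d(2), of "l div int d"]] by (simp add: minus_div_mult_eq_mod)
    then have "P (nat (l mod int d))" using pos by (simp add: P_def)
    moreover have "nat (l mod int d) < d" using d(1) pos by (simp add: nat_less_iff)
    ultimately show False unfolding d_def using not_less_Least by blast
  qed
  moreover have "l \<in> S" if "int d dvd l" for l
    using that mult[OF d(2)] by (auto simp: dvd_def mult.commute)
  ultimately show ?thesis by blast
qed

lemma exponents_principal:
  assumes V: "\<forall>A\<in>V. epigroup A"
  shows "\<exists>d. exponents V = {k. d dvd k}"
proof (rule int_subgroup_principal)
  show "0 \<in> exponents V" by (simp add: exponents_def identities_def satisfies_def)
next
  fix k l assume kl: "k \<in> exponents V" "l \<in> exponents V"
  show "k - l \<in> exponents V"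
    unfolding exponents_iff[OF V]
  proof (intro ballI)
    fix A x assume A: "A \<in> V" and x: "x \<in> carrier A"
    interpret epi A using A V by (simp add: epigroup_iff)
    interpret G: group "as_monoid A (units (om x)) (om x)"
      using unit_group(1) om_idem x by blast
    have "mul A x (om x) \<in> carrier (as_monoid A (units (om x)) (om x))"
      using unit_om[OF x] by (simp add: as_monoid_def)
    moreover have "\<one>\<^bsub>as_monoid A (units (om x)) (om x)\<^esub> = om x" by (simp add: as_monoid_def)
    ultimately show "mul A x (om x) [^]\<^bsub>as_monoid A (units (om x)) (om x)\<^esub> (k - l) = om x"
      using kl[unfolded exponents_iff[OF V]] A x G.int_pow_diff G.r_inv[OF G.one_closed]
      by (metis (lifting) G.r_one G.inv_one G.one_closed)
  qed
qed

text \<open>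
  Substituting \<open>x\<^sup>\<omega>\<close> for all variables but one extracts from an identity its exponent in that
  variable.
\<close>

lemma cnt_exponents:
  assumes V: "\<forall>A\<in>V. epigroup A" and st: "(s, t) \<in> identities V"
  shows "cnt i s - cnt i t \<in> exponents V"
  unfolding exponents_iff[OF V]
proof (intro ballI)
  fix A x assume A: "A \<in> V" and x: "x \<in> carrier A"
  interpret epi A using A V by (simp add: epigroup_iff)
  let ?G = "as_monoid A (units (om x)) (om x)" and ?h = "mul A x (om x)"
  have e: "om x \<in> carrier A" "mul A (om x) (om x) = om x" using x om_idem by auto
  interpret G: group ?G using unit_group(1)[OF e] .
  have h: "?h \<in> units (om x)" using unit_om[OF x] .
  then have hG: "?h \<in> carrier ?G" by (simp add: as_monoid_def)
  have "satisfies A s t" using st A by (auto simp: identities_def)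
  then have "?h [^]\<^bsub>?G\<^esub> cnt i s = ?h [^]\<^bsub>?G\<^esub> cnt i t"
    using satisfiesD[of A s t "\<lambda>j. if j = i then ?h else om x"] x e eval_cnt[OF e h, of i] by simp
  then have "?h [^]\<^bsub>?G\<^esub> (cnt i s - cnt i t) = \<one>\<^bsub>?G\<^esub>"
    using G.int_pow_diff[OF hG] G.r_inv hG by simp
  then show "?h [^]\<^bsub>?G\<^esub> (cnt i s - cnt i t) = om x" by (simp add: as_monoid_def)
qed

section \<open>Cyclic groups\<close>

text \<open>
  The cyclic group of order \<open>d\<close>, and the infinite cyclic group if \<open>d = 0\<close>, as \<open>x mod 0 = x\<close>.
\<close>

definition Zmod :: "int \<Rightarrow> int unary_semigroup" where
  "Zmod d = \<lparr>carrier = {x. x mod d = x}, mul = (\<lambda>x y. (x + y) mod d), pinv = (\<lambda>x. (- x) mod d)\<rparr>"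

lemma algebra_Zmod: "algebra (Zmod d)"
  by (auto simp: algebra_def Zmod_def intro: exI[of _ 0])

lemma eval_Zmod:
  assumes v: "\<And>i. v i mod d = v i" and I: "finite I" "vars t \<subseteq> I"
  shows "eval_uterm (Zmod d) v t = (\<Sum>i\<in>I. cnt i t * v i) mod d"
  using I(2)
proof (induction t)
  case (Var j)
  have "(\<Sum>i\<in>I. cnt i (Var j) * v i) = (\<Sum>i\<in>I. if i = j then v j else 0)"
    by (rule sum.cong) auto
  then show ?case using Var v I(1) by (simp add: Zmod_def)
next
  case (Mul s t)
  then show ?case by (simp add: Zmod_def sum.distrib distrib_right mod_simps)
next
  case (Inv t)
  then show ?case by (simp add: Zmod_def sum_negf mod_simps)
qed

lemma satisfies_Zmod: "satisfies (Zmod d) s t \<longleftrightarrow> (\<forall>i. d dvd cnt i s - cnt i t)"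
proof
  assume sat: "satisfies (Zmod d) s t"
  show "\<forall>i. d dvd cnt i s - cnt i t"
  proof
    fix i :: nat
    define v where "v j = (if j = i then 1 mod d else 0)" for j
    have v: "v j mod d = v j" for j by (simp add: v_def)
    let ?I = "insert i (vars s \<union> vars t)"
    have ev: "eval_uterm (Zmod d) v u = cnt i u mod d" if "u = s \<or> u = t" for u
    proof -
      have "(\<Sum>j\<in>?I. cnt j u * v j) = (\<Sum>j\<in>?I. if j = i then cnt i u * (1 mod d) else 0)"
        by (rule sum.cong) (auto simp: v_def)
      then show ?thesis using eval_Zmod[of v d ?I u, OF v] that by (auto simp: mod_simps)
    qed
    have "v j \<in> carrier (Zmod d)" for j using v by (simp add: Zmod_def)
    then have "cnt i s mod d = cnt i t mod d"
      using satisfiesD[OF sat, of v] ev[of s] ev[of t] by auto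
    then show "d dvd cnt i s - cnt i t" by (simp add: mod_eq_dvd_iff)
  qed
next
  assume dvd: "\<forall>i. d dvd cnt i s - cnt i t"
  show "satisfies (Zmod d) s t"
    unfolding satisfies_def
  proof (intro allI impI)
    fix v :: "nat \<Rightarrow> int" assume "\<forall>i. v i \<in> carrier (Zmod d)"
    then have v: "v i mod d = v i" for i by (simp add: Zmod_def)
    let ?I = "vars s \<union> vars t"
    have "(\<Sum>i\<in>?I. cnt i s * v i) - (\<Sum>i\<in>?I. cnt i t * v i) = (\<Sum>i\<in>?I. (cnt i s - cnt i t) * v i)"
      by (simp add: sum_subtractf left_diff_distrib)
    also have "d dvd \<dots>" using dvd by (intro dvd_sum dvd_mult2) simp
    finally show "eval_uterm (Zmod d) v s = eval_uterm (Zmod d) v t"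
      using eval_Zmod[OF v, of ?I] by (simp add: mod_eq_dvd_iff)
  qed
qed

text \<open>
  By \<open>cnt_exponents\<close> the two sides of an identity of \<open>V\<close> have the same exponents modulo \<open>d\<close>.
\<close>

lemma Zmod_in_variety:
  fixes V :: "'a unary_semigroup set" and h :: "int \<Rightarrow> 'a"
  assumes h: "inj h" and V: "epigroup_variety V" and d: "exponents V \<subseteq> {k. d dvd k}"
  shows "copy h (Zmod d) \<in> V"
proof (rule in_varietyI)
  show "variety V" using V by (simp add: epigroup_variety_def)
  show "algebra (copy h (Zmod d))" using h algebra_Zmod algebra_copy by blast
next
  fix s t assume "(s, t) \<in> identities V"
  then have "cnt i s - cnt i t \<in> exponents V" for i
    using cnt_exponents[of V] V by (simp add: epigroup_variety_def)
  then show "satisfies (copy h (Zmod d)) s t"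
    using d h by (auto simp: satisfies_copy satisfies_Zmod)
qed

section \<open>Identities of abelian groups\<close>

text \<open>
  In an abelian group the value of a term is the product of the powers of the values of its variables,
  with the exponents given by \<open>cnt\<close>.
\<close>

lemma satisfies_group_like:
  fixes A :: "'a unary_semigroup"
  assumes A: "epigroup A" and cs: "clifford_squares A" and gl: "group_like A"
    and cnt: "\<And>i. cnt i s - cnt i t \<in> exponents {A}"
  shows "satisfies A s t"
proof -
  interpret epi A using A by (simp add: epigroup_iff)
  obtain e where "comm_group (as_monoid A (carrier A) e)"
    using group_like_comm_group[OF A cs gl] by blast
  define G where "G = as_monoid A (carrier A) e"
  interpret G: comm_group G unfolding G_def by fact
  have G: "carrier G = carrier A" "mult G = mul A" "one G = e" by (simp_all add: G_def as_monoid_def)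
  have om: "om x = e" if "x \<in> carrier A" for x
    using G.l_cancel_one[of "om x" "om x"] that om_idem[OF that] by (simp add: G)
  have units: "units e = carrier A"
  proof
    show "carrier A \<subseteq> units e"
    proof
      fix x assume x: "x \<in> carrier A"
      show "x \<in> units e"
        using unit_om[OF x] x G.r_one[of x] by (simp add: om G)
    qed
  qed (auto simp: units_def)
  have e: "e \<in> carrier A" "mul A e e = e" using G.one_closed G.l_one[of e] by (auto simp: G)
  have G': "as_monoid A (units e) e = G" by (simp add: G_def units)
  have pinv: "pinv A x = inv\<^bsub>G\<^esub> x" if "x \<in> carrier A" for x
    using unit_group(2)[OF e, of x] that by (simp add: G_def units)
  have exp: "x [^]\<^bsub>G\<^esub> (cnt i s) = x [^]\<^bsub>G\<^esub> (cnt i t)" if x: "x \<in> carrier A" for x i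
  proof -
    have 1: "x [^]\<^bsub>G\<^esub> (cnt i s - cnt i t) = \<one>\<^bsub>G\<^esub>"
    proof -
      have "\<forall>x\<in>carrier A. mul A x e [^]\<^bsub>G\<^esub> (cnt i s - cnt i t) = e"
        using cnt[of i] exponents_iff[of "{A}"] A by (simp add: om G')
      from bspec[OF this x] show ?thesis using x G.r_one[of x] by (simp add: G)
    qed
    have xG: "x \<in> carrier G" using x by (simp add: G)
    have "x [^]\<^bsub>G\<^esub> (cnt i t + (cnt i s - cnt i t)) = x [^]\<^bsub>G\<^esub> cnt i t"
      unfolding G.int_pow_mult[OF xG] 1 by (rule G.r_one[OF G.int_pow_closed[OF xG]])
    then show ?thesis by simp
  qed
  have eval: "eval_uterm A v u = finprod G (\<lambda>i. v i [^]\<^bsub>G\<^esub> cnt i u) I"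
    if v: "\<And>i. v i \<in> carrier G" and I: "finite I" "vars u \<subseteq> I" for v u I
    using I(2)
  proof (induction u)
    case (Var j)
    have "finprod G (\<lambda>i. v i [^]\<^bsub>G\<^esub> cnt i (Var j)) I = finprod G (\<lambda>i. if j = i then v i else \<one>\<^bsub>G\<^esub>) I"
      by (rule G.finprod_cong') (use v in auto)
    also have "\<dots> = v j" using Var v I(1) by (intro G.finprod_singleton) auto
    finally show ?case by simp
  next
    case (Mul a b)
    have "finprod G (\<lambda>i. v i [^]\<^bsub>G\<^esub> cnt i (Mul a b)) I =
      finprod G (\<lambda>i. v i [^]\<^bsub>G\<^esub> cnt i a \<otimes>\<^bsub>G\<^esub> v i [^]\<^bsub>G\<^esub> cnt i b) I"
      by (rule G.finprod_cong') (use v G.int_pow_mult in auto)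
    also have "\<dots> = finprod G (\<lambda>i. v i [^]\<^bsub>G\<^esub> cnt i a) I \<otimes>\<^bsub>G\<^esub> finprod G (\<lambda>i. v i [^]\<^bsub>G\<^esub> cnt i b) I"
      by (rule G.finprod_multf) (use v in auto)
    finally show ?case using Mul by (simp add: G)
  next
    case (Inv a)
    have c: "(\<lambda>i. v i [^]\<^bsub>G\<^esub> k i) \<in> I \<rightarrow> carrier G" for k :: "nat \<Rightarrow> int"
      using v by auto
    have "finprod G (\<lambda>i. v i [^]\<^bsub>G\<^esub> cnt i (Inv a)) I \<otimes>\<^bsub>G\<^esub> finprod G (\<lambda>i. v i [^]\<^bsub>G\<^esub> cnt i a) I =
      finprod G (\<lambda>i. v i [^]\<^bsub>G\<^esub> cnt i (Inv a) \<otimes>\<^bsub>G\<^esub> v i [^]\<^bsub>G\<^esub> cnt i a) I"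
      using G.finprod_multf[OF c c] by simp
    also have "\<dots> = finprod G (\<lambda>i. \<one>\<^bsub>G\<^esub>) I"
      by (rule G.finprod_cong') (use v in \<open>auto simp: G.int_pow_neg\<close>)
    also have "\<dots> = \<one>\<^bsub>G\<^esub>" by simp
    finally have "inv\<^bsub>G\<^esub> (finprod G (\<lambda>i. v i [^]\<^bsub>G\<^esub> cnt i a) I) = finprod G (\<lambda>i. v i [^]\<^bsub>G\<^esub> cnt i (Inv a)) I"
      by (rule G.inv_equality[OF _ G.finprod_closed[OF c] G.finprod_closed[OF c]])
    moreover have "eval_uterm A v a \<in> carrier A" using eval_closed[OF algebra] v by (simp add: G)
    ultimately show ?case using Inv pinv by simp
  qed
  have "eval_uterm A v s = eval_uterm A v t" if v: "\<And>i. v i \<in> carrier A" for v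
  proof -
    have vG: "v i \<in> carrier G" for i using v by (simp add: G)
    have "finprod G (\<lambda>i. v i [^]\<^bsub>G\<^esub> cnt i s) (vars s \<union> vars t) =
        finprod G (\<lambda>i. v i [^]\<^bsub>G\<^esub> cnt i t) (vars s \<union> vars t)"
      using exp v by simp
    then show ?thesis using eval[of v "vars s \<union> vars t" s] eval[of v "vars s \<union> vars t" t] vG by simp
  qed
  then show ?thesis by (simp add: satisfies_def)
qed

section \<open>Codistributivity of varieties with Clifford squares\<close>

text \<open>
  A variety that does not contain \<open>SL\<close> has an identity whose two sides do not contain the same
  variables. Renaming variables produces a term in two variables that contains the second one but
  does not depend on it.
\<close>

lemma SL_join_prime:
  fixes Y Z :: "'a unary_semigroup set"
  assumes inf: "infinite (UNIV :: 'a set)" and Y: "epigroup_variety Y" and Z: "epigroup_variety Z"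
    and SL: "(SL :: 'a unary_semigroup set) \<subseteq> models (identities Y \<inter> identities Z)"
  shows "SL \<subseteq> Y \<or> SL \<subseteq> Z"
proof (rule ccontr)
  assume not: "\<not> (SL \<subseteq> Y \<or> SL \<subseteq> Z)"
  have ex: "\<exists>p. 1 \<in> vars p \<and> vars p \<subseteq> {0, 1} \<and> (p, subst (\<lambda>_. Var 0) p) \<in> identities X"
    if X: "epigroup_variety X" "\<not> SL \<subseteq> X" for X :: "'a unary_semigroup set"
  proof -
    obtain a b i where ab: "(a, b) \<in> identities X" "i \<in> vars a" "i \<notin> vars b"
      using not_SL_subset[OF X] by blast
    define p where "p = subst (\<lambda>j. if j = i then Var 1 else Var 0) a"
    have "satisfies A p (subst (\<lambda>_. Var 0) p)" if A: "A \<in> X" for A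
      unfolding satisfies_def
    proof (intro allI impI)
      fix v :: "nat \<Rightarrow> 'a" assume v: "\<forall>i. v i \<in> carrier A"
      have sat: "satisfies A a b" using ab(1) A by (auto simp: identities_def)
      have "eval_uterm A v p = eval_uterm A (\<lambda>j. if j = i then v 1 else v 0) a"
        by (simp add: p_def eval_subst if_distrib[of "eval_uterm A v"] cong: if_cong)
      also have "\<dots> = eval_uterm A (\<lambda>j. if j = i then v 1 else v 0) b"
        using v by (intro satisfiesD[OF sat]) simp
      also have "\<dots> = eval_uterm A (\<lambda>_. v 0) b"
        using ab(3) by (intro eval_cong) auto
      also have "\<dots> = eval_uterm A (\<lambda>_. v 0) a"
        using v by (intro satisfiesD[OF sat, symmetric]) simp
      also have "\<dots> = eval_uterm A v (subst (\<lambda>_. Var 0) p)"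
        by (simp add: p_def eval_subst if_distrib[of "eval_uterm A _"] cong: if_cong)
      finally show "eval_uterm A v p = eval_uterm A v (subst (\<lambda>_. Var 0) p)" .
    qed
    moreover have "1 \<in> vars p" "vars p \<subseteq> {0, 1}"
      using ab(2) by (auto simp: p_def vars_subst split: if_splits)
    ultimately show ?thesis by (auto simp: identities_def)
  qed
  obtain p where p: "1 \<in> vars p" "vars p \<subseteq> {0, 1}" "(p, subst (\<lambda>_. Var 0) p) \<in> identities Y"
    using ex Y not by blast
  obtain q where q: "1 \<in> vars q" "vars q \<subseteq> {0, 1}" "(q, subst (\<lambda>_. Var 0) q) \<in> identities Z"
    using ex Z not by blast
  \<comment> \<open>Nesting makes one term that ignores its second variable in both varieties.\<close>
  define r where "r = subst (\<lambda>j. if j = 1 then q else Var 0) p"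
  define r' where "r' = subst (\<lambda>_. Var 0) r"
  have r: "eval_uterm A v r = eval_uterm A (\<lambda>j. if j = 1 then eval_uterm A v q else v 0) p"
    and r': "eval_uterm A v r' = eval_uterm A (\<lambda>j. if j = 1 then eval_uterm A (\<lambda>_. v 0) q else v 0) p"
    for A :: "'a unary_semigroup" and v
    by (simp_all add: r_def r'_def eval_subst if_distrib[of "eval_uterm A _"] cong: if_cong)
  have "satisfies A r r'" if A: "A \<in> Y" for A
    unfolding satisfies_def
  proof (intro allI impI)
    fix v :: "nat \<Rightarrow> 'a" assume v: "\<forall>i. v i \<in> carrier A"
    have alg: "algebra A" using identities_algebra A Y by (auto simp: epigroup_variety_def)
    have sat: "satisfies A p (subst (\<lambda>_. Var 0) p)" using p A by (auto simp: identities_def)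
    have ignore: "eval_uterm A (\<lambda>j. if j = 1 then x else v 0) p = eval_uterm A (\<lambda>_. v 0) p"
      if "x \<in> carrier A" for x
      using satisfiesD[OF sat, of "\<lambda>j. if j = 1 then x else v 0"] v that by (simp add: eval_subst)
    have "eval_uterm A v q \<in> carrier A" "eval_uterm A (\<lambda>_. v 0) q \<in> carrier A"
      using v eval_closed[OF alg] by simp_all
    then show "eval_uterm A v r = eval_uterm A v r'"
      unfolding r r' by (simp only: ignore)
  qed
  moreover have "satisfies A r r'" if A: "A \<in> Z" for A
    unfolding satisfies_def
  proof (intro allI impI)
    fix v :: "nat \<Rightarrow> 'a" assume v: "\<forall>i. v i \<in> carrier A"
    have sat: "satisfies A q (subst (\<lambda>_. Var 0) q)" using q A by (auto simp: identities_def)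
    have "eval_uterm A v q = eval_uterm A (\<lambda>_. v 0) q"
      using satisfiesD[OF sat, of v] v by (simp add: eval_subst)
    then show "eval_uterm A v r = eval_uterm A v r'" unfolding r r' by (simp only:)
  qed
  ultimately have "(r, r') \<in> identities Y \<inter> identities Z" by (auto simp: identities_def)
  then have "(r, r') \<in> identities (SL :: 'a unary_semigroup set)"
    by (rule subsetD[OF identities_antimono[OF SL] subsetD[OF identities_models_subset]])
  then have "vars r = vars r'" using identities_SL[OF inf] by blast
  moreover have "1 \<in> vars r" using p q by (auto simp: r_def vars_subst)
  moreover have "vars r' \<subseteq> {0}" by (auto simp: r'_def vars_subst)
  ultimately show False by auto
qed

text \<open>
  If neither variety contains \<open>ZM\<close>, then \<open>xx\<^sup>\<omega> = x\<close> holds in both.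
\<close>

lemma ZM_join_prime:
  fixes Y Z :: "'a unary_semigroup set"
  assumes inf: "infinite (UNIV :: 'a set)" and Y: "epigroup_variety Y" and Z: "epigroup_variety Z"
    and ZM: "(ZM :: 'a unary_semigroup set) \<subseteq> models (identities Y \<inter> identities Z)"
  shows "ZM \<subseteq> Y \<or> ZM \<subseteq> Z"
proof (rule ccontr)
  assume "\<not> (ZM \<subseteq> Y \<or> ZM \<subseteq> Z)"
  then have "(Mul (Var 0) (omt (Var 0)), Var 0) \<in> identities Y \<inter> identities Z"
    using not_ZM_subset[OF Y] not_ZM_subset[OF Z] by blast
  then have "(Mul (Var 0) (omt (Var 0)), Var 0) \<in> identities (ZM :: 'a unary_semigroup set)"
    by (rule subsetD[OF identities_antimono[OF ZM] subsetD[OF identities_models_subset]])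
  then show False using identities_ZM[OF inf] by fastforce
qed

text \<open>
  Distributivity of the lattice of subgroups of the integers: an element of \<open>aZ + bZ\<close> and of
  \<open>aZ + cZ\<close> lies in \<open>aZ + (bZ \<inter> cZ)\<close>.
\<close>

lemma dvd_of_gcds:
  fixes a b c d m :: int
  assumes b: "gcd a b dvd m" and c: "gcd a c dvd m"
    and d: "d dvd a" "\<And>k. b dvd k \<Longrightarrow> c dvd k \<Longrightarrow> d dvd k"
  shows "d dvd m"
proof (cases "b = 0")
  case True
  then show ?thesis using b d(1) by (simp add: dvd_trans)
next
  case False
  define g where "g = gcd b c"
  obtain b' c' where bc: "b = g * b'" "c = g * c'" unfolding g_def by (meson dvd_def gcd_dvd1 gcd_dvd2)
  obtain u w where "u * b + w * c = g" unfolding g_def using bezout_int by blast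
  then have "g * (u * b' + w * c') = g * 1" by (simp add: bc algebra_simps)
  then have uw: "u * b' + w * c' = 1" using False bc by simp
  obtain x y where xy: "m = a * x + b * y"
    using b bezout_int[of a b] by (metis dvd_def distrib_right mult.assoc mult.commute)
  obtain z t where zt: "m = a * z + c * t"
    using c bezout_int[of a c] by (metis dvd_def distrib_right mult.assoc mult.commute)
  \<comment> \<open>Modulo \<open>a\<close> the summands are multiples of \<open>b'c\<close> and \<open>c'b\<close>; both are the common multiple \<open>g * b' * c'\<close>.\<close>
  have "m = u * b' * m + w * c' * m" using uw by (metis distrib_right mult_1)
  also have "\<dots> = a * (u * b' * z + w * c' * x) + (u * t + w * y) * (g * b' * c')"
    by (subst (1) zt, subst (1) xy) (simp add: bc algebra_simps)
  also have "d dvd \<dots>"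
    using d(1) d(2)[of "g * b' * c'"] bc by (intro dvd_add) auto
  finally show ?thesis .
qed

text \<open>
  The cyclic group of order \<open>gcd a b\<close> belongs to both \<open>V\<close> and \<open>Y\<close>.
\<close>

lemma cnt_of_meet:
  fixes V Y :: "'a unary_semigroup set"
  assumes inf: "infinite (UNIV :: 'a set)" and V: "epigroup_variety V" and Y: "epigroup_variety Y"
    and a: "exponents V = {k. a dvd k}" and b: "exponents Y = {k. b dvd k}"
    and st: "(s, t) \<in> identities (V \<inter> Y)"
  shows "gcd a b dvd cnt i s - cnt i t"
proof -
  obtain h :: "int \<Rightarrow> 'a" where h: "inj h" using injection_into_infinite[OF inf] by blast
  have "copy h (Zmod (gcd a b)) \<in> V \<inter> Y"
    using Zmod_in_variety[OF h V, of "gcd a b"] Zmod_in_variety[OF h Y, of "gcd a b"] a b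
    by (auto intro: dvd_trans)
  then have "satisfies (copy h (Zmod (gcd a b))) s t" using st by (auto simp: identities_def)
  then show ?thesis using h by (simp add: satisfies_copy satisfies_Zmod)
qed

text \<open>
  Every subvariety of \<open>V\<close> has Clifford squares, so \<open>identity_from_parts\<close> applies to the meet of \<open>V\<close> with
  the join of \<open>Y\<close> and \<open>Z\<close>. The contributions of \<open>SL\<close> and \<open>ZM\<close> come from join primeness. For an abelian
  group, an exponent difference in an identity of both meets is a multiple of the greatest common
  divisors \<open>gcd a b\<close> and \<open>gcd a c\<close> of the exponents involved, and distributivity applies.
\<close>

theorem clifford_squares_codistributive:
  fixes V :: "'a unary_semigroup set"
  assumes inf: "infinite (UNIV :: 'a set)" and V: "epigroup_variety V"
    and cs: "\<And>A. A \<in> V \<Longrightarrow> clifford_squares A"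
  shows "codistributive EPI V"
  unfolding codistributive_EPI[OF inf V]
proof (intro allI impI subsetI, elim IntE, simp only: split_paired_all)
  fix Y Z :: "'a unary_semigroup set" and s t
  assume Y: "epigroup_variety Y" and Z: "epigroup_variety Z"
    and sY: "(s, t) \<in> identities (V \<inter> Y)" and sZ: "(s, t) \<in> identities (V \<inter> Z)"
  let ?J = "models (identities Y \<inter> identities Z) :: 'a unary_semigroup set"
  have J: "epigroup_variety ?J" using join_EPI(1,2)[OF inf Y Z] by simp
  show "(s, t) \<in> identities (V \<inter> ?J)"
  proof (rule identity_from_parts)
    show "epigroup_variety (V \<inter> ?J)" using epigroup_variety_Int[OF V J] .
    show "clifford_squares A" if "A \<in> V \<inter> ?J" for A using cs that by blast
    show "vars s = vars t" if "SL \<subseteq> V \<inter> ?J"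
    proof -
      have "SL \<subseteq> V \<inter> Y \<or> SL \<subseteq> V \<inter> Z" using SL_join_prime[OF inf Y Z] that by blast
      then have "(s, t) \<in> identities (SL :: 'a unary_semigroup set)"
        using subsetD[OF identities_antimono sY] subsetD[OF identities_antimono sZ] by blast
      then show ?thesis using identities_SL[OF inf] by blast
    qed
    show "s = t \<or> compound s \<and> compound t" if "ZM \<subseteq> V \<inter> ?J"
    proof -
      have "ZM \<subseteq> V \<inter> Y \<or> ZM \<subseteq> V \<inter> Z" using ZM_join_prime[OF inf Y Z] that by blast
      then have "(s, t) \<in> identities (ZM :: 'a unary_semigroup set)"
        using subsetD[OF identities_antimono sY] subsetD[OF identities_antimono sZ] by blast
      then show ?thesis using identities_ZM[OF inf] by blast
    qed
    fix A assume A: "A \<in> V \<inter> ?J" and gl: "group_like A"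
    have epi: "epigroup A" using A V by (simp add: epigroup_variety_def)
    show "satisfies A s t"
    proof (rule satisfies_group_like[OF epi _ gl])
      show "clifford_squares A" using cs A by blast
      fix i
      obtain a where a: "exponents V = {k. a dvd k}"
        using exponents_principal[of V] V by (auto simp: epigroup_variety_def)
      obtain b where b: "exponents Y = {k. b dvd k}"
        using exponents_principal[of Y] Y by (auto simp: epigroup_variety_def)
      obtain c where c: "exponents Z = {k. c dvd k}"
        using exponents_principal[of Z] Z by (auto simp: epigroup_variety_def)
      obtain d where d: "exponents {A} = {k. d dvd k}"
        using exponents_principal[of "{A}"] epi by auto
      have "exponents V \<subseteq> exponents {A}" using A by (auto simp: exponents_def identities_def)
      then have "{k. a dvd k} \<subseteq> {k. d dvd k}" unfolding a d .
      then have "d dvd a" by (simp add: subset_iff)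
      moreover have "exponents Y \<inter> exponents Z \<subseteq> exponents {A}"
        using A by (auto simp: exponents_def models_def) (auto simp: identities_def)
      then have "{k. b dvd k} \<inter> {k. c dvd k} \<subseteq> {k. d dvd k}" unfolding b c d .
      then have "d dvd k" if "b dvd k" "c dvd k" for k using that by (simp add: subset_iff)
      ultimately have "d dvd cnt i s - cnt i t"
        using dvd_of_gcds[OF cnt_of_meet[OF inf V Y a b sY] cnt_of_meet[OF inf V Z a c sZ]] by blast
      then show "cnt i s - cnt i t \<in> exponents {A}" by (simp add: d)
    qed
  qed
qed

section \<open>Strongly permutative epigroups\<close>

lemma eval_linear_word:
  "eval_uterm A v (linear_word \<sigma> n) =
    foldl (\<lambda>x i. mul A x (v (\<sigma> i))) (v (\<sigma> 1)) [2..<Suc n]"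
proof -
  have "eval_uterm A v (foldl (\<lambda>t i. Mul t (Var (\<sigma> i))) t xs) =
      foldl (\<lambda>x i. mul A x (v (\<sigma> i))) (eval_uterm A v t) xs" for t xs
    by (induction xs arbitrary: t) auto
  then show ?thesis by (simp add: linear_word_def)
qed

context sg
begin

lemma foldl_idempotent:
  assumes x: "x \<cdot> e = x" and v: "\<And>i. i \<in> set xs \<Longrightarrow> v i = e"
  shows "foldl (\<lambda>x i. x \<cdot> v i) x xs = x"
  using v by (induction xs) (auto simp: x)

lemma foldl_left:
  assumes "e \<in> C" "x \<in> C" "\<And>i. i \<in> set xs \<Longrightarrow> v i \<in> C"
  shows "e \<cdot> foldl (\<lambda>x i. x \<cdot> v i) x xs = foldl (\<lambda>x i. x \<cdot> v i) (e \<cdot> x) xs"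
  using assms by (induction xs arbitrary: x) (auto simp: assoc)

lemma foldl_closed:
  assumes "x \<in> C" "\<And>i. i \<in> set xs \<Longrightarrow> v i \<in> C"
  shows "foldl (\<lambda>x i. x \<cdot> v i) x xs \<in> C"
  using assms by (induction xs arbitrary: x) auto

lemma foldl_single:
  assumes e: "e \<in> C" and c: "c \<in> C" "c \<cdot> e = c" and x: "x \<in> C" "x \<cdot> e = x"
    and xs: "distinct xs" "k \<in> set xs" and v: "\<And>i. i \<in> set xs \<Longrightarrow> v i = (if i = k then c else e)"
  shows "foldl (\<lambda>x i. x \<cdot> v i) x xs = x \<cdot> c"
  using xs v
proof (induction xs)
  case (Cons i xs)
  show ?case
  proof (cases "i = k")
    case True
    have "foldl (\<lambda>x i. x \<cdot> v i) (x \<cdot> c) xs = x \<cdot> c"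
      using Cons.prems True x c e by (intro foldl_idempotent[of _ e]) (auto simp: assoc)
    then show ?thesis using Cons.prems True by simp
  qed (use Cons x in auto)
qed simp

end

locale central_idempotents = epi +
  assumes central: "e \<in> carrier A \<Longrightarrow> mul A e e = e \<Longrightarrow> x \<in> carrier A \<Longrightarrow> mul A e x = mul A x e"
    and local_commute: "e \<in> carrier A \<Longrightarrow> mul A e e = e \<Longrightarrow> x \<in> carrier A \<Longrightarrow> y \<in> carrier A \<Longrightarrow>
      mul A e (mul A x y) = mul A e (mul A y x)"

text \<open>
  Put \<open>a\<close> for the first variable of the permutation identity and the idempotent \<open>e\<close> for the others:
  the left-hand side becomes \<open>ae\<close>, and the right-hand side begins with \<open>e\<close>, as the first variable has
  moved away. So \<open>ae = eae\<close>, and the last variable gives \<open>ea = eae\<close> in the same way. Within the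
  local submonoid at \<open>e\<close>, putting \<open>a\<close> for the first variable and \<open>b\<close> for the one that replaces it in
  front gives \<open>ab = ba\<close>.
\<close>

lemma (in epi) strongly_permutative_central:
  assumes \<pi>: "\<pi> permutes {1..n}" "\<pi> 1 \<noteq> 1" "\<pi> n \<noteq> n"
    and sat: "satisfies A (linear_word id n) (linear_word \<pi> n)"
  shows "central_idempotents A"
proof -
  have "1 \<in> {1..n}" using \<pi>(1,2) permutes_not_in by fastforce
  then have j: "\<pi> 1 \<in> {1..n}" using permutes_in_image[OF \<pi>(1)] by simp
  then have n: "n \<ge> 2" using \<pi>(2) by auto
  have eq: "foldl (\<lambda>x i. x \<cdot> v i) (v 1) [2..<Suc n] =
      foldl (\<lambda>x i. x \<cdot> v (\<pi> i)) (v (\<pi> 1)) [2..<Suc n]" if "\<And>i. v i \<in> C" for v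
    using satisfiesD[OF sat, of v] that by (simp add: eval_linear_word del: upt_Suc)
  have split: "[2..<Suc n] = [2..<n] @ [n]" using n by simp
  have commute: "e \<cdot> a = a \<cdot> e" if e: "e \<in> C" "e \<cdot> e = e" and a: "a \<in> C" for e a
  proof -
    define v where "v i = (if i = 1 then a else e)" for i :: nat
    have v: "v i \<in> C" for i using e a by (simp add: v_def)
    have "foldl (\<lambda>x i. x \<cdot> v i) (a \<cdot> e) [3..<Suc n] = a \<cdot> e"
      using e a by (intro foldl_idempotent[of _ e]) (auto simp: v_def assoc)
    moreover have "[2..<Suc n] = 2 # [3..<Suc n]" using n upt_conv_Cons[of 2 "Suc n"] by simp
    ultimately have L: "foldl (\<lambda>x i. x \<cdot> v i) (v 1) [2..<Suc n] = a \<cdot> e"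
      by (simp add: v_def)
    have "v (\<pi> 1) = e" using \<pi>(2) by (simp add: v_def)
    then have "e \<cdot> foldl (\<lambda>x i. x \<cdot> v (\<pi> i)) (v (\<pi> 1)) [2..<Suc n] =
        foldl (\<lambda>x i. x \<cdot> v (\<pi> i)) (v (\<pi> 1)) [2..<Suc n]"
      using foldl_left[of e "v (\<pi> 1)" "[2..<Suc n]" "\<lambda>i. v (\<pi> i)"] e v by simp
    then have 1: "e \<cdot> (a \<cdot> e) = a \<cdot> e" using eq[of v, OF v] L by simp
    define w where "w i = (if i = n then a else e)" for i :: nat
    have w: "w i \<in> C" for i using e a by (simp add: w_def)
    have "foldl (\<lambda>x i. x \<cdot> w i) e [2..<n] = e"
      using e by (intro foldl_idempotent[of _ e]) (auto simp: w_def)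
    then have L: "foldl (\<lambda>x i. x \<cdot> w i) (w 1) [2..<Suc n] = e \<cdot> a"
      using n unfolding split by (simp add: w_def)
    define z where "z = foldl (\<lambda>x i. x \<cdot> w (\<pi> i)) (w (\<pi> 1)) [2..<n]"
    have z: "z \<in> C" unfolding z_def using w by (intro foldl_closed) auto
    have "foldl (\<lambda>x i. x \<cdot> w (\<pi> i)) (w (\<pi> 1)) [2..<Suc n] = z \<cdot> e"
      unfolding split using \<pi>(3) by (simp add: z_def) (simp add: w_def)
    then have "e \<cdot> a = z \<cdot> e" using eq[of w, OF w] L by simp
    then have "e \<cdot> a \<cdot> e = e \<cdot> a" using z e by (simp add: assoc)
    then show ?thesis using 1 e a by (simp add: assoc)
  qed
  have swap: "a \<cdot> b = b \<cdot> a"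
    if e: "e \<in> C" "e \<cdot> e = e" and a: "a \<in> C" "a \<cdot> e = a" and b: "b \<in> C" "b \<cdot> e = b" for e a b
  proof -
    define v where "v i = (if i = 1 then a else if i = \<pi> 1 then b else e)" for i
    have v: "v i \<in> C" for i using e a b by (simp add: v_def)
    have L: "foldl (\<lambda>x i. x \<cdot> v i) (v 1) [2..<Suc n] = v 1 \<cdot> b"
      using e a b j \<pi>(2) by (intro foldl_single[of e b _ _ "\<pi> 1"]) (auto simp: v_def)
    obtain k where k: "k \<in> {1..n}" "\<pi> k = 1"
      using \<open>1 \<in> {1..n}\<close> permutes_image[OF \<pi>(1)] by (metis imageE)
    have inj: "\<pi> i = \<pi> l \<longleftrightarrow> i = l" for i l using permutes_inj[OF \<pi>(1)] by (simp add: inj_eq)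
    have "k \<noteq> 1" using k \<pi>(2) by auto
    then have k2: "k \<in> set [2..<Suc n]" using k(1) by auto
    have v\<pi>: "v (\<pi> i) = (if i = k then a else e)" if "i \<noteq> 1" for i
      using inj[of i 1] inj[of i k] k(2) that by (simp add: v_def)
    have "v (\<pi> 1) = b" using \<pi>(2) by (simp add: v_def)
    then have "foldl (\<lambda>x i. x \<cdot> v (\<pi> i)) (v (\<pi> 1)) [2..<Suc n] = v (\<pi> 1) \<cdot> a"
      using e(1) a b k2 v\<pi> by (intro foldl_single[of e a _ _ k]) (simp_all del: upt_Suc)
    then show ?thesis using L eq[of v, OF v] \<pi>(2) by (simp add: v_def)
  qed
  show ?thesis
  proof
    fix e x y assume e: "e \<in> C" "e \<cdot> e = e" and x: "x \<in> C" and y: "y \<in> C"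
    have ex: "e \<cdot> z \<cdot> e = e \<cdot> z" if "z \<in> C" for z
      using e that commute[OF e that] by (simp add: assoc)
    have "e \<cdot> x \<cdot> (e \<cdot> y) = e \<cdot> y \<cdot> (e \<cdot> x)"
      using swap[OF e, of "e \<cdot> x" "e \<cdot> y"] ex x y e by simp
    moreover have "e \<cdot> z \<cdot> (e \<cdot> u) = e \<cdot> (z \<cdot> u)" if "z \<in> C" "u \<in> C" for z u
      using ex[OF that(1)] that e assoc[of "e \<cdot> z" e u] by (simp add: assoc[of e z u])
    ultimately show "e \<cdot> (x \<cdot> y) = e \<cdot> (y \<cdot> x)" using x y by simp
  qed (use commute in blast)
qed

text \<open>
  The variables below an inverse. A term absorbs \<open>om\<close> of their values, and terms without such
  variables are words.
\<close>

primrec invvars :: "uterm \<Rightarrow> nat set" where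
  "invvars (Var i) = {}"
| "invvars (Mul s t) = invvars s \<union> invvars t"
| "invvars (Inv t) = vars t"

lemma (in sg) leading_letter:
  assumes "invvars t = {}" "compound t"
  shows "\<exists>i c. invvars c = {} \<and> (t = Mul (Var i) c \<or> compound c) \<and>
    (\<forall>v. (\<forall>i. v i \<in> C) \<longrightarrow> eval_uterm A v t = v i \<cdot> eval_uterm A v c)"
  using assms
proof (induction t)
  case (Mul a b)
  show ?case
  proof (cases "compound a")
    case True
    then obtain i c where c: "invvars c = {}"
      "\<And>v. \<forall>i. v i \<in> C \<Longrightarrow> eval_uterm A v a = v i \<cdot> eval_uterm A v c" using Mul by auto
    then have "eval_uterm A v (Mul a b) = v i \<cdot> eval_uterm A v (Mul c b)" if "\<forall>i. v i \<in> C" for v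
      using that eval_closed[OF algebra] by (simp add: assoc)
    then show ?thesis using c(1) Mul.prems by (intro exI[of _ i] exI[of _ "Mul c b"]) auto
  next
    case False
    then obtain i where "a = Var i" by (auto simp: compound_def)
    then show ?thesis using Mul.prems by (intro exI[of _ i] exI[of _ b]) simp
  qed
qed (use vars_nonempty in auto)

lemma (in sg) two_leading_letters:
  assumes t: "invvars t = {}" "compound t" and not: "\<And>i j. t \<noteq> Mul (Var i) (Var j)"
  shows "\<exists>i j c. \<forall>v. (\<forall>i. v i \<in> C) \<longrightarrow> eval_uterm A v t = v i \<cdot> v j \<cdot> eval_uterm A v c"
proof -
  obtain i c where c: "invvars c = {}" "t = Mul (Var i) c \<or> compound c"
    "\<And>v. \<forall>i. v i \<in> C \<Longrightarrow> eval_uterm A v t = v i \<cdot> eval_uterm A v c"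
    using leading_letter[OF t] by blast
  have "compound c" using c(2) not by (auto simp: compound_def)
  then obtain j d where d: "\<And>v. \<forall>i. v i \<in> C \<Longrightarrow> eval_uterm A v c = v j \<cdot> eval_uterm A v d"
    using leading_letter[OF c(1)] by blast
  have "eval_uterm A v t = v i \<cdot> v j \<cdot> eval_uterm A v d" if "\<forall>i. v i \<in> C" for v
    using c(3)[OF that] d[OF that] that eval_closed[OF algebra, of v d] by (simp add: assoc)
  then show ?thesis by blast
qed

context central_idempotents
begin

lemma om_central: "x \<in> C \<Longrightarrow> y \<in> C \<Longrightarrow> om x \<cdot> y = y \<cdot> om x"
  using central om_idem by blast

lemma om_swap: "x \<in> C \<Longrightarrow> y \<in> C \<Longrightarrow> z \<in> C \<Longrightarrow> om x \<cdot> (y \<cdot> z) = om x \<cdot> (z \<cdot> y)"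
  using local_commute om_idem by blast

text \<open>
  Since \<open>om p\<close> is central and \<open>p\<close>, \<open>q\<close> may be interchanged next to it, \<open>pq\<close> is also of the form \<open>qr\<close>,
  and therefore absorbs \<open>om q\<close> as well; then \<open>pq\<close> and \<open>qp\<close> absorb the same idempotent and agree.
\<close>

lemma clifford_if_left:
  assumes left: "\<And>p q. p \<in> C \<Longrightarrow> q \<in> C \<Longrightarrow> om p \<cdot> (p \<cdot> q) = p \<cdot> q"
  shows "clifford_squares A"
proof -
  have right: "om q \<cdot> (p \<cdot> q) = p \<cdot> q" if "p \<in> C" "q \<in> C" for p q
  proof -
    have "p \<cdot> q = om p \<cdot> (q \<cdot> p)" using left om_swap that by metis
    also have "\<dots> = q \<cdot> (p \<cdot> om p)" using om_central[of p "q \<cdot> p"] that by (simp add: assoc)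
    finally have "p \<cdot> q = q \<cdot> (p \<cdot> om p)" .
    then show ?thesis using left[of q "p \<cdot> om p"] that by simp
  qed
  have "p \<cdot> q = q \<cdot> p" if "p \<in> C" "q \<in> C" for p q
    by (rule left[OF that, symmetric, THEN trans,
          OF om_swap[OF that(1) that, THEN trans, OF right[OF that(2,1)]]])
  then have "clifford A" using left by unfold_locales
  then show ?thesis by (simp add: clifford_squares_iff)
qed

lemma clifford_if_right:
  assumes right: "\<And>p q. p \<in> C \<Longrightarrow> q \<in> C \<Longrightarrow> om q \<cdot> (p \<cdot> q) = p \<cdot> q"
  shows "clifford_squares A"
proof (rule clifford_if_left)
  fix p q assume pq: "p \<in> C" "q \<in> C"
  have "p \<cdot> q = om q \<cdot> (q \<cdot> p)" using right om_swap pq by metis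
  also have "\<dots> = om q \<cdot> q \<cdot> p" using pq by (simp add: assoc)
  finally have "p \<cdot> q = om q \<cdot> q \<cdot> p" .
  then show "om p \<cdot> (p \<cdot> q) = p \<cdot> q" using right[of "om q \<cdot> q" p] pq by simp
qed

text \<open>
  In the commutative local submonoid at \<open>om (a \<cdot> b)\<close>, both \<open>a\<close> and \<open>b\<close> divide the unit.
\<close>

lemma om_product:
  assumes a: "a \<in> C" and b: "b \<in> C"
  shows "om (a \<cdot> b) \<cdot> om a = om (a \<cdot> b)" "om (a \<cdot> b) \<cdot> om b = om (a \<cdot> b)"
proof -
  let ?e = "om (a \<cdot> b)" and ?d = "pinv A (a \<cdot> b)"
  have ee: "?e \<cdot> ?e = ?e" using om_idem a b by simp
  have "?e \<cdot> (b \<cdot> ?d) \<cdot> a = ?e \<cdot> (a \<cdot> (b \<cdot> ?d))"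
    using om_swap[of "a \<cdot> b" a "b \<cdot> ?d"] a b by (simp add: assoc)
  also have "\<dots> = ?e" using ee a b by (simp add: om_def assoc)
  finally have 1: "?e \<cdot> (b \<cdot> ?d) \<cdot> a = ?e" .
  have "?e \<cdot> (?d \<cdot> a) \<cdot> b = ?e \<cdot> (?d \<cdot> (a \<cdot> b))" using a b by (simp add: assoc)
  then have 2: "?e \<cdot> (?d \<cdot> a) \<cdot> b = ?e"
    using ee pinv_commute[of "a \<cdot> b"] a b by (simp add: om_def)
  have "?e \<cdot> z \<cdot> ?e = ?e \<cdot> z" if "z \<in> C" for z
    using om_central[of "a \<cdot> b" "?e \<cdot> z"] ee a b that by (simp flip: assoc)
  then show "?e \<cdot> om a = ?e" "?e \<cdot> om b = ?e"
    using absorb_om[OF _ _ _ 1] absorb_om[OF _ _ _ 2] a b by simp_all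
qed

lemma om_eval:
  assumes v: "\<forall>i. v i \<in> C" and i: "i \<in> vars t"
  shows "om (eval_uterm A v t) \<cdot> om (v i) = om (eval_uterm A v t)"
  using i
proof (induction t)
  case (Var j)
  then show ?case using v om_idem by simp
next
  case (Mul a b)
  let ?a = "eval_uterm A v a" and ?b = "eval_uterm A v b"
  have ab: "?a \<in> C" "?b \<in> C" using v eval_closed[OF algebra] by auto
  from Mul.prems have "i \<in> vars a \<or> i \<in> vars b" by simp
  then show ?case
  proof
    assume "i \<in> vars a"
    then have "om ?a \<cdot> om (v i) = om ?a" using Mul by simp
    then show ?thesis using om_product(1)[OF ab] ab v assoc[of "om (?a \<cdot> ?b)" "om ?a" "om (v i)"] by simp
  next
    assume "i \<in> vars b"
    then have "om ?b \<cdot> om (v i) = om ?b" using Mul by simp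
    then show ?thesis using om_product(2)[OF ab] ab v assoc[of "om (?a \<cdot> ?b)" "om ?b" "om (v i)"] by simp
  qed
next
  case (Inv a)
  then show ?case using v eval_closed[OF algebra] om_pinv_eq by simp
qed

lemma om_invvars:
  assumes v: "\<forall>i. v i \<in> C" and i: "i \<in> invvars t"
  shows "om (v i) \<cdot> eval_uterm A v t = eval_uterm A v t"
  using i
proof (induction t)
  case (Mul a b)
  let ?a = "eval_uterm A v a" and ?b = "eval_uterm A v b"
  have ab: "?a \<in> C" "?b \<in> C" using v eval_closed[OF algebra] by auto
  from Mul.prems have "i \<in> invvars a \<or> i \<in> invvars b" by simp
  then show ?case
  proof
    assume "i \<in> invvars a"
    then show ?thesis using Mul ab v assoc[of "om (v i)" ?a ?b] by simp
  next
    assume "i \<in> invvars b"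
    then have "om (v i) \<cdot> ?b = ?b" using Mul by simp
    then have "?a \<cdot> om (v i) \<cdot> ?b = ?a \<cdot> ?b" using ab v by (simp add: assoc)
    then show ?thesis using ab v om_central[of "v i" ?a] assoc[of "om (v i)" ?a ?b] by simp
  qed
next
  case (Inv a)
  let ?a = "eval_uterm A v a"
  have a: "?a \<in> C" using v eval_closed[OF algebra] by auto
  have "om ?a \<cdot> om (v i) = om ?a" using om_eval[OF v] Inv by simp
  then have "om (v i) \<cdot> om ?a = om ?a" using om_central[of "v i" "om ?a"] a v by simp
  then have "om (v i) \<cdot> (om ?a \<cdot> pinv A ?a) = om ?a \<cdot> pinv A ?a" using a v by (simp flip: assoc)
  then show ?case using om_pinv[OF a] by simp
qed simp

lemma right_factor_absorbs:
  assumes z: "z \<in> C" "z \<cdot> eval_uterm A v c = z" and v: "\<forall>i. v i \<in> C" and i: "i \<in> vars c"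
  shows "om (v i) \<cdot> z = z"
proof -
  have c: "eval_uterm A v c \<in> C" using v eval_closed[OF algebra] by auto
  have "z \<cdot> om (eval_uterm A v c) = z" using right_unit_om z c by blast
  then have "z \<cdot> om (v i) = z"
    using om_eval[OF v i] z(1) c v assoc[of z "om (eval_uterm A v c)" "om (v i)"] by simp
  then show ?thesis using om_central[of "v i" z] z v by simp
qed

text \<open>
  Set \<open>y\<close> to \<open>q\<close> and all other variables to \<open>p\<close>; then the first two letters of the word \<open>t\<close> decide. If
  they are \<open>pq\<close>, then the value of the rest \<open>c\<close> is a right unit of \<open>pq\<close>, which thus absorbs \<open>om\<close> of the
  value of any variable \<open>m\<close> of \<open>c\<close>.
  If they are \<open>pp\<close> or \<open>qq\<close>, the same argument with \<open>p = q\<close> shows that the square of this letter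
  absorbs its \<open>om\<close>. If they are \<open>qp\<close>, applying the identity twice leads back to the prefix \<open>pq\<close>. The
  choice of \<open>m\<close> is independent of \<open>p\<close> and \<open>q\<close>, so that it is always the left factor or always the right
  factor whose \<open>om\<close> is absorbed.
\<close>

lemma clifford_of_long_word:
  assumes sat: "satisfies A (Mul (Var x) (Var y)) t" and xy: "x \<noteq> y"
    and t: "\<And>v. \<forall>i. v i \<in> C \<Longrightarrow> eval_uterm A v t = v i \<cdot> v j \<cdot> eval_uterm A v c"
  shows "clifford_squares A"
proof -
  define v where "v p q k = (if k = y then q else p)" for p q :: 'a and k
  define w where "w p q = eval_uterm A (v p q) c" for p q
  have v: "\<forall>k. v p q k \<in> C" if "p \<in> C" "q \<in> C" for p q using that by (simp add: v_def)
  have wC: "w p q \<in> C" if "p \<in> C" "q \<in> C" for p q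
    unfolding w_def using eval_closed[OF algebra] v[OF that] by blast
  have eq: "p \<cdot> q = v p q i \<cdot> v p q j \<cdot> w p q" if "p \<in> C" "q \<in> C" for p q
    using satisfiesD[OF sat, of "v p q"] t[OF v[OF that]] v[OF that] xy
    by (simp add: w_def) (simp add: v_def)
  obtain m where m: "m \<in> vars c" using vars_nonempty by blast
  have absorb: "om (v p q m) \<cdot> z = z" if "p \<in> C" "q \<in> C" "z \<in> C" "z \<cdot> w p q = z" for p q z
    using right_factor_absorbs[OF that(3) _ v[OF that(1,2)] m] that(4) by (simp add: w_def)
  have square: "om p \<cdot> (p \<cdot> p) = p \<cdot> p" if p: "p \<in> C" for p
  proof -
    have vp: "v p p k = p" for k by (simp add: v_def)
    show ?thesis using absorb[OF p p _ eq[OF p p, unfolded vp, symmetric]] p unfolding vp by simp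
  qed
  have finish: ?thesis if *: "\<And>p q. p \<in> C \<Longrightarrow> q \<in> C \<Longrightarrow> om (v p q m) \<cdot> (p \<cdot> q) = p \<cdot> q"
  proof (cases "m = y")
    case True then show ?thesis using * by (intro clifford_if_right) (simp add: v_def)
  next
    case False then show ?thesis using * by (intro clifford_if_left) (simp add: v_def)
  qed
  show ?thesis
  proof (cases "i = y"; cases "j = y")
    assume "i \<noteq> y" "j = y"
    then have "p \<cdot> q \<cdot> w p q = p \<cdot> q" if "p \<in> C" "q \<in> C" for p q
      using eq[OF that, symmetric] by (simp add: v_def)
    then show ?thesis using absorb by (intro finish) simp
  next
    assume "i \<noteq> y" "j \<noteq> y"
    then have "p \<cdot> p \<cdot> w p q = p \<cdot> q" if "p \<in> C" "q \<in> C" for p q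
      using eq[OF that, symmetric] by (simp add: v_def)
    then have "om p \<cdot> (p \<cdot> q) = p \<cdot> q" if "p \<in> C" "q \<in> C" for p q
      using that square[of p] wC[OF that] assoc[of "om p" "p \<cdot> p" "w p q"] by simp
    then show ?thesis by (rule clifford_if_left)
  next
    assume "i = y" "j = y"
    then have "q \<cdot> q \<cdot> w p q = p \<cdot> q" if "p \<in> C" "q \<in> C" for p q
      using eq[OF that, symmetric] by (simp add: v_def)
    then have "om q \<cdot> (p \<cdot> q) = p \<cdot> q" if "p \<in> C" "q \<in> C" for p q
      using that square[of q] wC[OF that] assoc[of "om q" "q \<cdot> q" "w p q"] by simp
    then show ?thesis by (rule clifford_if_right)
  next
    assume ij: "i = y" "j \<noteq> y"
    have swap: "q \<cdot> p \<cdot> w p q = p \<cdot> q" if "p \<in> C" "q \<in> C" for p q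
      using eq[OF that, symmetric] ij by (simp add: v_def)
    have "om (v p q m) \<cdot> (p \<cdot> q) = p \<cdot> q" if pq: "p \<in> C" "q \<in> C" for p q
    proof -
      have c: "w q p \<in> C" "w p q \<in> C" using wC pq by auto
      have "p \<cdot> q \<cdot> (w q p \<cdot> w p q) = p \<cdot> q"
        using swap[OF pq] swap[OF pq(2,1)] c pq assoc[of "p \<cdot> q" "w q p" "w p q"] by simp
      then have "p \<cdot> q \<cdot> om (w q p \<cdot> w p q) = p \<cdot> q" using right_unit_om c pq by simp
      then have "p \<cdot> q \<cdot> om (w p q) = p \<cdot> q"
        using om_product(2)[OF c] c pq assoc[of "p \<cdot> q" "om (w q p \<cdot> w p q)" "om (w p q)"] by simp
      then have "p \<cdot> q \<cdot> om (v p q m) = p \<cdot> q"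
        using om_eval[OF v[OF pq] m] c pq v[OF pq]
          assoc[of "p \<cdot> q" "om (w p q)" "om (v p q m)"] by (simp add: w_def)
      then show ?thesis using om_central[of "v p q m" "p \<cdot> q"] v[OF pq] pq by simp
    qed
    then show ?thesis by (rule finish)
  qed
qed

text \<open>
  An inverse in \<open>t\<close> makes the product absorb \<open>om\<close> of a variable below it. A word \<open>t\<close> of length two other
  than \<open>xy\<close> and \<open>yx\<close> misses \<open>x\<close> or \<open>y\<close>, so that \<open>p\<close> may be replaced by \<open>om p \<cdot> p\<close>, or \<open>q\<close> by \<open>q \<cdot> om q\<close>.
  The remaining terms are words of length at least three.
\<close>

lemma clifford_of_product_identity:
  assumes sat: "satisfies A (Mul (Var x) (Var y)) t" and xy: "x \<noteq> y" and t: "compound t"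
    "t \<noteq> Mul (Var x) (Var y)" "t \<noteq> Mul (Var y) (Var x)"
  shows "clifford_squares A"
proof (cases "invvars t = {}")
  case False
  then obtain i where i: "i \<in> invvars t" by blast
  define v where "v p q k = (if k = y then q else p)" for p q :: 'a and k
  have *: "om (v p q i) \<cdot> (p \<cdot> q) = p \<cdot> q" if "p \<in> C" "q \<in> C" for p q
  proof -
    have v: "\<forall>k. v p q k \<in> C" using that by (simp add: v_def)
    have "p \<cdot> q = eval_uterm A (v p q) t" using satisfiesD[OF sat, of "v p q"] v xy by (simp add: v_def)
    then show ?thesis using om_invvars[OF v i] by simp
  qed
  show ?thesis
  proof (cases "i = y")
    case True then show ?thesis using * by (intro clifford_if_right) (simp add: v_def)
  next
    case False then show ?thesis using * by (intro clifford_if_left) (simp add: v_def)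
  qed
next
  case True
  show ?thesis
  proof (cases "\<exists>i j. t = Mul (Var i) (Var j)")
    case False
    then obtain i j c where "\<And>v. \<forall>i. v i \<in> C \<Longrightarrow> eval_uterm A v t = v i \<cdot> v j \<cdot> eval_uterm A v c"
      using two_leading_letters[OF True t(1)] by blast
    then show ?thesis using clifford_of_long_word[OF sat xy] by blast
  next
    case short: True
    have "x \<notin> vars t \<or> y \<notin> vars t" using short t xy by auto
    then show ?thesis
    proof
      assume x: "x \<notin> vars t"
      show ?thesis
      proof (rule clifford_if_left)
        fix p q assume pq: "p \<in> C" "q \<in> C"
        have "p' \<cdot> q = eval_uterm A (\<lambda>_. q) t" if "p' \<in> C" for p'
        proof -
          have "p' \<cdot> q = eval_uterm A (\<lambda>k. if k = x then p' else q) t"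
            using satisfiesD[OF sat, of "\<lambda>k. if k = x then p' else q"] pq that xy by simp
          also have "\<dots> = eval_uterm A (\<lambda>_. q) t" using x by (intro eval_cong) auto
          finally show ?thesis .
        qed
        then have "p \<cdot> q = om p \<cdot> p \<cdot> q" using pq by simp
        then show "om p \<cdot> (p \<cdot> q) = p \<cdot> q" using pq by (simp add: assoc)
      qed
    next
      assume y: "y \<notin> vars t"
      show ?thesis
      proof (rule clifford_if_right)
        fix p q assume pq: "p \<in> C" "q \<in> C"
        have "p \<cdot> q' = eval_uterm A (\<lambda>_. p) t" if "q' \<in> C" for q'
        proof -
          have "p \<cdot> q' = eval_uterm A (\<lambda>k. if k = y then q' else p) t"
            using satisfiesD[OF sat, of "\<lambda>k. if k = y then q' else p"] pq that xy by simp
          also have "\<dots> = eval_uterm A (\<lambda>_. p) t" using y by (intro eval_cong) auto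
          finally show ?thesis .
        qed
        then have "p \<cdot> q = p \<cdot> (q \<cdot> om q)" using pq by simp
        then show "om q \<cdot> (p \<cdot> q) = p \<cdot> q" using pq om_central[of q "p \<cdot> q"] om_idem[of q] by (simp add: assoc)
      qed
    qed
  qed
qed

lemma clifford_of_variable_identity:
  assumes "satisfies A (Var i) t" "t \<noteq> Var i"
  shows "clifford_squares A"
proof (rule clifford_if_left)
  fix p q assume pq: "p \<in> C" "q \<in> C"
  have "om p \<cdot> p = p" using satisfies_Var_regular[OF assms pq(1)] om_commute[OF pq(1)] by simp
  then show "om p \<cdot> (p \<cdot> q) = p \<cdot> q" using pq assoc[of "om p" p q] by simp
qed

end

section \<open>The obstruction to codistributivity\<close>

text \<open>
  The semigroup with elements \<open>a\<close>, \<open>b\<close>, \<open>ab = ba\<close> and \<open>0\<close>, coded as \<open>1\<close>, \<open>2\<close>, \<open>3\<close> and \<open>0\<close>.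
\<close>

definition nil_square :: "nat unary_semigroup" where
  "nil_square = \<lparr>carrier = {0, 1, 2, 3},
     mul = (\<lambda>x y. if x = 1 \<and> y = 2 \<or> x = 2 \<and> y = 1 then 3 else 0), pinv = (\<lambda>_. 0)\<rparr>"

text \<open>
  An idempotent \<open>1\<close> acting from the left on \<open>2\<close>, all other products being \<open>0\<close>. A word takes the value
  \<open>2\<close> only if it consists of letters \<open>1\<close> followed by a single letter \<open>2\<close>.
\<close>

definition left_action :: "nat unary_semigroup" where
  "left_action = \<lparr>carrier = {0, 1, 2}, mul = (\<lambda>x y. if x = 1 then y else 0),
     pinv = (\<lambda>x. if x = 1 then 1 else 0)\<rparr>"

definition right_action :: "nat unary_semigroup" where
  "right_action = \<lparr>carrier = {0, 1, 2}, mul = (\<lambda>x y. if y = 1 then x else 0),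
     pinv = (\<lambda>x. if x = 1 then 1 else 0)\<rparr>"

text \<open>
  The identities that fail in \<open>nil_square\<close>, up to exchanging the two sides.
\<close>

definition collapsing :: "uterm \<Rightarrow> uterm \<Rightarrow> bool" where
  "collapsing s t \<longleftrightarrow> (\<exists>i. s = Var i \<and> t \<noteq> Var i) \<or>
     (\<exists>x y. x \<noteq> y \<and> s = Mul (Var x) (Var y) \<and> compound t \<and>
        t \<noteq> Mul (Var x) (Var y) \<and> t \<noteq> Mul (Var y) (Var x))"

lemma algebra_nil_square: "algebra nil_square"
  by (auto simp: algebra_def nil_square_def)

lemma eval_nil_square:
  assumes "compound t"
  shows "(\<exists>x y. x \<noteq> y \<and> t = Mul (Var x) (Var y)) \<or> (\<forall>v. eval_uterm nil_square v t = 0)"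
proof (cases t)
  case (Mul a b)
  have range: "eval_uterm nil_square v u \<in> {0, 3}" if "compound u" for v u
    using that by (cases u) (auto simp: nil_square_def)
  have zero: "eval_uterm nil_square v t = 0" if "compound a \<or> compound b" for v
  proof -
    have "eval_uterm nil_square v a \<in> {0, 3} \<or> eval_uterm nil_square v b \<in> {0, 3}"
      using range that by blast
    then show ?thesis using Mul by (auto simp: nil_square_def)
  qed
  show ?thesis
  proof (cases "compound a \<or> compound b")
    case False
    then obtain x y where "a = Var x" "b = Var y" by (auto simp: compound_def)
    then show ?thesis using Mul by (cases "x = y") (auto simp: nil_square_def)
  qed (use zero in blast)
qed (use assms in \<open>auto simp: nil_square_def\<close>)

lemma not_satisfies_nil_square:
  assumes not: "\<not> satisfies nil_square s t"
  shows "collapsing s t \<or> collapsing t s"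
proof (cases "compound s \<and> compound t")
  case False
  moreover have "s \<noteq> t" using not by (auto simp: satisfies_def)
  ultimately show ?thesis by (auto simp: collapsing_def compound_def)
next
  case True
  have comm: "satisfies nil_square (Mul (Var x) (Var y)) (Mul (Var y) (Var x))" for x y
    by (auto simp: satisfies_def nil_square_def)
  have neq: "s \<noteq> t" using not by (auto simp: satisfies_def)
  have "(\<exists>x y. x \<noteq> y \<and> s = Mul (Var x) (Var y)) \<or> (\<exists>x y. x \<noteq> y \<and> t = Mul (Var x) (Var y))"
    using eval_nil_square True not by (metis satisfies_def)
  then show ?thesis
    using True neq not comm unfolding collapsing_def by metis
qed

text \<open>
  For \<open>s = xy\<close>, the left action with \<open>x\<close> as \<open>1\<close> and \<open>y\<close> as \<open>2\<close> only allows \<open>t\<close> to be a word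
  \<open>x\<dots>xy\<close>, and the right action with these values exchanged only allows a word \<open>xy\<dots>y\<close>. For a
  variable \<open>s\<close>, the single letter \<open>2\<close> would have to be both the last and the first one of \<open>t\<close>.
\<close>

lemma collapsing_not_satisfies:
  assumes "collapsing s t"
  shows "\<not> (satisfies left_action s t \<and> satisfies right_action s t)"
proof
  assume "satisfies left_action s t \<and> satisfies right_action s t"
  then have sat: "satisfies left_action s t" "satisfies right_action s t" by auto
  let ?L = "eval_uterm left_action" and ?R = "eval_uterm right_action"
  have L: "?L v (Mul a b) = (if ?L v a = 1 then ?L v b else 0)"
      "?L v (Inv a) = 1 \<longleftrightarrow> ?L v a = 1" "?L v (Inv a) \<noteq> 2"
    and R: "?R v (Mul a b) = (if ?R v b = 1 then ?R v a else 0)"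
      "?R v (Inv a) = 1 \<longleftrightarrow> ?R v a = 1" "?R v (Inv a) \<noteq> 2"
    for v a b by (simp_all add: left_action_def right_action_def)
  have L1: "?L v a = 1 \<and> ?L v b = c" if "?L v (Mul a b) = c" "c \<noteq> 0" for v a b c
    using that unfolding L by (cases "?L v a = 1") simp_all
  have R1: "?R v b = 1 \<and> ?R v a = c" if "?R v (Mul a b) = c" "c \<noteq> 0" for v a b c
    using that unfolding R by (cases "?R v b = 1") simp_all
  from assms show False
    unfolding collapsing_def
  proof (elim disjE exE conjE)
    fix i assume s: "s = Var i" and t: "t \<noteq> Var i"
    define v where "v k = (if k = i then 2 else 1 :: nat)" for k
    have v: "v k \<in> carrier left_action \<and> v k \<in> carrier right_action" for k
      by (simp add: v_def left_action_def right_action_def)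
    have eq: "?L v t = 2" "?R v t = 2"
      using satisfiesD[OF sat(1), of v] satisfiesD[OF sat(2), of v] v s by (simp_all add: v_def)
    have one: "?L v u = 1 \<Longrightarrow> ?R v u = 1" for u
    proof (induction u)
      case (Mul a b)
      then have "?R v a = 1" "?R v b = 1" using L1[OF Mul.prems] by blast+
      then show ?case by (simp only: R(1) if_True simp_thms)
    next
      case (Inv a)
      then show ?case unfolding L(2) R(2) by blast
    qed (simp add: v_def)
    show False
    proof (cases t)
      case (Var k)
      then show False using eq t by (simp add: v_def split: if_splits)
    next
      case (Mul a b)
      then have "?L v a = 1" "?R v a = 2"
        using L1[of v a b 2] R1[of v a b 2] eq by (simp_all del: eval_uterm.simps)
      then show False using one[of a] by simp
    next
      case (Inv a)
      then show False using eq L(3) by blast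
    qed
  next
    fix x y assume xy: "x \<noteq> y" and s: "s = Mul (Var x) (Var y)" and t: "compound t" "t \<noteq> Mul (Var x) (Var y)"
    define v where "v k = (if k = x then 1 else if k = y then 2 else 0 :: nat)" for k
    define w where "w k = (if k = x then 2 else if k = y then 1 else 0 :: nat)" for k
    have vw: "v k \<in> carrier left_action" "w k \<in> carrier right_action" for k
      by (simp_all add: v_def w_def left_action_def right_action_def)
    have "?L v s = 2" "?R w s = 2"
      using xy unfolding s L(1) R(1) by (simp_all add: v_def w_def)
    then have eq: "?L v t = 2" "?R w t = 2"
      using satisfiesD[OF sat(1), of v] satisfiesD[OF sat(2), of w] vw by simp_all
    have none: "\<not> (?L v u = 1 \<and> ?R w u = 1)" for u
    proof (induction u)
      case (Mul a b)
      then show ?case using L1[of v a b 1] R1[of w a b 1] by (metis one_neq_zero)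
    next
      case (Inv a)
      then show ?case unfolding L(2) R(2) .
    qed (use xy in \<open>simp add: v_def w_def\<close>)
    have x: "u = Var x" if u: "?L v u = 1" "?R w u = 2" for u
    proof (cases u)
      case (Var k)
      then show ?thesis using u by (simp add: v_def split: if_splits)
    next
      case (Mul c d)
      then have "?L v d = 1" "?R w d = 1"
        using L1[of v c d 1] R1[of w c d 2] u by (simp_all del: eval_uterm.simps)
      then show ?thesis using none by blast
    next
      case (Inv c)
      then show ?thesis using u R(3) by blast
    qed
    have y: "u = Var y" if u: "?L v u = 2" "?R w u = 1" for u
    proof (cases u)
      case (Var k)
      then show ?thesis using u by (simp add: v_def split: if_splits)
    next
      case (Mul c d)
      then have "?L v c = 1" "?R w c = 1"
        using L1[of v c d 2] R1[of w c d 1] u by (simp_all del: eval_uterm.simps)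
      then show ?thesis using none by blast
    next
      case (Inv c)
      then show ?thesis using u L(3) by blast
    qed
    show False
    proof (cases t)
      case (Var k)
      then show False using t(1) by simp
    next
      case (Mul a b)
      then have "?L v a = 1" "?L v b = 2" "?R w b = 1" "?R w a = 2"
        using L1[of v a b 2] R1[of w a b 2] eq by (simp_all del: eval_uterm.simps)
      then show False using x y t(2) Mul by blast
    next
      case (Inv a)
      then show False using eq L(3) by blast
    qed
  qed
qed

lemma clifford_of_collapsing:
  assumes "central_idempotents A" and sat: "satisfies A s t" and st: "collapsing s t"
  shows "clifford_squares A"
proof -
  interpret central_idempotents A by fact
  show ?thesis
    using st clifford_of_variable_identity clifford_of_product_identity sat
    unfolding collapsing_def by blast
qed

lemma clifford_squares_unless_nil_square:
  fixes V :: "'a unary_semigroup set"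
  assumes V: "epigroup_variety V" and sp: "strongly_permutative V"
    and h: "inj h" and not: "copy h nil_square \<notin> V"
  shows "clifford_identities \<subseteq> identities V"
proof -
  obtain s t where st: "(s, t) \<in> identities V" "\<not> satisfies (copy h nil_square) s t"
    using in_varietyI[of V "copy h nil_square"] not V algebra_copy[OF h algebra_nil_square]
    by (auto simp: epigroup_variety_def)
  then have "collapsing s t \<or> collapsing t s"
    using not_satisfies_nil_square h by (simp add: satisfies_copy)
  moreover have "(t, s) \<in> identities V" using st(1) by (auto simp: identities_def satisfies_def)
  ultimately obtain a b where ab: "(a, b) \<in> identities V" "collapsing a b" using st(1) by blast
  obtain n \<pi> where \<pi>: "\<pi> permutes {1..n}" "\<pi> 1 \<noteq> 1" "\<pi> n \<noteq> n"
    "\<And>A. A \<in> V \<Longrightarrow> satisfies A (linear_word id n) (linear_word \<pi> n)"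
    using sp by (auto simp: strongly_permutative_def)
  have "clifford_squares A" if A: "A \<in> V" for A
  proof (rule clifford_of_collapsing[OF _ _ ab(2)])
    interpret epi A using V A by (simp add: epigroup_variety_def epigroup_iff)
    show "central_idempotents A" using strongly_permutative_central[OF \<pi>(1-3) \<pi>(4)[OF A]] .
    show "satisfies A a b" using ab(1) A by (auto simp: identities_def)
  qed
  then show ?thesis by (simp add: clifford_identities_iff)
qed

text \<open>
  These identities make every square idempotent, which leaves no choice for the
  pseudoinverse.
\<close>

definition aperiodic_identities :: "(uterm \<times> uterm) set" where
  "aperiodic_identities =
    {(Mul (Mul (Var 0) (Var 1)) (Var 2), Mul (Var 0) (Mul (Var 1) (Var 2))),
     (Inv (Var 0), Mul (Var 0) (Var 0)),
     (Mul (Var 0) (Mul (Var 0) (Var 0)), Mul (Var 0) (Var 0))}"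

definition left_identities :: "(uterm \<times> uterm) set" where
  "left_identities =
    insert (Mul (Var 0) (Var 1), Mul (Mul (Var 0) (Var 0)) (Var 1)) aperiodic_identities"

definition right_identities :: "(uterm \<times> uterm) set" where
  "right_identities =
    insert (Mul (Var 0) (Var 1), Mul (Var 0) (Mul (Var 1) (Var 1))) aperiodic_identities"

lemma epigroup_variety_aperiodic:
  assumes E: "aperiodic_identities \<subseteq> E"
  shows "epigroup_variety (models E)"
  unfolding epigroup_variety_def
proof (intro conjI ballI models_variety)
  fix A :: "'a unary_semigroup" assume "A \<in> models E"
  then have A: "algebra A" and sat: "\<And>s t. (s, t) \<in> aperiodic_identities \<Longrightarrow> satisfies A s t"
    using E by (auto simp: models_def)
  have pinv: "pinv A x = mul A x x" and cube: "mul A x (mul A x x) = mul A x x"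
    if "x \<in> carrier A" for x
    using satisfiesD[OF sat, of "Inv (Var 0)" "Mul (Var 0) (Var 0)" "\<lambda>i. x"]
      satisfiesD[OF sat, of "Mul (Var 0) (Mul (Var 0) (Var 0))" "Mul (Var 0) (Var 0)" "\<lambda>i. x"]
      that by (auto simp: aperiodic_identities_def)
  have as: "mul A (mul A x y) z = mul A x (mul A y z)"
    if "x \<in> carrier A" "y \<in> carrier A" "z \<in> carrier A" for x y z
    using satisfiesD[OF sat, of "Mul (Mul (Var 0) (Var 1)) (Var 2)" "Mul (Var 0) (Mul (Var 1) (Var 2))"
        "\<lambda>i. if i = 0 then x else if i = 1 then y else z"] that
    by (auto simp: aperiodic_identities_def)
  interpret sg A using A as by unfold_locales (auto simp: associative_def)
  have "epi A"
    by unfold_locales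
      (use pinv cube in \<open>auto intro!: exI[of _ "Suc 0"] simp: pw_Suc assoc\<close>)
  then show "epigroup A" by (simp add: epigroup_iff)
qed

lemma identities_of_actions:
  fixes h :: "nat \<Rightarrow> 'a"
  assumes h: "inj h"
  shows "copy h left_action \<in> models left_identities" "copy h right_action \<in> models right_identities"
    "copy h nil_square \<notin> models left_identities" "copy h nil_square \<notin> models right_identities"
proof -
  have "algebra left_action" "algebra right_action"
    by (auto simp: algebra_def left_action_def right_action_def)
  then show "copy h left_action \<in> models left_identities" "copy h right_action \<in> models right_identities"
    using h by (auto simp: models_def left_identities_def right_identities_def aperiodic_identities_def
        algebra_copy satisfies_copy) (auto simp: satisfies_def left_action_def right_action_def)
  have v: "(if i = 0 then 1 else 2 :: nat) \<in> carrier nil_square" for i :: nat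
    by (simp add: nil_square_def)
  have "\<not> satisfies nil_square (Mul (Var 0) (Var 1)) (Mul (Mul (Var 0) (Var 0)) (Var 1))"
    "\<not> satisfies nil_square (Mul (Var 0) (Var 1)) (Mul (Var 0) (Mul (Var 1) (Var 1)))"
    using satisfiesD[of nil_square "Mul (Var 0) (Var 1)" _ "\<lambda>i. if i = 0 then 1 else 2", OF _ v]
    by (force simp: nil_square_def)+
  then show "copy h nil_square \<notin> models left_identities" "copy h nil_square \<notin> models right_identities"
    using h by (auto simp: models_def left_identities_def right_identities_def satisfies_copy)
qed

lemma strongly_permutative_mono:
  "strongly_permutative V \<Longrightarrow> W \<subseteq> V \<Longrightarrow> strongly_permutative W"
  unfolding strongly_permutative_def by blast

text \<open>
  If \<open>nil_square\<close> were in \<open>V\<close>, codistributivity would transfer the identities of Clifford squares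
  from the meets of \<open>V\<close> with \<open>Y\<close> and \<open>Z\<close> to \<open>nil_square\<close>, where \<open>x\<^sup>\<omega>xy = 0\<close>.
\<close>

lemma codistributive_clifford_squares:
  fixes V :: "'a unary_semigroup set"
  assumes inf: "infinite (UNIV :: 'a set)" and V: "epigroup_variety V" and sp: "strongly_permutative V"
    and cod: "codistributive EPI V"
  shows "clifford_identities \<subseteq> identities V"
proof -
  obtain h :: "nat \<Rightarrow> 'a" where h: "inj h" using injection_into_infinite[OF inf] by blast
  let ?N = "copy h nil_square"
  define Y where "Y = (models left_identities :: 'a unary_semigroup set)"
  define Z where "Z = (models right_identities :: 'a unary_semigroup set)"
  note YZ = identities_of_actions[OF h, folded Y_def Z_def]
  have Y: "epigroup_variety Y" and Z: "epigroup_variety Z"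
    unfolding Y_def Z_def left_identities_def right_identities_def
    by (auto intro!: epigroup_variety_aperiodic)
  have "clifford_identities \<subseteq> identities (V \<inter> X)" if "epigroup_variety X" "?N \<notin> X" for X
    by (rule clifford_squares_unless_nil_square[OF epigroup_variety_Int[OF V that(1)] _ h])
      (use strongly_permutative_mono[OF sp] that(2) in auto)
  then have "clifford_identities \<subseteq> identities (V \<inter> Y) \<inter> identities (V \<inter> Z)"
    using Y Z YZ by blast
  also have "\<dots> \<subseteq> identities (V \<inter> models (identities Y \<inter> identities Z))"
    using cod Y Z unfolding codistributive_EPI[OF inf V] by blast
  finally have cs: "clifford_squares A" if "A \<in> V \<inter> models (identities Y \<inter> identities Z)" for A
    using that unfolding clifford_identities_iff by blast
  have "?N \<in> models (identities Y \<inter> identities Z)"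
  proof -
    have "satisfies nil_square s t" if "(s, t) \<in> identities Y \<inter> identities Z" for s t
    proof (rule ccontr)
      assume "\<not> satisfies nil_square s t"
      then have "collapsing s t \<or> collapsing t s" by (rule not_satisfies_nil_square)
      moreover have "satisfies left_action s t" "satisfies right_action s t"
        using that YZ(1,2) h by (auto simp: identities_def satisfies_copy)
      ultimately show False using collapsing_not_satisfies satisfies_sym by blast
    qed
    then show ?thesis using h algebra_copy[OF h algebra_nil_square]
      by (auto simp: models_def satisfies_copy)
  qed
  moreover have "\<not> clifford_squares ?N"
  proof
    assume "clifford_squares ?N"
    then have "satisfies nil_square (Mul (omt (Var 0)) (Mul (Var 0) (Var 1))) (Mul (Var 0) (Var 1))"
      using h by (simp add: clifford_squares_def satisfies_copy)
    moreover have "(if i = 0 then 1 else 2) \<in> carrier nil_square" for i :: nat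
      by (simp add: nil_square_def)
    ultimately show False
      using satisfiesD[of nil_square _ _ "\<lambda>i. if i = 0 then 1 else 2"]
      by (force simp: nil_square_def)
  qed
  ultimately have "?N \<notin> V" using cs by blast
  then show ?thesis by (rule clifford_squares_unless_nil_square[OF V sp h])
qed

theorem theorem1p4:
  fixes V :: "'a unary_semigroup set"
  assumes "infinite (UNIV :: 'a set)"
    and "epigroup_variety V"
    and "strongly_permutative V"
  shows "codistributive EPI V \<longleftrightarrow>
    (\<exists>G X. abelian_group_variety G \<and>
       X \<in> {trivial_variety, SL, ZM, SL \<squnion>\<^bsub>EPI\<^esub> ZM} \<and>
       V = G \<squnion>\<^bsub>EPI\<^esub> X)"
proof -
  have "codistributive EPI V \<longleftrightarrow> (\<forall>A\<in>V. clifford_squares A)"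
    using codistributive_clifford_squares[OF assms] clifford_squares_codistributive[OF assms(1,2)]
    unfolding clifford_identities_iff by blast
  then show ?thesis using clifford_squares_decomposition[OF assms(1,2)] by simp
qed

end
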